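(* Let $X$ be a variety over a field $k$, and let $\mathrm{Bir}(X)^{\mathrm{p-reg}}\subset\mathrm{Bir}(X)$ be the normal subgroup generated by pseudo-regularizable elements. Then $$\mathrm{Bir}(X)^{\mathrm{p-reg}}\subset\mathrm{Ker}(c|_{\mathrm{Bir}(X)}).$$
   Context: A variety over $k$ is an irreducible and reduced separated scheme of finite type over $k$. $\mathrm{Bir}(X)$ is the group of birational maps $X\dashrightarrow X$ over $k$. A birational map $\phi:X\dashrightarrow Y$ is an isomorphism at a (not necessarily closed) point $x\in X$ if there is an open $U\ni x$ such that $\phi|_U$ is an open embedding into $Y$; $\mathrm{Ex}(\phi)\subset X$ is the closed set of points at which $\phi$ is not an isomorphism. $\mathrm{Bir}_m/k$ is the set of birational classes of $m$-dimensional $k$-varieties and $\mathbb{Z}[\mathrm{Bir}_m/k]$ the free abelian group on it. For a birational map $\phi:X\dashrightarrow Y$ of $n$-dimensional $k$-varieties, $$c(\phi)=\sum_{y\in \mathrm{Ex}(\phi^{-1}),\ \mathrm{codim}_Y y=1}[k(y)]-\sum_{x\in \mathrm{Ex}(\phi),\ \mathrm{codim}_X x=1}[k(x)]\in\mathbb{Z}[\mathrm{Bir}_{n-1}/k],$$ where the residue fields are identified with the corresponding birational classes; $c|_{\mathrm{Bir}(X)}:\mathrm{Bir}(X)\to\mathbb{Z}[\mathrm{Bir}_{n-1}/k]$ is a group homomorphism. A pseudo-automorphism of a variety $X'$ is $\gamma\in\mathrm{Bir}(X')$ which is an isomorphism in codimension one, i.e. $\mathrm{Ex}(\gamma)$ and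 $\mathrm{Ex}(\gamma^{-1})$ have codimension $\ge 2$. An element $\phi\in\mathrm{Bir}(X)$ is pseudo-regularizable if $\phi=\alpha^{-1}\circ\gamma\circ\alpha$ for some birational map $\alpha:X\dashrightarrow X'$ to a variety $X'$ (not assumed smooth or projective) and some pseudo-automorphism $\gamma$ of $X'$. *)

theory Defs
  imports
    "HOL-Analysis.Abstract_Topology"
    "HOL-Library.Extended_Nat"
    "HOL-Algebra.QuotRing"
    "HOL-Algebra.Generated_Rings"
    "HOL-Algebra.Free_Abelian_Groups"
begin

section \<open>Topology: irreducible subsets, dimension, codimension\<close>

definition irreducible_in :: "'a topology \<Rightarrow> 'a set \<Rightarrow> bool" where
  "irreducible_in T Z \<longleftrightarrow> Z \<subseteq> topspace T \<and> Z \<noteq> {} \<and>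
     (\<forall>A B. closedin T A \<and> closedin T B \<and> Z \<subseteq> A \<union> B \<longrightarrow> Z \<subseteq> A \<or> Z \<subseteq> B)"

definition irreducible_closed :: "'a topology \<Rightarrow> 'a set \<Rightarrow> bool" where
  "irreducible_closed T Z \<longleftrightarrow> closedin T Z \<and> irreducible_in T Z"

text \<open>A strictly increasing chain \<open>C 0 \<subset> \<dots> \<subset> C n\<close> of irreducible closed subsets has length \<open>n\<close>.\<close>

definition irreducible_chain :: "'a topology \<Rightarrow> (nat \<Rightarrow> 'a set) \<Rightarrow> nat \<Rightarrow> bool" where
  "irreducible_chain T C n \<longleftrightarrow>
     (\<forall>i\<le>n. irreducible_closed T (C i)) \<and> (\<forall>i<n. C i \<subset> C (Suc i))"

definition krull_dim :: "'a topology \<Rightarrow> enat" where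
  "krull_dim T = Sup {enat n |n. \<exists>C. irreducible_chain T C n}"

definition codim_irred :: "'a topology \<Rightarrow> 'a set \<Rightarrow> enat" where
  "codim_irred T Z = Sup {enat n |n. \<exists>C. irreducible_chain T C n \<and> C 0 = Z}"

text \<open>By convention, the empty set has codimension \<open>\<infinity>\<close>.\<close>

definition codim_closed :: "'a topology \<Rightarrow> 'a set \<Rightarrow> enat" where
  "codim_closed T Y = Inf {codim_irred T Z |Z. irreducible_closed T Z \<and> Z \<subseteq> Y}"

definition codim_point :: "'a topology \<Rightarrow> 'a \<Rightarrow> enat" where
  "codim_point T x = codim_irred T (T closure_of {x})"


section \<open>Ringed spaces and their morphisms\<close>

text \<open>
  \<open>sect X U\<close> is the ring of sections over \<open>U\<close> and \<open>restr X U V\<close> is the restriction map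
  from \<open>U\<close> to \<open>V\<close>; both are meaningful only for open sets \<open>V \<subseteq> U\<close>.
\<close>

record ('x, 'r) ringed_space =
  topo :: "'x topology"
  sect :: "'x set \<Rightarrow> 'r ring"
  restr :: "'x set \<Rightarrow> 'x set \<Rightarrow> 'r \<Rightarrow> 'r"

abbreviation points :: "('x, 'r, 'z) ringed_space_scheme \<Rightarrow> 'x set" where
  "points X \<equiv> topspace (topo X)"

abbreviation opn :: "('x, 'r, 'z) ringed_space_scheme \<Rightarrow> 'x set \<Rightarrow> bool" where
  "opn X U \<equiv> openin (topo X) U"

definition presheaf_of_rings :: "('x, 'r, 'z) ringed_space_scheme \<Rightarrow> bool" where
  "presheaf_of_rings X \<longleftrightarrow>
     (\<forall>U. opn X U \<longrightarrow> cring (sect X U)) \<and>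
     (\<forall>U V. opn X U \<and> opn X V \<and> V \<subseteq> U \<longrightarrow> restr X U V \<in> ring_hom (sect X U) (sect X V)) \<and>
     (\<forall>U. opn X U \<longrightarrow> (\<forall>s\<in>carrier (sect X U). restr X U U s = s)) \<and>
     (\<forall>U V W. opn X U \<and> opn X V \<and> opn X W \<and> W \<subseteq> V \<and> V \<subseteq> U \<longrightarrow>
        (\<forall>s\<in>carrier (sect X U). restr X V W (restr X U V s) = restr X U W s))"

definition sheaf_of_rings :: "('x, 'r, 'z) ringed_space_scheme \<Rightarrow> bool" where
  "sheaf_of_rings X \<longleftrightarrow> presheaf_of_rings X \<and>
     (\<forall>\<U>. (\<forall>U\<in>\<U>. opn X U) \<longrightarrow>
        (\<forall>s\<in>carrier (sect X (\<Union>\<U>)). \<forall>t\<in>carrier (sect X (\<Union>\<U>)).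
           (\<forall>U\<in>\<U>. restr X (\<Union>\<U>) U s = restr X (\<Union>\<U>) U t) \<longrightarrow> s = t) \<and>
        (\<forall>\<sigma>. (\<forall>U\<in>\<U>. \<sigma> U \<in> carrier (sect X U)) \<and>
             (\<forall>U\<in>\<U>. \<forall>V\<in>\<U>. restr X U (U \<inter> V) (\<sigma> U) = restr X V (U \<inter> V) (\<sigma> V)) \<longrightarrow>
           (\<exists>s\<in>carrier (sect X (\<Union>\<U>)). \<forall>U\<in>\<U>. restr X (\<Union>\<U>) U s = \<sigma> U)))"

type_synonym ('x, 'r) germ = "('x set \<times> 'r) set"

definition germ_at ::
    "('x, 'r, 'z) ringed_space_scheme \<Rightarrow> 'x \<Rightarrow> 'x set \<Rightarrow> 'r \<Rightarrow> ('x, 'r) germ" where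
  "germ_at X x U s = {(V, t). opn X V \<and> x \<in> V \<and> t \<in> carrier (sect X V) \<and>
     (\<exists>W. opn X W \<and> x \<in> W \<and> W \<subseteq> U \<inter> V \<and> restr X U W s = restr X V W t)}"

definition stalk :: "('x, 'r, 'z) ringed_space_scheme \<Rightarrow> 'x \<Rightarrow> ('x, 'r) germ ring" where
  "stalk X x =
     \<lparr>carrier = {germ_at X x U s |U s. opn X U \<and> x \<in> U \<and> s \<in> carrier (sect X U)},
      monoid.mult = (\<lambda>A B. \<Union>(U, s)\<in>A. \<Union>(V, t)\<in>B. germ_at X x (U \<inter> V)
        (restr X U (U \<inter> V) s \<otimes>\<^bsub>sect X (U \<inter> V)\<^esub> restr X V (U \<inter> V) t)),
      monoid.one = germ_at X x (points X) \<one>\<^bsub>sect X (points X)\<^esub>,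
      ring.zero = germ_at X x (points X) \<zero>\<^bsub>sect X (points X)\<^esub>,
      ring.add = (\<lambda>A B. \<Union>(U, s)\<in>A. \<Union>(V, t)\<in>B. germ_at X x (U \<inter> V)
        (restr X U (U \<inter> V) s \<oplus>\<^bsub>sect X (U \<inter> V)\<^esub> restr X V (U \<inter> V) t))\<rparr>"

definition is_local_ring :: "('a, 'm) ring_scheme \<Rightarrow> bool" where
  "is_local_ring R \<longleftrightarrow> cring R \<and> (\<exists>!M. maximalideal M R)"

definition the_max_ideal :: "('a, 'm) ring_scheme \<Rightarrow> 'a set" where
  "the_max_ideal R = (THE M. maximalideal M R)"

definition locally_ringed_space :: "('x, 'r, 'z) ringed_space_scheme \<Rightarrow> bool" where
  "locally_ringed_space X \<longleftrightarrow>
     sheaf_of_rings X \<and> (\<forall>x\<in>points X. is_local_ring (stalk X x))"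

text \<open>
  A morphism \<open>X \<rightarrow> Y\<close> is a pair of a map on points and a family of comorphisms
  \<open>sect Y V \<rightarrow> sect X (f\<^sup>-\<^sup>1 V)\<close> indexed by the open sets \<open>V\<close> of \<open>Y\<close>. As functions in HOL are
  total, morphisms are compared with \<open>mor_eq\<close>, which ignores values outside the carriers.
\<close>

type_synonym ('x, 'r, 'y, 's) mor = "('x \<Rightarrow> 'y) \<times> ('y set \<Rightarrow> 's \<Rightarrow> 'r)"

definition preim ::
    "('x, 'r, 'z) ringed_space_scheme \<Rightarrow> ('x, 'r, 'y, 's) mor \<Rightarrow> 'y set \<Rightarrow> 'x set" where
  "preim X f V = {x \<in> points X. fst f x \<in> V}"

definition rs_morphism ::
    "('x, 'r, 'z) ringed_space_scheme \<Rightarrow> ('y, 's, 'w) ringed_space_scheme \<Rightarrow>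
     ('x, 'r, 'y, 's) mor \<Rightarrow> bool" where
  "rs_morphism X Y f \<longleftrightarrow>
     continuous_map (topo X) (topo Y) (fst f) \<and>
     (\<forall>V. opn Y V \<longrightarrow> snd f V \<in> ring_hom (sect Y V) (sect X (preim X f V))) \<and>
     (\<forall>V W. opn Y V \<and> opn Y W \<and> W \<subseteq> V \<longrightarrow>
        (\<forall>s\<in>carrier (sect Y V).
           snd f W (restr Y V W s) = restr X (preim X f V) (preim X f W) (snd f V s)))"

text \<open>
  The last clause says that the induced ring homomorphisms on stalks
  \<open>stalk Y (f x) \<rightarrow> stalk X x\<close> are local.
\<close>

definition lrs_morphism ::
    "('x, 'r, 'z) ringed_space_scheme \<Rightarrow> ('y, 's, 'w) ringed_space_scheme \<Rightarrow>
     ('x, 'r, 'y, 's) mor \<Rightarrow> bool" where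
  "lrs_morphism X Y f \<longleftrightarrow> rs_morphism X Y f \<and>
     (\<forall>x\<in>points X. \<forall>V. opn Y V \<and> fst f x \<in> V \<longrightarrow>
        (\<forall>s\<in>carrier (sect Y V).
           germ_at X x (preim X f V) (snd f V s) \<in> Units (stalk X x) \<longrightarrow>
           germ_at Y (fst f x) V s \<in> Units (stalk Y (fst f x))))"

definition mor_eq ::
    "('x, 'r, 'z) ringed_space_scheme \<Rightarrow> ('y, 's, 'w) ringed_space_scheme \<Rightarrow>
     ('x, 'r, 'y, 's) mor \<Rightarrow> ('x, 'r, 'y, 's) mor \<Rightarrow> bool" where
  "mor_eq X Y f g \<longleftrightarrow> (\<forall>x\<in>points X. fst f x = fst g x) \<and>
     (\<forall>V. opn Y V \<longrightarrow> (\<forall>s\<in>carrier (sect Y V). snd f V s = snd g V s))"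

definition mor_id :: "('x, 'r, 'x, 'r) mor" where
  "mor_id = (\<lambda>x. x, \<lambda>V s. s)"

definition mor_comp ::
    "('y, 's, 'w) ringed_space_scheme \<Rightarrow> ('y, 's, 'u, 't) mor \<Rightarrow> ('x, 'r, 'y, 's) mor \<Rightarrow>
     ('x, 'r, 'u, 't) mor" where
  "mor_comp Y g f = (fst g \<circ> fst f, \<lambda>W s. snd f (preim Y g W) (snd g W s))"

definition lrs_iso ::
    "('x, 'r, 'z) ringed_space_scheme \<Rightarrow> ('y, 's, 'w) ringed_space_scheme \<Rightarrow>
     ('x, 'r, 'y, 's) mor \<Rightarrow> bool" where
  "lrs_iso X Y f \<longleftrightarrow> lrs_morphism X Y f \<and>
     (\<exists>g. lrs_morphism Y X g \<and>
        mor_eq X X (mor_comp Y g f) mor_id \<and> mor_eq Y Y (mor_comp X f g) mor_id)"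

definition open_subspace ::
    "('x, 'r, 'z) ringed_space_scheme \<Rightarrow> 'x set \<Rightarrow> ('x, 'r, 'z) ringed_space_scheme" where
  "open_subspace X U = X\<lparr>topo := subtopology (topo X) U\<rparr>"

definition mor_restrict ::
    "('x, 'r, 'z) ringed_space_scheme \<Rightarrow> ('x, 'r, 'y, 's) mor \<Rightarrow> 'x set \<Rightarrow>
     ('x, 'r, 'y, 's) mor" where
  "mor_restrict X f W =
     (fst f, \<lambda>V s. restr X (preim X f V) (preim X f V \<inter> W) (snd f V s))"


section \<open>Localization, spectra and schemes\<close>

text \<open>The fraction \<open>a / s\<close> in the localization of \<open>R\<close> at the prime ideal \<open>p\<close>.\<close>

definition frac_at :: "('a, 'm) ring_scheme \<Rightarrow> 'a set \<Rightarrow> 'a \<Rightarrow> 'a \<Rightarrow> ('a \<times> 'a) set" where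
  "frac_at R p a s = {(b, t). b \<in> carrier R \<and> t \<in> carrier R - p \<and>
     (\<exists>u\<in>carrier R - p. u \<otimes>\<^bsub>R\<^esub> (a \<otimes>\<^bsub>R\<^esub> t) = u \<otimes>\<^bsub>R\<^esub> (b \<otimes>\<^bsub>R\<^esub> s))}"

definition localization_at :: "('a, 'm) ring_scheme \<Rightarrow> 'a set \<Rightarrow> ('a \<times> 'a) set ring" where
  "localization_at R p =
     \<lparr>carrier = {frac_at R p a s |a s. a \<in> carrier R \<and> s \<in> carrier R - p},
      monoid.mult = (\<lambda>A B. \<Union>(a, s)\<in>A. \<Union>(b, t)\<in>B. frac_at R p (a \<otimes>\<^bsub>R\<^esub> b) (s \<otimes>\<^bsub>R\<^esub> t)),
      monoid.one = frac_at R p \<one>\<^bsub>R\<^esub> \<one>\<^bsub>R\<^esub>,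
      ring.zero = frac_at R p \<zero>\<^bsub>R\<^esub> \<one>\<^bsub>R\<^esub>,
      ring.add = (\<lambda>A B. \<Union>(a, s)\<in>A. \<Union>(b, t)\<in>B.
        frac_at R p ((a \<otimes>\<^bsub>R\<^esub> t) \<oplus>\<^bsub>R\<^esub> (b \<otimes>\<^bsub>R\<^esub> s)) (s \<otimes>\<^bsub>R\<^esub> t))\<rparr>"

definition spec_open :: "('a, 'm) ring_scheme \<Rightarrow> 'a set set \<Rightarrow> bool" where
  "spec_open R U \<longleftrightarrow> (\<exists>S\<subseteq>carrier R. U = {p. primeideal p R \<and> \<not> S \<subseteq> p})"

definition spec_topology :: "('a, 'm) ring_scheme \<Rightarrow> 'a set topology" where
  "spec_topology R = topology (spec_open R)"

lemma istopology_spec_open: "istopology (spec_open R)"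
  unfolding istopology_def
proof (intro conjI allI impI)
  fix U V assume "spec_open R U" "spec_open R V"
  then obtain S T where S: "S \<subseteq> carrier R" "U = {p. primeideal p R \<and> \<not> S \<subseteq> p}"
    and T: "T \<subseteq> carrier R" "V = {p. primeideal p R \<and> \<not> T \<subseteq> p}"
    unfolding spec_open_def by blast
  define P where "P = {s \<otimes>\<^bsub>R\<^esub> t |s t. s \<in> S \<and> t \<in> T}"
  have mem: "\<not> P \<subseteq> p \<longleftrightarrow> \<not> S \<subseteq> p \<and> \<not> T \<subseteq> p" if "primeideal p R" for p
  proof -
    interpret primeideal p R by fact
    show ?thesis
      using S(1) T(1) I_prime I_l_closed I_r_closed unfolding P_def by blast
  qed
  have PR: "P \<subseteq> carrier R" if "primeideal p R" for p
  proof -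
    interpret primeideal p R by fact
    show ?thesis using S(1) T(1) unfolding P_def by blast
  qed
  show "spec_open R (U \<inter> V)"
  proof (cases "\<exists>p. primeideal p R")
    case True
    then have "P \<subseteq> carrier R" using PR by blast
    moreover have "U \<inter> V = {p. primeideal p R \<and> \<not> P \<subseteq> p}" using S(2) T(2) mem by blast
    ultimately show ?thesis unfolding spec_open_def by blast
  next
    case False
    then show ?thesis unfolding spec_open_def using S(2) by blast
  qed
next
  fix \<K> assume "\<forall>K\<in>\<K>. spec_open R K"
  then have "\<forall>K\<in>\<K>. \<exists>S\<subseteq>carrier R. K = {p. primeideal p R \<and> \<not> S \<subseteq> p}"
    unfolding spec_open_def by blast
  then obtain S where S: "\<And>K. K \<in> \<K> \<Longrightarrow> S K \<subseteq> carrier R \<and> K = {p. primeideal p R \<and> \<not> S K \<subseteq> p}"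
    by metis
  have "\<Union>\<K> = {p. primeideal p R \<and> \<not> (\<Union>K\<in>\<K>. S K) \<subseteq> p}"
    using S by blast
  moreover have "(\<Union>K\<in>\<K>. S K) \<subseteq> carrier R" using S by blast
  ultimately show "spec_open R (\<Union>\<K>)" unfolding spec_open_def by blast
qed

text \<open>
  Sections of the structure sheaf of \<open>Spec R\<close> over \<open>U\<close> are the functions assigning to each
  \<open>p \<in> U\<close> an element of the localization at \<open>p\<close> that are locally given by a fraction.
\<close>

definition spec_sections ::
    "('a, 'm) ring_scheme \<Rightarrow> 'a set set \<Rightarrow> ('a set \<Rightarrow> ('a \<times> 'a) set) set" where
  "spec_sections R U =
     {\<sigma> \<in> (\<Pi>\<^sub>E p\<in>U. carrier (localization_at R p)).
        \<forall>p\<in>U. \<exists>W. spec_open R W \<and> p \<in> W \<and> W \<subseteq> U \<and>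
          (\<exists>a\<in>carrier R. \<exists>s\<in>carrier R. \<forall>q\<in>W. s \<notin> q \<and> \<sigma> q = frac_at R q a s)}"

definition Spec ::
    "('a, 'm) ring_scheme \<Rightarrow> ('a set, 'a set \<Rightarrow> ('a \<times> 'a) set) ringed_space" where
  "Spec R =
     \<lparr>topo = spec_topology R,
      sect = (\<lambda>U.
        \<lparr>carrier = spec_sections R U,
         monoid.mult = (\<lambda>\<sigma> \<tau>. \<lambda>p\<in>U. \<sigma> p \<otimes>\<^bsub>localization_at R p\<^esub> \<tau> p),
         monoid.one = (\<lambda>p\<in>U. \<one>\<^bsub>localization_at R p\<^esub>),
         ring.zero = (\<lambda>p\<in>U. \<zero>\<^bsub>localization_at R p\<^esub>),
         ring.add = (\<lambda>\<sigma> \<tau>. \<lambda>p\<in>U. \<sigma> p \<oplus>\<^bsub>localization_at R p\<^esub> \<tau> p)\<rparr>),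
      restr = (\<lambda>U V \<sigma>. restrict \<sigma> V)\<rparr>"

text \<open>
  If an open subspace is isomorphic to \<open>Spec R\<close> for some \<open>R\<close>, then \<open>R\<close> is isomorphic to its
  ring of sections; so it suffices to consider the spectrum of the latter.
\<close>

definition affine_open :: "('x, 'r, 'z) ringed_space_scheme \<Rightarrow> 'x set \<Rightarrow> bool" where
  "affine_open X U \<longleftrightarrow> opn X U \<and> (\<exists>f. lrs_iso (open_subspace X U) (Spec (sect X U)) f)"

definition is_scheme :: "('x, 'r, 'z) ringed_space_scheme \<Rightarrow> bool" where
  "is_scheme X \<longleftrightarrow>
     locally_ringed_space X \<and> (\<forall>x\<in>points X. \<exists>U. x \<in> U \<and> affine_open X U)"


section \<open>Varieties over a field\<close>

text \<open>
  The structure morphism \<open>X \<rightarrow> Spec k\<close> is given by the corresponding ring homomorphism from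
  \<open>k\<close> to the global sections of \<open>X\<close>.
\<close>

record ('x, 'r, 'k) k_space = "('x, 'r) ringed_space" +
  struc :: "'k \<Rightarrow> 'r"

definition scheme_over :: "'k ring \<Rightarrow> ('x, 'r, 'k) k_space \<Rightarrow> bool" where
  "scheme_over k X \<longleftrightarrow> is_scheme X \<and> struc X \<in> ring_hom k (sect X (points X))"

definition open_subscheme :: "('x, 'r, 'k) k_space \<Rightarrow> 'x set \<Rightarrow> ('x, 'r, 'k) k_space" where
  "open_subscheme X U =
     (open_subspace X U)\<lparr>struc := (\<lambda>a. restr X (points X) U (struc X a))\<rparr>"

definition k_morphism ::
    "'k ring \<Rightarrow> ('x, 'r, 'k) k_space \<Rightarrow> ('y, 's, 'k) k_space \<Rightarrow> ('x, 'r, 'y, 's) mor \<Rightarrow> bool" where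
  "k_morphism k X Y f \<longleftrightarrow> lrs_morphism X Y f \<and>
     (\<forall>a\<in>carrier k. snd f (points Y) (struc Y a) = struc X a)"

definition reduced_space :: "('x, 'r, 'z) ringed_space_scheme \<Rightarrow> bool" where
  "reduced_space X \<longleftrightarrow>
     (\<forall>U. opn X U \<longrightarrow> (\<forall>s\<in>carrier (sect X U). \<forall>n::nat.
        s [^]\<^bsub>sect X U\<^esub> n = \<zero>\<^bsub>sect X U\<^esub> \<longrightarrow> s = \<zero>\<^bsub>sect X U\<^esub>))"

definition finite_type_over :: "'k ring \<Rightarrow> ('x, 'r, 'k) k_space \<Rightarrow> bool" where
  "finite_type_over k X \<longleftrightarrow>
     (\<exists>\<U>. finite \<U> \<and> \<Union>\<U> = points X \<and>
        (\<forall>U\<in>\<U>. affine_open X U \<and>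
           (\<exists>S. finite S \<and> S \<subseteq> carrier (sect X U) \<and>
              generate_ring (sect X U) (struc (open_subscheme X U) ` carrier k \<union> S)
                = carrier (sect X U))))"

text \<open>
  The diagonal \<open>X \<rightarrow> X \<times>\<^sub>k X\<close> is a closed immersion, spelled out on the affine charts
  \<open>U \<times>\<^sub>k V = Spec (sect X U \<otimes>\<^sub>k sect X V)\<close> of the product: the inverse image of this chart is
  \<open>U \<inter> V\<close>, and \<open>U \<inter> V \<rightarrow> U \<times>\<^sub>k V\<close> is a closed immersion iff \<open>U \<inter> V\<close> is affine and
  \<open>sect X U \<otimes>\<^sub>k sect X V \<rightarrow> sect X (U \<inter> V)\<close> is surjective. The image of the latter map is the
  subring generated by the restrictions of sections over \<open>U\<close> and over \<open>V\<close>.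
\<close>

definition separated_scheme :: "('x, 'r, 'z) ringed_space_scheme \<Rightarrow> bool" where
  "separated_scheme X \<longleftrightarrow>
     (\<forall>U V. affine_open X U \<and> affine_open X V \<longrightarrow>
        affine_open X (U \<inter> V) \<and>
        generate_ring (sect X (U \<inter> V))
            (restr X U (U \<inter> V) ` carrier (sect X U) \<union> restr X V (U \<inter> V) ` carrier (sect X V))
          = carrier (sect X (U \<inter> V)))"

definition variety :: "'k ring \<Rightarrow> ('x, 'r, 'k) k_space \<Rightarrow> bool" where
  "variety k X \<longleftrightarrow> scheme_over k X \<and> irreducible_in (topo X) (points X) \<and>
     reduced_space X \<and> separated_scheme X \<and> finite_type_over k X"


section \<open>Rational and birational maps\<close>

type_synonym ('x, 'r, 'y, 's) rat_map = "('x set \<times> ('x, 'r, 'y, 's) mor) set"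

definition rat_reps ::
    "'k ring \<Rightarrow> ('x, 'r, 'k) k_space \<Rightarrow> ('y, 's, 'k) k_space \<Rightarrow> ('x, 'r, 'y, 's) rat_map" where
  "rat_reps k X Y = {(U, f). opn X U \<and> U \<noteq> {} \<and> k_morphism k (open_subscheme X U) Y f}"

definition rat_rel ::
    "'k ring \<Rightarrow> ('x, 'r, 'k) k_space \<Rightarrow> ('y, 's, 'k) k_space \<Rightarrow>
     (('x set \<times> ('x, 'r, 'y, 's) mor) \<times> ('x set \<times> ('x, 'r, 'y, 's) mor)) set" where
  "rat_rel k X Y = {((U, f), (V, g)). (U, f) \<in> rat_reps k X Y \<and> (V, g) \<in> rat_reps k X Y \<and>
     (\<exists>W. opn X W \<and> W \<noteq> {} \<and> W \<subseteq> U \<inter> V \<and>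
        mor_eq (open_subscheme X W) Y
          (mor_restrict (open_subscheme X U) f W) (mor_restrict (open_subscheme X V) g W))}"

definition rational_map ::
    "'k ring \<Rightarrow> ('x, 'r, 'k) k_space \<Rightarrow> ('y, 's, 'k) k_space \<Rightarrow> ('x, 'r, 'y, 's) rat_map \<Rightarrow> bool"
  where "rational_map k X Y \<phi> \<longleftrightarrow> \<phi> \<in> rat_reps k X Y // rat_rel k X Y"

definition rat_id :: "'k ring \<Rightarrow> ('x, 'r, 'k) k_space \<Rightarrow> ('x, 'r, 'x, 'r) rat_map" where
  "rat_id k X = rat_rel k X X `` {(points X, mor_id)}"

text \<open>
  The class of \<open>g \<circ> f\<close> on \<open>f\<^sup>-\<^sup>1 V\<close>, for representatives \<open>(U, f)\<close> of \<open>\<phi>\<close> and \<open>(V, g)\<close> of \<open>\<psi>\<close>;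
  this is a rational map whenever \<open>\<phi>\<close> is dominant, in particular for birational maps.
\<close>

definition rat_comp ::
    "'k ring \<Rightarrow> ('x, 'r, 'k) k_space \<Rightarrow> ('y, 's, 'k) k_space \<Rightarrow> ('u, 't, 'k) k_space \<Rightarrow>
     ('y, 's, 'u, 't) rat_map \<Rightarrow> ('x, 'r, 'y, 's) rat_map \<Rightarrow> ('x, 'r, 'u, 't) rat_map" where
  "rat_comp k X Y Z \<psi> \<phi> = (\<Union>(U, f)\<in>\<phi>. \<Union>(V, g)\<in>\<psi>.
     let U' = preim (open_subscheme X U) f V in
     rat_rel k X Z ``
       {(U', mor_comp (open_subscheme Y V) g (mor_restrict (open_subscheme X U) f U'))})"

definition open_immersion ::
    "'k ring \<Rightarrow> ('x, 'r, 'k) k_space \<Rightarrow> ('y, 's, 'k) k_space \<Rightarrow> ('x, 'r, 'y, 's) mor \<Rightarrow> bool" where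
  "open_immersion k X Y f \<longleftrightarrow> k_morphism k X Y f \<and>
     (\<exists>V. opn Y V \<and> lrs_iso X (open_subscheme Y V) f)"

text \<open>
  A birational map is a rational map that restricts to an isomorphism between nonempty
  (hence dense) open subschemes.
\<close>

definition birational_map ::
    "'k ring \<Rightarrow> ('x, 'r, 'k) k_space \<Rightarrow> ('y, 's, 'k) k_space \<Rightarrow> ('x, 'r, 'y, 's) rat_map \<Rightarrow> bool"
  where "birational_map k X Y \<phi> \<longleftrightarrow> rational_map k X Y \<phi> \<and>
    (\<exists>(U, f)\<in>\<phi>. open_immersion k (open_subscheme X U) Y f)"

definition birational_inv ::
    "'k ring \<Rightarrow> ('x, 'r, 'k) k_space \<Rightarrow> ('y, 's, 'k) k_space \<Rightarrow>
     ('x, 'r, 'y, 's) rat_map \<Rightarrow> ('y, 's, 'x, 'r) rat_map" where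
  "birational_inv k X Y \<phi> = (THE \<psi>. birational_map k Y X \<psi> \<and>
     rat_comp k X Y X \<psi> \<phi> = rat_id k X \<and> rat_comp k Y X Y \<phi> \<psi> = rat_id k Y)"

definition iso_at ::
    "'k ring \<Rightarrow> ('x, 'r, 'k) k_space \<Rightarrow> ('y, 's, 'k) k_space \<Rightarrow>
     ('x, 'r, 'y, 's) rat_map \<Rightarrow> 'x \<Rightarrow> bool" where
  "iso_at k X Y \<phi> x \<longleftrightarrow>
     (\<exists>(U, f)\<in>\<phi>. x \<in> U \<and> open_immersion k (open_subscheme X U) Y f)"

definition exc_locus ::
    "'k ring \<Rightarrow> ('x, 'r, 'k) k_space \<Rightarrow> ('y, 's, 'k) k_space \<Rightarrow>
     ('x, 'r, 'y, 's) rat_map \<Rightarrow> 'x set" where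
  "exc_locus k X Y \<phi> = {x \<in> points X. \<not> iso_at k X Y \<phi> x}"

definition Bir ::
    "'k ring \<Rightarrow> ('x, 'r, 'k) k_space \<Rightarrow> ('x, 'r, 'x, 'r) rat_map monoid" where
  "Bir k X = \<lparr>carrier = {\<phi>. birational_map k X X \<phi>}, monoid.mult = rat_comp k X X X, one = rat_id k X\<rparr>"


section \<open>Birational classes and the homomorphism \<open>c\<close>\<close>

type_synonym ('x, 'r) res_elem = "('x, 'r) germ set"

definition residue_field :: "('x, 'r, 'k) k_space \<Rightarrow> 'x \<Rightarrow> ('x, 'r) res_elem ring" where
  "residue_field X x = stalk X x Quot the_max_ideal (stalk X x)"

definition residue_struc :: "('x, 'r, 'k) k_space \<Rightarrow> 'x \<Rightarrow> 'k \<Rightarrow> ('x, 'r) res_elem" where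
  "residue_struc X x a =
     the_max_ideal (stalk X x) +>\<^bsub>stalk X x\<^esub> germ_at X x (points X) (struc X a)"

definition k_alg_iso ::
    "'k ring \<Rightarrow> ('a, 'm) ring_scheme \<Rightarrow> ('k \<Rightarrow> 'a) \<Rightarrow> ('b, 'n) ring_scheme \<Rightarrow> ('k \<Rightarrow> 'b) \<Rightarrow> bool" where
  "k_alg_iso k A \<alpha> B \<beta> \<longleftrightarrow> (\<exists>h\<in>ring_iso A B. \<forall>a\<in>carrier k. h (\<alpha> a) = \<beta> a)"

definition generic_point :: "('x, 'r, 'z) ringed_space_scheme \<Rightarrow> 'x" where
  "generic_point X = (THE x. x \<in> points X \<and> topo X closure_of {x} = points X)"

text \<open>
  A birational class has to be a set of varieties carried by fixed types. When comparing
  varieties of type \<open>('x, 'r, 'k) k_space\<close> we let birational classes consist of varieties whose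
  sections are elements of the type containing the residue fields, and whose points are sets of
  such elements. This loses nothing: a variety is determined up to isomorphism by the family of
  its local rings inside its function field, so every field that is finitely generated over \<open>k\<close>
  and whose elements are of type \<open>('x, 'r) res_elem\<close> is the function field of such a variety.
  If \<open>X\<close> has dimension \<open>n \<ge> 1\<close>, every field of transcendence degree \<open>n - 1\<close> that is finitely
  generated over \<open>k\<close> has at most the cardinality of the function field of \<open>X\<close>, so every
  birational class of \<open>(n - 1)\<close>-dimensional varieties is represented.
\<close>

type_synonym ('x, 'r, 'k) model = "(('x, 'r) res_elem set, ('x, 'r) res_elem, 'k) k_space"

definition Bir_classes :: "'k ring \<Rightarrow> enat \<Rightarrow> ('x, 'r, 'k) model set set" where
  "Bir_classes k m =
     {V. variety k V \<and> krull_dim (topo V) = m} //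
     {(V, W). variety k V \<and> krull_dim (topo V) = m \<and> variety k W \<and> krull_dim (topo W) = m \<and>
        (\<exists>\<phi>. birational_map k V W \<phi>)}"

text \<open>The birational class \<open>[k(x)]\<close>: all varieties with function field \<open>k\<close>-isomorphic to \<open>k(x)\<close>.\<close>

definition residue_class :: "'k ring \<Rightarrow> ('x, 'r, 'k) k_space \<Rightarrow> 'x \<Rightarrow> ('x, 'r, 'k) model set" where
  "residue_class k X x = {V. variety k V \<and>
     k_alg_iso k (residue_field V (generic_point V)) (residue_struc V (generic_point V))
       (residue_field X x) (residue_struc X x)}"

text \<open>Both sums are finite, since the exceptional loci are proper closed subsets of
  Noetherian spaces.\<close>

definition c_map ::
    "'k ring \<Rightarrow> ('x, 'r, 'k) k_space \<Rightarrow> ('x, 'r, 'k) k_space \<Rightarrow>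
     ('x, 'r, 'x, 'r) rat_map \<Rightarrow> ('x, 'r, 'k) model set \<Rightarrow>\<^sub>0 int" where
  "c_map k X Y \<phi> =
     (\<Sum>y\<in>{y \<in> exc_locus k Y X (birational_inv k X Y \<phi>). codim_point (topo Y) y = 1}.
        frag_of (residue_class k Y y)) -
     (\<Sum>x\<in>{x \<in> exc_locus k X Y \<phi>. codim_point (topo X) x = 1}.
        frag_of (residue_class k X x))"


section \<open>Pseudo-regularizable elements\<close>

definition pseudo_automorphism ::
    "'k ring \<Rightarrow> ('x, 'r, 'k) k_space \<Rightarrow> ('x, 'r, 'x, 'r) rat_map \<Rightarrow> bool" where
  "pseudo_automorphism k X \<gamma> \<longleftrightarrow> \<gamma> \<in> carrier (Bir k X) \<and>
     codim_closed (topo X) (exc_locus k X X \<gamma>) \<ge> 2 \<and>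
     codim_closed (topo X) (exc_locus k X X (birational_inv k X X \<gamma>)) \<ge> 2"

text \<open>
  The type argument names the types of the points and of the sections of the varieties \<open>X'\<close>
  over which the existential quantifier ranges. By the remark on \<open>model\<close> above, it ranges over
  all varieties birational to \<open>X\<close>, up to isomorphism, as soon as these types are large enough.
\<close>

definition pseudo_regularizable ::
    "('y \<times> 's) itself \<Rightarrow> 'k ring \<Rightarrow> ('x, 'r, 'k) k_space \<Rightarrow> ('x, 'r, 'x, 'r) rat_map \<Rightarrow> bool" where
  "pseudo_regularizable _ k X \<phi> \<longleftrightarrow> \<phi> \<in> carrier (Bir k X) \<and>
     (\<exists>(X' :: ('y, 's, 'k) k_space) \<alpha> \<gamma>.
        variety k X' \<and> birational_map k X X' \<alpha> \<and> pseudo_automorphism k X' \<gamma> \<and>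
        \<phi> = rat_comp k X X' X (birational_inv k X X' \<alpha>) (rat_comp k X X' X' \<gamma> \<alpha>))"

definition normal_closure :: "('g, 'm) monoid_scheme \<Rightarrow> 'g set \<Rightarrow> 'g set" where
  "normal_closure G S = \<Inter>{N. N \<lhd> G \<and> S \<subseteq> N}"

definition Bir_preg ::
    "('y \<times> 's) itself \<Rightarrow> 'k ring \<Rightarrow> ('x, 'r, 'k) k_space \<Rightarrow> ('x, 'r, 'x, 'r) rat_map set" where
  "Bir_preg U k X = normal_closure (Bir k X) {\<phi>. pseudo_regularizable U k X \<phi>}"

end

theory Submission
  imports Defs "HOL-Algebra.Ring_Divisibility"
begin

text \<open>
  For a birational map \<open>\<phi>\<close> from \<open>X\<close> to \<open>Y\<close> represented by an open immersion \<open>f\<close> of some nonempty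
  open \<open>U\<close>, the class \<open>c \<phi>\<close> is the sum of \<open>[k(y)]\<close> over the codimension one points \<open>y\<close> of \<open>Y\<close>
  outside \<open>f U\<close> minus the sum of \<open>[k(x)]\<close> over those of \<open>X\<close> outside \<open>U\<close>, whichever \<open>U\<close> is
  chosen: the points that enter both sums when \<open>U\<close> shrinks are matched by \<open>\<phi>\<close>, which is well
  defined on them because \<open>Y\<close> is separated, and both sums are finite because \<open>X\<close> and \<open>Y\<close> are
  Noetherian. Choosing compatible open sets makes \<open>c\<close> additive under composition, also between
  different varieties. It vanishes on pseudo-automorphisms, which have no exceptional points of
  codimension one, so \<open>c (\<alpha>\<^sup>-\<^sup>1 \<gamma> \<alpha>) = - c \<alpha> + c \<gamma> + c \<alpha> = 0\<close>.
\<close>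

section \<open>Commutative algebra\<close>

text \<open>Two features of the definitions shape the proof. An affine open set \<open>A\<close>
  comes with some isomorphism onto the spectrum of its own ring of sections, not with the canonical
  one. Hence points of \<open>A\<close> are compared through the functions vanishing at them, and
  the passage from primes to points is recovered from irreducibility and reducedness, which make
  restriction to nonempty open sets injective. Sums and products of germs and of fractions, and
  composites of rational maps, are unions over all representatives, so each formula for them begins
  with independence of the representatives.

  The group in which \<open>c\<close> takes values depends on the types of points and sections,
  whereas the varieties \<open>X'\<close> have types of their own. The argument therefore uses a
  version of \<open>c\<close> whose classes live in freely chosen types. Finiteness of the sums is
  essential: a sum over an infinite set is 0 by convention, and the cancellation upon shrinking
  \<open>U\<close> would be lost. It comes from Hilbert's basis theorem, since the codimension one
  points outside \<open>U\<close> give minimal primes of Noetherian rings.\<close>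

lemma UN_pair_const:
  fixes C :: "'e set"
  assumes "(a0, s0) \<in> A" "(b0, t0) \<in> B"
    and "\<And>a s b t. (a, s) \<in> A \<Longrightarrow> (b, t) \<in> B \<Longrightarrow> f a s b t = C"
  shows "(\<Union>(a, s)\<in>A. \<Union>(b, t)\<in>B. f a s b t) = C"
proof (rule Set.set_eqI)
  fix x
  have "x \<in> (\<Union>(a, s)\<in>A. \<Union>(b, t)\<in>B. f a s b t) \<longleftrightarrow>
      (\<exists>a s b t. (a, s) \<in> A \<and> (b, t) \<in> B \<and> x \<in> f a s b t)" by auto
  also have "\<dots> \<longleftrightarrow> x \<in> C" using assms by metis
  finally show "x \<in> (\<Union>(a, s)\<in>A. \<Union>(b, t)\<in>B. f a s b t) \<longleftrightarrow> x \<in> C" .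
qed

section \<open>Prime and maximal ideals from Zorn's lemma\<close>

context cring begin

text \<open>Zorn's lemma, with \<open>M\<close> an arbitrary set: multiplicative sets will give
  primes, and \<open>{\<one>}\<close> gives maximal ideals.\<close>

lemma exists_ideal_maximal_avoiding:
  assumes I: "ideal I R" and M: "I \<inter> M = {}"
  obtains P where "ideal P R" "I \<subseteq> P" "P \<inter> M = {}"
    "\<And>J. ideal J R \<Longrightarrow> P \<subseteq> J \<Longrightarrow> J \<inter> M = {} \<Longrightarrow> J = P"
proof -
  define \<A> where "\<A> = {J. ideal J R \<and> I \<subseteq> J \<and> J \<inter> M = {}}"
  have "\<exists>P\<in>\<A>. \<forall>J\<in>\<A>. P \<subseteq> J \<longrightarrow> J = P"
  proof (rule subset_Zorn)
    fix C assume C: "subset.chain \<A> C"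
    show "\<exists>U\<in>\<A>. \<forall>J\<in>C. J \<subseteq> U"
    proof (cases "C = {}")
      case True
      then show ?thesis using I M by (auto simp: \<A>_def)
    next
      case False
      from C have CA: "C \<subseteq> \<A>" by (simp add: pred_on.chain_def)
      have "subset.chain {J. ideal J R} C"
        using C unfolding pred_on.chain_def \<A>_def by blast
      from chain_Union_is_ideal[OF this] False have "ideal (\<Union>C) R" by simp
      moreover have "I \<subseteq> \<Union>C" "\<Union>C \<inter> M = {}" using CA False by (auto simp: \<A>_def)
      ultimately have "\<Union>C \<in> \<A>" by (simp add: \<A>_def)
      then show ?thesis by blast
    qed
  qed
  then obtain P where P: "P \<in> \<A>" "\<And>J. J \<in> \<A> \<Longrightarrow> P \<subseteq> J \<Longrightarrow> J = P" by blast
  from P(1) have P1: "ideal P R" "I \<subseteq> P" "P \<inter> M = {}" by (auto simp: \<A>_def)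
  show thesis
  proof (rule that[OF P1])
    fix J assume J: "ideal J R" "P \<subseteq> J" "J \<inter> M = {}"
    then have "J \<in> \<A>" using P1(2) by (auto simp: \<A>_def)
    then show "J = P" using P(2) J(2) by blast
  qed
qed

text \<open>The ideal generated by \<open>J\<close> and \<open>a\<close> in the explicit form
  \<open>J + R a\<close>; prime avoidance and the induction on minimal primes both compute with its
  elements.\<close>

lemma ideal_insert_subset:
  assumes J: "ideal J R" and a: "a \<in> carrier R"
  defines "K \<equiv> {j \<oplus> r \<otimes> a |j r. j \<in> J \<and> r \<in> carrier R}"
  shows "ideal K R" "J \<subseteq> K" "a \<in> K"
proof -
  interpret J: ideal J R by fact
  have K: "K = J <+> PIdl a"
    unfolding K_def cgenideal_def set_add_def' by blast
  show "ideal K R" unfolding K by (intro add_ideals J cgenideal_ideal a)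
  show "J \<subseteq> K"
  proof
    fix j assume j: "j \<in> J"
    then have "j = j \<oplus> \<zero> \<otimes> a" using a by simp
    then show "j \<in> K" unfolding K_def using j by blast
  qed
  have "a = \<zero> \<oplus> \<one> \<otimes> a" using a by simp
  then show "a \<in> K" unfolding K_def using J.zero_closed by blast
qed

text \<open>An ideal maximal among those missing \<open>M\<close> is prime: if \<open>a\<close> and
  \<open>b\<close> lie outside \<open>P\<close>, then \<open>P + R a\<close> and
  \<open>P + R b\<close> both meet \<open>M\<close>. The product of the two meeting elements lies in
  \<open>M\<close> but, once \<open>a b\<close> is in \<open>P\<close>, also in
  \<open>P\<close>.\<close>

lemma exists_prime_avoiding:
  assumes I: "ideal I R" and M: "I \<inter> M = {}" "\<one> \<in> M" "M \<subseteq> carrier R"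
    and mult: "\<And>x y. x \<in> M \<Longrightarrow> y \<in> M \<Longrightarrow> x \<otimes> y \<in> M"
  obtains P where "primeideal P R" "I \<subseteq> P" "P \<inter> M = {}"
proof -
  obtain P where P: "ideal P R" "I \<subseteq> P" "P \<inter> M = {}"
    and max: "\<And>J. ideal J R \<Longrightarrow> P \<subseteq> J \<Longrightarrow> J \<inter> M = {} \<Longrightarrow> J = P"
    using exists_ideal_maximal_avoiding[OF I M(1)] by blast
  interpret P: ideal P R by fact
  have "primeideal P R"
  proof (rule primeidealI)
    show "carrier R \<noteq> P" using P(3) M by auto
    fix a b assume ab: "a \<in> carrier R" "b \<in> carrier R" "a \<otimes> b \<in> P"
    have hit: "\<exists>j r. j \<in> P \<and> r \<in> carrier R \<and> j \<oplus> r \<otimes> c \<in> M" if c: "c \<in> carrier R" "c \<notin> P" for c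
    proof -
      note K = ideal_insert_subset[OF P(1) c(1)]
      have "{j \<oplus> r \<otimes> c |j r. j \<in> P \<and> r \<in> carrier R} \<inter> M \<noteq> {}"
        using max[OF K(1,2)] K(3) c(2) by blast
      then show ?thesis by blast
    qed
    show "a \<in> P \<or> b \<in> P"
    proof (rule ccontr)
      assume neg: "\<not> (a \<in> P \<or> b \<in> P)"
      obtain j r where j: "j \<in> P" "r \<in> carrier R" "j \<oplus> r \<otimes> a \<in> M" using hit[of a] ab neg by auto
      obtain i s where i: "i \<in> P" "s \<in> carrier R" "i \<oplus> s \<otimes> b \<in> M" using hit[of b] ab neg by auto
      have c: "j \<in> carrier R" "i \<in> carrier R" using i j by auto
      have eq: "(j \<oplus> r \<otimes> a) \<otimes> (i \<oplus> s \<otimes> b) = (j \<otimes> (i \<oplus> s \<otimes> b)) \<oplus> ((r \<otimes> a) \<otimes> i \<oplus> (r \<otimes> s) \<otimes> (a \<otimes> b))"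
        using c i(2) j(2) ab by algebra
      have "\<dots> \<in> P"
        using c i j ab by (intro P.a_closed P.I_r_closed[OF j(1)] P.I_l_closed[OF i(1)] P.I_l_closed[OF ab(3)]) auto
      then show False using mult[OF j(3) i(3)] eq P(3) by auto
    qed
  qed (use P is_cring in auto)
  then show thesis using that P by blast
qed

text \<open>Otherwise some prime would avoid all powers of \<open>a\<close>; the power 0 puts
  \<open>\<one>\<close> into the multiplicative set.\<close>

lemma nilpotent_if_in_all_primes:
  assumes a: "a \<in> carrier R" and all: "\<And>P. primeideal P R \<Longrightarrow> a \<in> P"
  shows "\<exists>n::nat. a [^] n = \<zero>"
proof (rule ccontr)
  assume neg: "\<nexists>n::nat. a [^] n = \<zero>"
  define M where "M = {a [^] n |n::nat. True}"
  obtain P where P: "primeideal P R" "P \<inter> M = {}"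
  proof (rule exists_prime_avoiding[OF zeroideal, of M])
    show "{\<zero>} \<inter> M = {}" using neg by (auto simp: M_def)
    have "\<one> = a [^] (0::nat)" by simp
    then show "\<one> \<in> M" unfolding M_def by blast
    show "M \<subseteq> carrier R" using a by (auto simp: M_def)
    fix x y assume "x \<in> M" "y \<in> M"
    then show "x \<otimes> y \<in> M" using a by (auto simp: M_def nat_pow_mult)
  qed (use that in blast)
  have "a = a [^] (1::nat)" using a by simp
  then have "a \<in> M" unfolding M_def by blast
  then show False using P all by blast
qed

lemma exists_maximal:
  assumes I: "ideal I R" and "\<one> \<notin> I"
  obtains P where "maximalideal P R" "I \<subseteq> P"
proof -
  obtain P where P: "ideal P R" "I \<subseteq> P" "P \<inter> {\<one>} = {}"
    and max: "\<And>J. ideal J R \<Longrightarrow> P \<subseteq> J \<Longrightarrow> J \<inter> {\<one>} = {} \<Longrightarrow> J = P"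
    using exists_ideal_maximal_avoiding[OF I, of "{\<one>}"] assms(2) by blast
  have "maximalideal P R"
  proof (rule maximalidealI)
    show "carrier R \<noteq> P" using P(3) by auto
    fix J assume J: "ideal J R" "P \<subseteq> J" "J \<subseteq> carrier R"
    then show "J = P \<or> J = carrier R"
      using max[OF J(1,2)] ideal.one_imp_carrier[OF J(1)] by auto
  qed (use P in auto)
  then show thesis using that P by blast
qed

subsection \<open>Finitely generated algebras over a field are Noetherian\<close>

text \<open>\<open>B\<close> may be any subset of the ring, so that ideals of a subring and modules
  of leading coefficients are both of this form while the ambient ring stays fixed. Closure under
  negation follows when \<open>\<ominus> \<one> \<in> B\<close>.\<close>

definition submod :: "'a set \<Rightarrow> 'a set \<Rightarrow> bool" where
  "submod B I \<longleftrightarrow> I \<subseteq> carrier R \<and> \<zero> \<in> I \<and> (\<forall>x\<in>I. \<forall>y\<in>I. x \<oplus> y \<in> I) \<and> (\<forall>b\<in>B. \<forall>x\<in>I. b \<otimes> x \<in> I)"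

text \<open>For a subring \<open>B\<close> this is the ascending chain condition on the ideals of
  \<open>B\<close>, phrased inside the ambient ring so that subrings obtained by adjoining
  generators can be compared.\<close>

definition noeth :: "'a set \<Rightarrow> bool" where
  "noeth B \<longleftrightarrow> (\<forall>I::nat \<Rightarrow> 'a set. (\<forall>n. submod B (I n) \<and> I n \<subseteq> B \<and> I n \<subseteq> I (Suc n)) \<longrightarrow>
     (\<exists>N. \<forall>n\<ge>N. I n = I N))"

text \<open>Polynomials in \<open>a\<close> of degree less than \<open>n\<close> with coefficients in \<open>B\<close>.\<close>

primrec polys :: "'a set \<Rightarrow> 'a \<Rightarrow> nat \<Rightarrow> 'a set" where
  "polys B a 0 = {\<zero>}"
| "polys B a (Suc n) = {c \<otimes> a [^] n \<oplus> p |c p. c \<in> B \<and> p \<in> polys B a n}"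

text \<open>As \<open>a\<close> may be algebraic over \<open>B\<close>, the leading coefficient is
  not a function of the element. What counts is that some polynomial expression of degree at most
  \<open>n\<close> with this coefficient has its value in \<open>I\<close>.\<close>

definition lead :: "'a set \<Rightarrow> 'a \<Rightarrow> nat \<Rightarrow> 'a set \<Rightarrow> 'a set" where
  "lead B a n I = {c \<in> B. \<exists>p\<in>polys B a n. c \<otimes> a [^] n \<oplus> p \<in> I}"

context
  fixes B a assumes B: "subring B R" and a: "a \<in> carrier R"
begin

lemma B_carr: "b \<in> B \<Longrightarrow> b \<in> carrier R" using subringE(1)[OF B] by blast

lemma polys_carr: "p \<in> polys B a n \<Longrightarrow> p \<in> carrier R"
  by (induction n arbitrary: p) (auto simp: B_carr a)

lemma polys_zero: "\<zero> \<in> polys B a n"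
proof (induction n)
  case (Suc n)
  have "\<zero> = \<zero> \<otimes> a [^] n \<oplus> \<zero>" using a by simp
  then show ?case using Suc subringE(2)[OF B] by auto
qed simp

lemma polys_mono: "p \<in> polys B a n \<Longrightarrow> p \<in> polys B a (Suc n)"
proof -
  assume p: "p \<in> polys B a n"
  then have "p = \<zero> \<otimes> a [^] n \<oplus> p" using a polys_carr by simp
  then show ?thesis using p subringE(2)[OF B] by auto
qed

lemma polys_add: "p \<in> polys B a n \<Longrightarrow> q \<in> polys B a n \<Longrightarrow> p \<oplus> q \<in> polys B a n"
proof (induction n arbitrary: p q)
  case (Suc n)
  then obtain c d p' q' where *: "c \<in> B" "d \<in> B" "p' \<in> polys B a n" "q' \<in> polys B a n"
    "p = c \<otimes> a [^] n \<oplus> p'" "q = d \<otimes> a [^] n \<oplus> q'" by auto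
  have "a [^] n \<in> carrier R" "p' \<in> carrier R" "q' \<in> carrier R" "c \<in> carrier R" "d \<in> carrier R"
    using a * polys_carr B_carr by auto
  then have "p \<oplus> q = (c \<oplus> d) \<otimes> a [^] n \<oplus> (p' \<oplus> q')" unfolding * by algebra
  then show ?case using Suc.IH[OF *(3,4)] subringE(7)[OF B *(1,2)] by auto
qed auto

lemma polys_smult: "b \<in> B \<Longrightarrow> p \<in> polys B a n \<Longrightarrow> b \<otimes> p \<in> polys B a n"
proof (induction n arbitrary: p)
  case (Suc n)
  then obtain c p' where *: "c \<in> B" "p' \<in> polys B a n" "p = c \<otimes> a [^] n \<oplus> p'" by auto
  have "a [^] n \<in> carrier R" "p' \<in> carrier R" "c \<in> carrier R" "b \<in> carrier R"
    using a * polys_carr B_carr Suc by auto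
  then have "b \<otimes> p = (b \<otimes> c) \<otimes> a [^] n \<oplus> b \<otimes> p'" unfolding * by algebra
  then show ?case using Suc.IH[OF Suc.prems(1) *(2)] subringE(6)[OF B Suc.prems(1) *(1)] by auto
qed (auto simp: B_carr)

lemma polys_shift: "p \<in> polys B a n \<Longrightarrow> a \<otimes> p \<in> polys B a (Suc n)"
proof (induction n arbitrary: p)
  case (Suc n)
  then obtain c p' where *: "c \<in> B" "p' \<in> polys B a n" "p = c \<otimes> a [^] n \<oplus> p'" by auto
  have c: "a [^] n \<in> carrier R" "p' \<in> carrier R" "c \<in> carrier R" using a * polys_carr B_carr by auto
  have "a \<otimes> p = c \<otimes> (a [^] n \<otimes> a) \<oplus> a \<otimes> p'" unfolding * using a c by algebra
  then have "a \<otimes> p = c \<otimes> a [^] Suc n \<oplus> a \<otimes> p'" by simp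
  then show ?case using Suc.IH[OF *(2)] *(1) unfolding polys.simps(2)[of B a "Suc n"] by blast
next
  case 0
  then show ?case using polys_zero[of "Suc 0"] a by simp
qed

lemma polys_mono_le: "n \<le> m \<Longrightarrow> p \<in> polys B a n \<Longrightarrow> p \<in> polys B a m"
  by (induction rule: dec_induct) (auto simp del: polys.simps intro: polys_mono)

lemma polys_pow: "p \<in> polys B a n \<Longrightarrow> a [^] m \<otimes> p \<in> polys B a (m + n)"
proof (induction m)
  case 0
  then show ?case using polys_carr by simp
next
  case (Suc m)
  have "a [^] Suc m \<otimes> p = a \<otimes> (a [^] m \<otimes> p)"
    using a polys_carr[OF Suc.prems] m_comm m_assoc by simp
  then show ?case using polys_shift[OF Suc.IH[OF Suc.prems]] by simp
qed

lemma polys_mult: "p \<in> polys B a n \<Longrightarrow> q \<in> polys B a m \<Longrightarrow> p \<otimes> q \<in> polys B a (n + m)"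
proof (induction n arbitrary: p)
  case 0
  then show ?case using polys_carr polys_zero by simp
next
  case (Suc n)
  then obtain c p' where *: "c \<in> B" "p' \<in> polys B a n" "p = c \<otimes> a [^] n \<oplus> p'" by auto
  have "a [^] n \<in> carrier R" "p' \<in> carrier R" "c \<in> carrier R" "q \<in> carrier R"
    using a * polys_carr B_carr Suc by auto
  then have "p \<otimes> q = c \<otimes> (a [^] n \<otimes> q) \<oplus> p' \<otimes> q" unfolding * by algebra
  moreover have "c \<otimes> (a [^] n \<otimes> q) \<oplus> p' \<otimes> q \<in> polys B a (n + m)"
    using Suc.IH[OF *(2) Suc.prems(2)] polys_smult[OF *(1) polys_pow[OF Suc.prems(2)]] polys_add by blast
  ultimately show ?case using polys_mono by simp
qed

lemma subring_Union_polys: "subring (\<Union>n. polys B a n) R"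
proof (rule subringI)
  show "(\<Union>n. polys B a n) \<subseteq> carrier R" using polys_carr by blast
  have "\<one> = \<one> \<otimes> a [^] (0::nat) \<oplus> \<zero>" by simp
  then have "\<one> \<in> polys B a 1" using subringE(3)[OF B] unfolding One_nat_def polys.simps by blast
  then show "\<one> \<in> (\<Union>n. polys B a n)" by blast
  fix p q assume "p \<in> (\<Union>n. polys B a n)" "q \<in> (\<Union>n. polys B a n)"
  then obtain n m where *: "p \<in> polys B a n" "q \<in> polys B a m" by blast
  then show "p \<otimes> q \<in> (\<Union>n. polys B a n)" using polys_mult by blast
  have "p \<in> polys B a (max n m)" "q \<in> polys B a (max n m)"
    using * polys_mono_le max.cobounded1 max.cobounded2 by blast+
  then show "p \<oplus> q \<in> (\<Union>n. polys B a n)" using polys_add by blast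
next
  fix p assume "p \<in> (\<Union>n. polys B a n)"
  then obtain n where n: "p \<in> polys B a n" by blast
  have "\<ominus> p = (\<ominus> \<one>) \<otimes> p" using polys_carr[OF n] by (simp add: l_minus)
  then have "\<ominus> p \<in> polys B a n" using polys_smult[OF _ n] subringE(5)[OF B] subringE(3)[OF B] by auto
  then show "\<ominus> p \<in> (\<Union>n. polys B a n)" by blast
qed

lemma lead_submod:
  assumes I: "submod A I" and BA: "B \<subseteq> A"
  shows "submod B (lead B a n I)"
  unfolding submod_def
proof (intro conjI ballI)
  show "lead B a n I \<subseteq> carrier R" using B_carr by (auto simp: lead_def)
  have "\<zero> = \<zero> \<otimes> a [^] n \<oplus> \<zero>" "\<zero> \<in> I" using a I by (auto simp: submod_def)
  then show "\<zero> \<in> lead B a n I"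
    unfolding lead_def using polys_zero subringE(2)[OF B] by (metis (mono_tags, lifting) mem_Collect_eq)
  fix x y assume x: "x \<in> lead B a n I" and y: "y \<in> lead B a n I"
  from x obtain p where p: "x \<in> B" "p \<in> polys B a n" "x \<otimes> a [^] n \<oplus> p \<in> I" by (auto simp: lead_def)
  from y obtain q where q: "y \<in> B" "q \<in> polys B a n" "y \<otimes> a [^] n \<oplus> q \<in> I" by (auto simp: lead_def)
  have "a [^] n \<in> carrier R" "p \<in> carrier R" "q \<in> carrier R" "x \<in> carrier R" "y \<in> carrier R"
    using a p q polys_carr B_carr by auto
  then have "(x \<oplus> y) \<otimes> a [^] n \<oplus> (p \<oplus> q) = (x \<otimes> a [^] n \<oplus> p) \<oplus> (y \<otimes> a [^] n \<oplus> q)" by algebra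
  also have "\<dots> \<in> I" using I p q by (auto simp: submod_def)
  finally show "x \<oplus> y \<in> lead B a n I"
    using polys_add[OF p(2) q(2)] subringE(7)[OF B p(1) q(1)] by (auto simp: lead_def)
next
  fix b x assume b: "b \<in> B" and x: "x \<in> lead B a n I"
  from x obtain p where p: "x \<in> B" "p \<in> polys B a n" "x \<otimes> a [^] n \<oplus> p \<in> I" by (auto simp: lead_def)
  have "a [^] n \<in> carrier R" "p \<in> carrier R" "b \<in> carrier R" "x \<in> carrier R"
    using a p b polys_carr B_carr by auto
  then have "(b \<otimes> x) \<otimes> a [^] n \<oplus> (b \<otimes> p) = b \<otimes> (x \<otimes> a [^] n \<oplus> p)" by algebra
  also have "\<dots> \<in> I" using I p b BA by (auto simp: submod_def)
  finally show "b \<otimes> x \<in> lead B a n I"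
    using polys_smult[OF b p(2)] subringE(6)[OF B b p(1)] by (auto simp: lead_def)
qed

text \<open>Multiplication by \<open>a\<close> raises the degree and keeps the leading
  coefficient.\<close>

lemma lead_Suc:
  assumes I: "submod A I" and aA: "a \<in> A"
  shows "lead B a n I \<subseteq> lead B a (Suc n) I"
proof
  fix x assume "x \<in> lead B a n I"
  then obtain p where p: "x \<in> B" "p \<in> polys B a n" "x \<otimes> a [^] n \<oplus> p \<in> I" by (auto simp: lead_def)
  have c: "a [^] n \<in> carrier R" "p \<in> carrier R" "x \<in> carrier R" using a p polys_carr B_carr by auto
  have "x \<otimes> a [^] Suc n \<oplus> a \<otimes> p = x \<otimes> (a [^] n \<otimes> a) \<oplus> a \<otimes> p" by simp
  also have "\<dots> = a \<otimes> (x \<otimes> a [^] n \<oplus> p)" using a c by algebra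
  also have "\<dots> \<in> I" using I p aA by (auto simp: submod_def)
  finally show "x \<in> lead B a (Suc n) I" using polys_shift[OF p(2)] p(1) unfolding lead_def by blast
qed

text \<open>Induction on the degree: an element of \<open>J\<close> and one of \<open>I\<close> with
  the same leading coefficient differ by an element of \<open>J\<close> of smaller degree, which
  lies in \<open>I\<close> by induction.\<close>

lemma polys_subset_if_lead_eq:
  assumes I: "submod A I" and J: "submod A J" and IJ: "I \<subseteq> J" and m1: "\<ominus> \<one> \<in> A"
    and lead: "\<And>n. lead B a n J \<subseteq> lead B a n I"
  shows "p \<in> polys B a n \<Longrightarrow> p \<in> J \<Longrightarrow> p \<in> I"
proof (induction n arbitrary: p)
  case 0
  then show ?case using I by (auto simp: submod_def)
next
  case (Suc n)
  then obtain c p' where *: "c \<in> B" "p' \<in> polys B a n" "p = c \<otimes> a [^] n \<oplus> p'" by auto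
  then have "c \<in> lead B a n J" using Suc by (auto simp: lead_def)
  then obtain q where q: "q \<in> polys B a n" "c \<otimes> a [^] n \<oplus> q \<in> I"
    using lead by (auto simp: lead_def)
  have c: "a [^] n \<in> carrier R" "p' \<in> carrier R" "q \<in> carrier R" "c \<in> carrier R"
    using a * q polys_carr B_carr by auto
  have "p' \<oplus> (\<ominus> \<one>) \<otimes> q = p \<oplus> (\<ominus> \<one>) \<otimes> (c \<otimes> a [^] n \<oplus> q)" unfolding * using c by algebra
  also have "\<dots> \<in> J" using J m1 IJ q Suc.prems unfolding submod_def by blast
  finally have "p' \<oplus> (\<ominus> \<one>) \<otimes> q \<in> I"
    using subringE(5)[OF B] subringE(3)[OF B]
    by (intro Suc.IH polys_add polys_smult * q) auto
  then have "(p' \<oplus> (\<ominus> \<one>) \<otimes> q) \<oplus> (c \<otimes> a [^] n \<oplus> q) \<in> I" using I q unfolding submod_def by blast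
  moreover have "(p' \<oplus> (\<ominus> \<one>) \<otimes> q) \<oplus> (c \<otimes> a [^] n \<oplus> q) = p" unfolding * using c by algebra
  ultimately show ?case by simp
qed

text \<open>Hilbert's basis theorem for \<open>A = B[a]\<close>. The leading coefficients of the
  chain form an array of ideals of \<open>B\<close>, increasing in the degree and in the index of
  the chain. Once all its rows are constant from a common index \<open>T\<close> on, the chain
  itself is constant by \<open>polys_subset_if_lead_eq\<close>.\<close>

lemma noeth_adjoin:
  assumes nB: "noeth B" and A: "subring A R" "B \<subseteq> A" "a \<in> A" "A \<subseteq> (\<Union>n. polys B a n)"
  shows "noeth A"
  unfolding noeth_def
proof (intro allI impI)
  fix I :: "nat \<Rightarrow> 'a set"
  assume I: "\<forall>n. submod A (I n) \<and> I n \<subseteq> A \<and> I n \<subseteq> I (Suc n)"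
  have Imono: "i \<le> j \<Longrightarrow> I i \<subseteq> I j" for i j using I by (simp add: lift_Suc_mono_le)
  have lead1: "i \<le> j \<Longrightarrow> lead B a n (I i) \<subseteq> lead B a n (I j)" for i j n
    using Imono unfolding lead_def by blast
  have lead2: "n \<le> m \<Longrightarrow> lead B a n (I i) \<subseteq> lead B a m (I i)" for i n m
    using lift_Suc_mono_le[of "\<lambda>n. lead B a n (I i)"] lead_Suc[of A "I i"] I A(3) by blast
  \<comment> \<open>Every row of the array, and its diagonal, is a chain of ideals of
    \<open>B\<close>, to which the assumption on \<open>B\<close> applies.\<close>
  have stab: "\<exists>N. \<forall>n\<ge>N. K n = K N"
    if "\<And>n. K n = lead B a (f n) (I (g n))" "\<And>n. K n \<subseteq> K (Suc n)" for K f g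
    using nB that lead_submod[OF _ A(2)] I unfolding noeth_def
    by (metis (no_types, lifting) lead_def mem_Collect_eq subsetI)
  obtain N where N: "\<And>n. n \<ge> N \<Longrightarrow> lead B a n (I n) = lead B a N (I N)"
  proof -
    have "lead B a n (I n) \<subseteq> lead B a (Suc n) (I (Suc n))" for n
      using lead1[of n "Suc n"] lead2[of n "Suc n"] by (meson le_SucI le_refl subset_trans)
    then show ?thesis using stab[of "\<lambda>n. lead B a n (I n)" "\<lambda>n. n" "\<lambda>n. n"] that by blast
  qed
  \<comment> \<open>The diagonal is constant from \<open>N\<close> on; by monotonicity in both
    directions, so is the whole quadrant beyond it.\<close>
  have big: "lead B a n (I j) = lead B a N (I N)" if "n \<ge> N" "j \<ge> N" for n j
  proof -
    have "lead B a N (I N) \<subseteq> lead B a n (I j)"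
      using lead1[of N j] lead2[of N n] that by blast
    moreover have "lead B a n (I j) \<subseteq> lead B a (max n j) (I (max n j))"
      using lead1[of j "max n j"] lead2[of n "max n j"] by (meson max.cobounded1 max.cobounded2 subset_trans)
    ultimately show ?thesis using N[of "max n j"] that by auto
  qed
  have "\<forall>n. \<exists>M. \<forall>j\<ge>M. lead B a n (I j) = lead B a n (I M)"
  proof
    fix n show "\<exists>M. \<forall>j\<ge>M. lead B a n (I j) = lead B a n (I M)"
      using stab[of "\<lambda>j. lead B a n (I j)" "\<lambda>j. n" "\<lambda>j. j"] lead1 by simp
  qed
  then obtain M where M: "\<And>n j. j \<ge> M n \<Longrightarrow> lead B a n (I j) = lead B a n (I (M n))" by metis
  \<comment> \<open>Below degree \<open>N\<close> only finitely many rows remain, each of which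
    stabilizes at its own index \<open>M n\<close>.\<close>
  define T where "T = Max (insert N (M ` {..<N}))"
  have TN: "T \<ge> N" unfolding T_def by simp
  have TM: "T \<ge> M n" if "n < N" for n unfolding T_def using that by simp
  have "I j = I T" if j: "j \<ge> T" for j
  proof
    show "I T \<subseteq> I j" using Imono j by blast
    have "lead B a n (I j) \<subseteq> lead B a n (I T)" for n
    proof (cases "n < N")
      case True
      then show ?thesis using M[of n j] M[of n T] TM[of n] j by simp
    next
      case False
      then show ?thesis using big[of n j] big[of n T] TN j by simp
    qed
    then have "p \<in> I T" if "p \<in> polys B a n" "p \<in> I j" for p n
      using polys_subset_if_lead_eq[of A "I T" "I j"] I Imono[OF j] that subringE(5)[OF A(1)] subringE(3)[OF A(1)]
      by blast
    then show "I j \<subseteq> I T" using A(4) I by blast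
  qed
  then show "\<exists>N. \<forall>n\<ge>N. I n = I N" by blast
qed

end

text \<open>A field has no ideals but 0 and itself, and so has its image: a nonzero
  \<open>h u\<close> in an ideal yields \<open>h v = h (v / u) h u\<close> for every
  \<open>v\<close>.\<close>

lemma noeth_hom_image_field:
  assumes k: "field k" and h: "h \<in> ring_hom k R"
  shows "subring (h ` carrier k) R" "noeth (h ` carrier k)"
proof -
  interpret k: field k by fact
  interpret h: ring_hom_ring k R h
    using h k.ring_axioms ring_axioms by (simp add: ring_hom_ring_axioms_def ring_hom_ring_def)
  show "subring (h ` carrier k) R" by (rule h.img_is_subring) (rule k.carrier_is_subring)
  have triv: "I = {\<zero>} \<or> I = h ` carrier k" if I: "submod (h ` carrier k) I" "I \<subseteq> h ` carrier k" for I
  proof (cases "I = {\<zero>}")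
    case False
    then obtain x where x: "x \<in> I" "x \<noteq> \<zero>" using I by (auto simp: submod_def)
    then obtain u where u: "u \<in> carrier k" "x = h u" using I by blast
    have u0: "u \<noteq> \<zero>\<^bsub>k\<^esub>" using u x by auto
    then have inv: "inv\<^bsub>k\<^esub> u \<in> carrier k" "inv\<^bsub>k\<^esub> u \<otimes>\<^bsub>k\<^esub> u = \<one>\<^bsub>k\<^esub>"
      using u k.field_Units by auto
    have "h v \<in> I" if v: "v \<in> carrier k" for v
    proof -
      have "h v = h (v \<otimes>\<^bsub>k\<^esub> inv\<^bsub>k\<^esub> u) \<otimes> x"
        using v u inv by (metis h.hom_mult k.m_assoc k.m_closed k.r_one)
      moreover have "h (v \<otimes>\<^bsub>k\<^esub> inv\<^bsub>k\<^esub> u) \<in> h ` carrier k" using v inv by blast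
      ultimately show ?thesis using I(1) x(1) unfolding submod_def by metis
    qed
    then show ?thesis using I(2) by blast
  qed simp
  show "noeth (h ` carrier k)" unfolding noeth_def
  proof (intro allI impI)
    fix I :: "nat \<Rightarrow> 'a set"
    assume I: "\<forall>n. submod (h ` carrier k) (I n) \<and> I n \<subseteq> h ` carrier k \<and> I n \<subseteq> I (Suc n)"
    have mono: "i \<le> j \<Longrightarrow> I i \<subseteq> I j" for i j using I by (simp add: lift_Suc_mono_le)
    show "\<exists>N. \<forall>n\<ge>N. I n = I N"
    proof (cases "\<exists>N. I N = h ` carrier k")
      case True
      then show ?thesis using mono I by blast
    next
      case False
      then have "I n = {\<zero>}" for n using triv I by blast
      then show ?thesis by simp
    qed
  qed
qed

text \<open>Hilbert's basis theorem, once for each generator.\<close>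

lemma noeth_generate:
  assumes B: "subring B R" "noeth B" and S: "finite S" "S \<subseteq> carrier R"
  shows "noeth (generate_ring R (B \<union> S))"
  using S
proof (induction S rule: finite_induct)
  case empty
  have "generate_ring R B = B"
    using generate_ring_min_subring1[OF _ B(1), of B] subringE(1)[OF B(1)] generate_ring.incl by auto
  then show ?case using B(2) by simp
next
  case (insert a S)
  let ?B = "generate_ring R (B \<union> S)" and ?A = "generate_ring R (B \<union> insert a S)"
  have carr: "B \<union> S \<subseteq> carrier R" "B \<union> insert a S \<subseteq> carrier R" "a \<in> carrier R"
    using insert subringE(1)[OF B(1)] by auto
  have sB: "subring ?B R" "subring ?A R" using carr generate_ring_is_subring by auto
  have "?B \<subseteq> ?A"
    by (rule generate_ring_min_subring1[OF carr(1) sB(2)]) (auto intro: generate_ring.incl)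
  moreover have "a \<in> ?A" by (auto intro: generate_ring.incl)
  moreover have "?A \<subseteq> (\<Union>n. polys ?B a n)"
  proof (rule generate_ring_min_subring1[OF carr(2) subring_Union_polys[OF sB(1) carr(3)]])
    show "B \<union> insert a S \<subseteq> (\<Union>n. polys ?B a n)"
    proof
      fix x assume "x \<in> B \<union> insert a S"
      then consider "x \<in> ?B" | "x = a" by (auto intro: generate_ring.incl)
      then show "x \<in> (\<Union>n. polys ?B a n)"
      proof cases
        case 1
        have "x = x \<otimes> a [^] (0::nat) \<oplus> \<zero>" using 1 subringE(1)[OF sB(1)] by auto
        then have "x \<in> polys ?B a 1" using 1 by auto
        then show ?thesis by blast
      next
        case 2
        have "\<one> \<in> polys ?B a 1"
        proof -
          have "\<one> = \<one> \<otimes> a [^] (0::nat) \<oplus> \<zero>" by simp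
          then show ?thesis using subringE(3)[OF sB(1)] unfolding One_nat_def polys.simps by blast
        qed
        from polys_shift[OF sB(1) carr(3) this] have "x \<in> polys ?B a 2" using 2 carr(3) by (simp add: numeral_2_eq_2)
        then show ?thesis by blast
      qed
    qed
  qed
  ultimately show ?case using noeth_adjoin[OF sB(1) carr(3) insert.IH sB(2)] insert.prems by auto
qed

subsection \<open>Minimal primes\<close>

definition minprime :: "'a set \<Rightarrow> 'a set \<Rightarrow> bool" where
  "minprime J P \<longleftrightarrow> primeideal P R \<and> J \<subseteq> P \<and> (\<forall>Q. primeideal Q R \<and> J \<subseteq> Q \<and> Q \<subseteq> P \<longrightarrow> Q = P)"

lemma submod_ideal:
  assumes "ideal I R" shows "submod (carrier R) I"
proof -
  interpret ideal I R by fact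
  show ?thesis unfolding submod_def using a_subset zero_closed I_l_closed by auto
qed

text \<open>The chain condition in the form needed for Noetherian induction.\<close>

lemma wf_ideals:
  assumes "noeth (carrier R)"
  shows "wf {(J, I). ideal I R \<and> ideal J R \<and> I \<subset> J}"
  unfolding wf_iff_no_infinite_down_chain
proof
  assume "\<exists>f. \<forall>i. (f (Suc i), f i) \<in> {(J, I). ideal I R \<and> ideal J R \<and> I \<subset> J}"
  then obtain f where f: "\<And>i. ideal (f i) R" "\<And>i. f i \<subset> f (Suc i)" by blast
  then have "\<exists>N. \<forall>n\<ge>N. f n = f N"
    using assms submod_ideal unfolding noeth_def by (metis psubset_imp_subset submod_def)
  then show False using f(2) by (metis le_SucI le_refl psubset_eq)
qed

text \<open>Noetherian induction: if \<open>J\<close> is proper and not prime, pick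
  \<open>a b\<close> in \<open>J\<close> with \<open>a\<close> and \<open>b\<close> outside. A prime
  over \<open>J\<close> contains \<open>a\<close> or \<open>b\<close>, so a minimal one is minimal
  over \<open>J + R a\<close> or over \<open>J + R b\<close>, both larger than
  \<open>J\<close>.\<close>

theorem finite_minprimes:
  assumes noeth: "noeth (carrier R)" and "ideal J R"
  shows "finite {P. minprime J P}"
  using assms(2)
proof (induction J rule: wf_induct_rule[OF wf_ideals[OF noeth]])
  case (1 J)
  show ?case
  proof (cases "primeideal J R")
    case True
    then have "{P. minprime J P} \<subseteq> {J}" by (auto simp: minprime_def)
    then show ?thesis by (rule finite_subset) simp
  next
    case notprime: False
    show ?thesis
    proof (cases "carrier R = J")
      case True
      then have "{P. minprime J P} = {}"
        unfolding minprime_def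
        by (metis (mono_tags, lifting) Collect_empty_eq ideal.Icarr primeideal.I_notcarr primeideal.axioms(1) subsetI subset_antisym)
      then show ?thesis by simp
    next
      case False
      then obtain a b where ab: "a \<in> carrier R" "b \<in> carrier R" "a \<otimes> b \<in> J" "a \<notin> J" "b \<notin> J"
        using notprime primeidealI[OF \<open>ideal J R\<close> is_cring] by blast
      define K where "K c = {j \<oplus> r \<otimes> c |j r. j \<in> J \<and> r \<in> carrier R}" for c
      have fin: "finite {P. minprime (K c) P}" if c: "c \<in> carrier R" "c \<notin> J" for c
      proof -
        note K = ideal_insert_subset[OF \<open>ideal J R\<close> c(1), folded K_def]
        have "J \<subset> K c" using K c by blast
        then show ?thesis using 1 K(1) by blast
      qed
      have "minprime (K a) P \<or> minprime (K b) P" if P: "minprime J P" for P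
      proof -
        from P interpret P: primeideal P R by (simp add: minprime_def)
        have JK: "J \<subseteq> K c" if "c \<in> carrier R" for c
          using ideal_insert_subset(2)[OF \<open>ideal J R\<close> that] by (simp add: K_def)
        have KP: "minprime (K c) P" if c: "c \<in> carrier R" "c \<in> P" for c
        proof -
          have "K c \<subseteq> P"
            using c P unfolding K_def minprime_def
            by (clarsimp, intro P.a_closed P.I_l_closed) auto
          then show ?thesis using P JK[OF c(1)] unfolding minprime_def by (metis subset_trans)
        qed
        have "a \<in> P \<or> b \<in> P" using P.I_prime ab P by (auto simp: minprime_def)
        then show ?thesis using KP ab(1,2) by auto
      qed
      then have "{P. minprime J P} \<subseteq> {P. minprime (K a) P} \<union> {P. minprime (K b) P}" by blast
      then show ?thesis using fin ab by (meson finite_UnI finite_subset)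
    qed
  qed
qed

end

subsection \<open>Fractions at a prime ideal\<close>

context primeideal begin

lemma diff_mult: "s \<in> carrier R - I \<Longrightarrow> t \<in> carrier R - I \<Longrightarrow> s \<otimes> t \<in> carrier R - I"
  using I_prime by auto

lemma one_diff: "\<one> \<in> carrier R - I"
  using I_notcarr one_imp_carrier by auto

lemma frac_at_sym:
  assumes "(b, t) \<in> frac_at R I a s" "a \<in> carrier R" "s \<in> carrier R - I"
  shows "(a, s) \<in> frac_at R I b t"
proof -
  from assms(1) obtain u where "u \<in> carrier R - I" "u \<otimes> (a \<otimes> t) = u \<otimes> (b \<otimes> s)"
    unfolding frac_at_def by blast
  then have "\<exists>u\<in>carrier R - I. u \<otimes> (b \<otimes> s) = u \<otimes> (a \<otimes> t)" by metis
  then show ?thesis using assms(2,3) unfolding frac_at_def by simp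
qed

text \<open>The multiplier \<open>u \<otimes> w \<otimes> t\<close> includes the middle denominator
  \<open>t\<close>: the two given equations can be chained only after clearing it.\<close>

lemma frac_at_trans:
  assumes bt: "(b, t) \<in> frac_at R I a s" and cv: "(c, v) \<in> frac_at R I b t"
    and a: "a \<in> carrier R" "s \<in> carrier R - I"
  shows "(c, v) \<in> frac_at R I a s"
proof -
  from bt obtain u where u: "u \<in> carrier R - I" "u \<otimes> (a \<otimes> t) = u \<otimes> (b \<otimes> s)"
    "b \<in> carrier R" "t \<in> carrier R - I" unfolding frac_at_def by blast
  from cv obtain w where w: "w \<in> carrier R - I" "w \<otimes> (b \<otimes> v) = w \<otimes> (c \<otimes> t)"
    "c \<in> carrier R" "v \<in> carrier R - I" unfolding frac_at_def by blast
  have "(u \<otimes> w \<otimes> t) \<otimes> (a \<otimes> v) = (w \<otimes> v) \<otimes> (u \<otimes> (a \<otimes> t))"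
    using a u(1,3,4) w(1,3,4) by simp algebra
  also have "\<dots> = (u \<otimes> s) \<otimes> (w \<otimes> (b \<otimes> v))"
    unfolding u(2) using a u(1,3,4) w(1,3,4) by simp algebra
  also have "\<dots> = (u \<otimes> w \<otimes> t) \<otimes> (c \<otimes> s)"
    unfolding w(2) using a u(1,3,4) w(1,3,4) by simp algebra
  finally have "(u \<otimes> w \<otimes> t) \<otimes> (a \<otimes> v) = (u \<otimes> w \<otimes> t) \<otimes> (c \<otimes> s)" .
  moreover have "u \<otimes> w \<otimes> t \<in> carrier R - I" using u w by (intro diff_mult)
  ultimately show ?thesis using w unfolding frac_at_def by blast
qed

lemma frac_at_self:
  assumes "a \<in> carrier R" "s \<in> carrier R - I"
  shows "(a, s) \<in> frac_at R I a s"
  using assms one_diff unfolding frac_at_def by blast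

lemma frac_at_eqI:
  assumes "(b, t) \<in> frac_at R I a s" "a \<in> carrier R" "s \<in> carrier R - I"
  shows "frac_at R I b t = frac_at R I a s"
proof -
  have b: "b \<in> carrier R" "t \<in> carrier R - I" using assms(1) unfolding frac_at_def by auto
  show ?thesis
    using frac_at_trans[OF assms(1) _ assms(2,3)]
      frac_at_trans[OF frac_at_sym[OF assms] _ b] by auto
qed

lemma frac_at_eq_iff:
  assumes "a \<in> carrier R" "s \<in> carrier R - I" "b \<in> carrier R" "t \<in> carrier R - I"
  shows "frac_at R I a s = frac_at R I b t \<longleftrightarrow> (\<exists>u\<in>carrier R - I. u \<otimes> (a \<otimes> t) = u \<otimes> (b \<otimes> s))"
proof
  assume "frac_at R I a s = frac_at R I b t"
  then have "(b, t) \<in> frac_at R I a s" using frac_at_self assms by blast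
  then show "\<exists>u\<in>carrier R - I. u \<otimes> (a \<otimes> t) = u \<otimes> (b \<otimes> s)" unfolding frac_at_def by blast
next
  assume "\<exists>u\<in>carrier R - I. u \<otimes> (a \<otimes> t) = u \<otimes> (b \<otimes> s)"
  then have "(b, t) \<in> frac_at R I a s" using assms unfolding frac_at_def by blast
  from frac_at_eqI[OF this assms(1,2)] show "frac_at R I a s = frac_at R I b t" by simp
qed

text \<open>The product is a union over all pairs of representatives. Step \<open>*\<close> shows
  that all of them give the same class, which is therefore the union.\<close>

lemma localization_mult:
  assumes "a \<in> carrier R" "s \<in> carrier R - I" "b \<in> carrier R" "t \<in> carrier R - I"
  shows "frac_at R I a s \<otimes>\<^bsub>localization_at R I\<^esub> frac_at R I b t = frac_at R I (a \<otimes> b) (s \<otimes> t)"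
proof -
  have *: "frac_at R I (a' \<otimes> b') (s' \<otimes> t') = frac_at R I (a \<otimes> b) (s \<otimes> t)"
    if a': "(a', s') \<in> frac_at R I a s" and b': "(b', t') \<in> frac_at R I b t" for a' s' b' t'
  proof -
    from a' obtain u where u: "u \<in> carrier R - I" "u \<otimes> (a \<otimes> s') = u \<otimes> (a' \<otimes> s)"
      "a' \<in> carrier R" "s' \<in> carrier R - I" unfolding frac_at_def by blast
    from b' obtain w where w: "w \<in> carrier R - I" "w \<otimes> (b \<otimes> t') = w \<otimes> (b' \<otimes> t)"
      "b' \<in> carrier R" "t' \<in> carrier R - I" unfolding frac_at_def by blast
    have "(u \<otimes> w) \<otimes> ((a \<otimes> b) \<otimes> (s' \<otimes> t')) = (u \<otimes> (a \<otimes> s')) \<otimes> (w \<otimes> (b \<otimes> t'))"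
      using assms u(1,3,4) w(1,3,4) by simp algebra
    also have "\<dots> = (u \<otimes> w) \<otimes> ((a' \<otimes> b') \<otimes> (s \<otimes> t))"
      unfolding u(2) w(2) using assms u(1,3,4) w(1,3,4) by simp algebra
    finally have "\<exists>x\<in>carrier R - I. x \<otimes> ((a \<otimes> b) \<otimes> (s' \<otimes> t')) = x \<otimes> ((a' \<otimes> b') \<otimes> (s \<otimes> t))"
      using diff_mult u(1) w(1) by blast
    then show ?thesis
      using frac_at_eq_iff[of "a \<otimes> b" "s \<otimes> t" "a' \<otimes> b'" "s' \<otimes> t'"] assms u w diff_mult by simp
  qed
  show ?thesis unfolding localization_at_def
    using UN_pair_const[OF frac_at_self[OF assms(1,2)] frac_at_self[OF assms(3,4)] *] by simp
qed

lemma localization_add: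
  assumes "a \<in> carrier R" "s \<in> carrier R - I" "b \<in> carrier R" "t \<in> carrier R - I"
  shows "frac_at R I a s \<oplus>\<^bsub>localization_at R I\<^esub> frac_at R I b t = frac_at R I (a \<otimes> t \<oplus> b \<otimes> s) (s \<otimes> t)"
proof -
  have *: "frac_at R I (a' \<otimes> t' \<oplus> b' \<otimes> s') (s' \<otimes> t') = frac_at R I (a \<otimes> t \<oplus> b \<otimes> s) (s \<otimes> t)"
    if a': "(a', s') \<in> frac_at R I a s" and b': "(b', t') \<in> frac_at R I b t" for a' s' b' t'
  proof -
    from a' obtain u where u: "u \<in> carrier R - I" "u \<otimes> (a \<otimes> s') = u \<otimes> (a' \<otimes> s)"
      "a' \<in> carrier R" "s' \<in> carrier R - I" unfolding frac_at_def by blast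
    from b' obtain w where w: "w \<in> carrier R - I" "w \<otimes> (b \<otimes> t') = w \<otimes> (b' \<otimes> t)"
      "b' \<in> carrier R" "t' \<in> carrier R - I" unfolding frac_at_def by blast
    have "(u \<otimes> w) \<otimes> ((a \<otimes> t \<oplus> b \<otimes> s) \<otimes> (s' \<otimes> t'))
        = (w \<otimes> t \<otimes> t') \<otimes> (u \<otimes> (a \<otimes> s')) \<oplus> (u \<otimes> s \<otimes> s') \<otimes> (w \<otimes> (b \<otimes> t'))"
      using assms u(1,3,4) w(1,3,4) by simp algebra
    also have "\<dots> = (u \<otimes> w) \<otimes> ((a' \<otimes> t' \<oplus> b' \<otimes> s') \<otimes> (s \<otimes> t))"
      unfolding u(2) w(2) using assms u(1,3,4) w(1,3,4) by simp algebra
    finally have "\<exists>x\<in>carrier R - I.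
        x \<otimes> ((a \<otimes> t \<oplus> b \<otimes> s) \<otimes> (s' \<otimes> t')) = x \<otimes> ((a' \<otimes> t' \<oplus> b' \<otimes> s') \<otimes> (s \<otimes> t))"
      using diff_mult u(1) w(1) by blast
    then show ?thesis
      using frac_at_eq_iff[of "a \<otimes> t \<oplus> b \<otimes> s" "s \<otimes> t" "a' \<otimes> t' \<oplus> b' \<otimes> s'" "s' \<otimes> t'"]
        assms u w diff_mult by simp
  qed
  show ?thesis unfolding localization_at_def
    using UN_pair_const[OF frac_at_self[OF assms(1,2)] frac_at_self[OF assms(3,4)] *] by simp
qed

lemma frac_at_carrier:
  assumes "a \<in> carrier R" "s \<in> carrier R - I"
  shows "frac_at R I a s \<in> carrier (localization_at R I)"
  using assms unfolding localization_at_def by auto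

end

subsection \<open>The spectrum\<close>

lemma openin_spec [simp]: "openin (spec_topology R) U \<longleftrightarrow> spec_open R U"
  by (simp add: spec_topology_def istopology_spec_open)

lemma topspace_spec [simp]: "topspace (spec_topology R) = {p. primeideal p R}"
proof -
  have "spec_open R {p. primeideal p R}" unfolding spec_open_def
  proof (intro exI conjI)
    show "{p. primeideal p R} = {p. primeideal p R \<and> \<not> carrier R \<subseteq> p}"
      by (auto dest: primeideal.I_notcarr ideal.Icarr[OF primeideal.axioms(1)])
  qed simp
  moreover have "U \<subseteq> {p. primeideal p R}" if "spec_open R U" for U
    using that unfolding spec_open_def by auto
  ultimately show ?thesis unfolding topspace_def openin_spec by blast
qed

definition basic_open :: "('a, 'm) ring_scheme \<Rightarrow> 'a \<Rightarrow> 'a set set" where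
  "basic_open R f = {p. primeideal p R \<and> f \<notin> p}"

lemma spec_open_basic: "f \<in> carrier R \<Longrightarrow> spec_open R (basic_open R f)"
  unfolding spec_open_def basic_open_def by (intro exI[of _ "{f}"]) auto

lemma spec_open_prime: "spec_open R U \<Longrightarrow> p \<in> U \<Longrightarrow> primeideal p R"
  unfolding spec_open_def by auto

lemma spec_open_basic_subset:
  assumes "spec_open R U" "p \<in> U"
  obtains f where "f \<in> carrier R" "p \<in> basic_open R f" "basic_open R f \<subseteq> U"
  using assms unfolding spec_open_def basic_open_def by blast

lemma Spec_sel [simp]:
  "topo (Spec R) = spec_topology R"
  "carrier (sect (Spec R) U) = spec_sections R U"
  "restr (Spec R) U V \<sigma> = restrict \<sigma> V"
  "\<one>\<^bsub>sect (Spec R) U\<^esub> = (\<lambda>p\<in>U. \<one>\<^bsub>localization_at R p\<^esub>)"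
  "\<zero>\<^bsub>sect (Spec R) U\<^esub> = (\<lambda>p\<in>U. \<zero>\<^bsub>localization_at R p\<^esub>)"
  "\<sigma> \<otimes>\<^bsub>sect (Spec R) U\<^esub> \<tau> = (\<lambda>p\<in>U. \<sigma> p \<otimes>\<^bsub>localization_at R p\<^esub> \<tau> p)"
  "\<sigma> \<oplus>\<^bsub>sect (Spec R) U\<^esub> \<tau> = (\<lambda>p\<in>U. \<sigma> p \<oplus>\<^bsub>localization_at R p\<^esub> \<tau> p)"
  by (simp_all add: Spec_def)

lemma localization_one [simp]: "\<one>\<^bsub>localization_at R p\<^esub> = frac_at R p \<one>\<^bsub>R\<^esub> \<one>\<^bsub>R\<^esub>"
  and localization_zero [simp]: "\<zero>\<^bsub>localization_at R p\<^esub> = frac_at R p \<zero>\<^bsub>R\<^esub> \<one>\<^bsub>R\<^esub>"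
  by (simp_all add: localization_at_def)

section \<open>Sections of the spectrum given by a single fraction\<close>

definition frac_sec :: "('a, 'm) ring_scheme \<Rightarrow> 'a set set \<Rightarrow> 'a \<Rightarrow> 'a \<Rightarrow> 'a set \<Rightarrow> ('a \<times> 'a) set" where
  "frac_sec R W a s = (\<lambda>q\<in>W. frac_at R q a s)"

lemma frac_sec_mem:
  assumes "spec_open R W" "a \<in> carrier R" "s \<in> carrier R" "\<And>q. q \<in> W \<Longrightarrow> s \<notin> q"
  shows "frac_sec R W a s \<in> spec_sections R W"
proof -
  have "frac_at R q a s \<in> carrier (localization_at R q)" if "q \<in> W" for q
  proof -
    interpret primeideal q R using assms(1) that by (rule spec_open_prime)
    show ?thesis using assms that by (intro frac_at_carrier) auto
  qed
  moreover have "\<forall>p\<in>W. \<exists>V. spec_open R V \<and> p \<in> V \<and> V \<subseteq> W \<and>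
      (\<exists>b\<in>carrier R. \<exists>t\<in>carrier R. \<forall>q\<in>V. t \<notin> q \<and> frac_sec R W a s q = frac_at R q b t)"
  proof
    fix p assume "p \<in> W"
    have "\<forall>q\<in>W. s \<notin> q \<and> frac_sec R W a s q = frac_at R q a s" using assms(4) by (simp add: frac_sec_def)
    then show "\<exists>V. spec_open R V \<and> p \<in> V \<and> V \<subseteq> W \<and>
      (\<exists>b\<in>carrier R. \<exists>t\<in>carrier R. \<forall>q\<in>V. t \<notin> q \<and> frac_sec R W a s q = frac_at R q b t)"
      using assms(1-3) \<open>p \<in> W\<close> by blast
  qed
  ultimately show ?thesis unfolding spec_sections_def by (simp add: frac_sec_def)
qed

lemma spec_section_local:
  assumes "\<sigma> \<in> spec_sections R U" "p \<in> U"
  obtains W a s where "spec_open R W" "p \<in> W" "W \<subseteq> U" "a \<in> carrier R" "s \<in> carrier R"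
    "\<And>q. q \<in> W \<Longrightarrow> s \<notin> q" "restrict \<sigma> W = frac_sec R W a s"
proof -
  obtain W a s where *: "spec_open R W" "p \<in> W" "W \<subseteq> U" "a \<in> carrier R" "s \<in> carrier R"
    "\<forall>q\<in>W. s \<notin> q \<and> \<sigma> q = frac_at R q a s" using assms unfolding spec_sections_def by blast
  then have "restrict \<sigma> W = frac_sec R W a s" by (simp add: frac_sec_def restrict_def fun_eq_iff)
  then show thesis using that * by blast
qed

lemma frac_sec_mult:
  assumes "spec_open R W" "a \<in> carrier R" "s \<in> carrier R" "\<And>q. q \<in> W \<Longrightarrow> s \<notin> q"
    "b \<in> carrier R" "t \<in> carrier R" "\<And>q. q \<in> W \<Longrightarrow> t \<notin> q"
  shows "frac_sec R W a s \<otimes>\<^bsub>sect (Spec R) W\<^esub> frac_sec R W b t = frac_sec R W (a \<otimes>\<^bsub>R\<^esub> b) (s \<otimes>\<^bsub>R\<^esub> t)"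
proof -
  have "frac_at R q a s \<otimes>\<^bsub>localization_at R q\<^esub> frac_at R q b t = frac_at R q (a \<otimes>\<^bsub>R\<^esub> b) (s \<otimes>\<^bsub>R\<^esub> t)"
    if "q \<in> W" for q
  proof -
    interpret primeideal q R using assms(1) that by (rule spec_open_prime)
    show ?thesis using assms that by (intro localization_mult) auto
  qed
  then show ?thesis by (simp add: frac_sec_def restrict_def fun_eq_iff)
qed

lemma frac_sec_add:
  assumes "spec_open R W" "a \<in> carrier R" "s \<in> carrier R" "\<And>q. q \<in> W \<Longrightarrow> s \<notin> q"
    "b \<in> carrier R" "t \<in> carrier R" "\<And>q. q \<in> W \<Longrightarrow> t \<notin> q"
  shows "frac_sec R W a s \<oplus>\<^bsub>sect (Spec R) W\<^esub> frac_sec R W b t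
    = frac_sec R W (a \<otimes>\<^bsub>R\<^esub> t \<oplus>\<^bsub>R\<^esub> b \<otimes>\<^bsub>R\<^esub> s) (s \<otimes>\<^bsub>R\<^esub> t)"
proof -
  have "frac_at R q a s \<oplus>\<^bsub>localization_at R q\<^esub> frac_at R q b t
      = frac_at R q (a \<otimes>\<^bsub>R\<^esub> t \<oplus>\<^bsub>R\<^esub> b \<otimes>\<^bsub>R\<^esub> s) (s \<otimes>\<^bsub>R\<^esub> t)"
    if "q \<in> W" for q
  proof -
    interpret primeideal q R using assms(1) that by (rule spec_open_prime)
    show ?thesis using assms that by (intro localization_add) auto
  qed
  then show ?thesis by (simp add: frac_sec_def restrict_def fun_eq_iff)
qed

lemma frac_sec_eqI:
  assumes "spec_open R W" "a \<in> carrier R" "s \<in> carrier R" "\<And>q. q \<in> W \<Longrightarrow> s \<notin> q"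
    "b \<in> carrier R" "t \<in> carrier R" "\<And>q. q \<in> W \<Longrightarrow> t \<notin> q"
    "u \<in> carrier R" "\<And>q. q \<in> W \<Longrightarrow> u \<notin> q" "u \<otimes>\<^bsub>R\<^esub> (a \<otimes>\<^bsub>R\<^esub> t) = u \<otimes>\<^bsub>R\<^esub> (b \<otimes>\<^bsub>R\<^esub> s)"
  shows "frac_sec R W a s = frac_sec R W b t"
proof -
  have "frac_at R q a s = frac_at R q b t" if "q \<in> W" for q
  proof -
    interpret primeideal q R using assms(1) that by (rule spec_open_prime)
    show ?thesis using assms that by (subst frac_at_eq_iff) auto
  qed
  then show ?thesis by (simp add: frac_sec_def restrict_def fun_eq_iff)
qed

lemma frac_sec_one [simp]: "\<one>\<^bsub>sect (Spec R) W\<^esub> = frac_sec R W \<one>\<^bsub>R\<^esub> \<one>\<^bsub>R\<^esub>"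
  and frac_sec_zero [simp]: "\<zero>\<^bsub>sect (Spec R) W\<^esub> = frac_sec R W \<zero>\<^bsub>R\<^esub> \<one>\<^bsub>R\<^esub>"
  by (simp_all add: frac_sec_def)

lemma restrict_frac_sec: "V \<subseteq> W \<Longrightarrow> restrict (frac_sec R W a s) V = frac_sec R V a s"
  by (auto simp: frac_sec_def restrict_def fun_eq_iff)

section \<open>Presheaves, germs and stalks\<close>

lemma (in cring) units_ring_hom:
  assumes "cring S" "h \<in> ring_hom R S" "a \<in> Units R"
  shows "h a \<in> Units S"
proof -
  obtain b where "b \<in> carrier R" "b \<otimes> a = \<one>" "a \<otimes> b = \<one>" "a \<in> carrier R"
    using assms(3) unfolding Units_def by blast
  then have "h b \<in> carrier S" "h b \<otimes>\<^bsub>S\<^esub> h a = \<one>\<^bsub>S\<^esub>" "h a \<otimes>\<^bsub>S\<^esub> h b = \<one>\<^bsub>S\<^esub>" "h a \<in> carrier S"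
    using assms(2) by (simp_all add: ring_hom_closed ring_hom_mult[symmetric] ring_hom_one)
  then show ?thesis unfolding Units_def by blast
qed

lemma ring_hom_zero_cring:
  assumes "cring R" "cring S" "h \<in> ring_hom R S"
  shows "h \<zero>\<^bsub>R\<^esub> = \<zero>\<^bsub>S\<^esub>"
  using ring_hom_zero[OF assms(3)] assms(1,2) by (simp add: cring_def)

text \<open>The function \<open>s\<close> on \<open>U\<close> does not vanish at \<open>x\<close>.\<close>

definition nv :: "('x, 'r, 'z) ringed_space_scheme \<Rightarrow> 'x \<Rightarrow> 'x set \<Rightarrow> 'r \<Rightarrow> bool" where
  "nv X x U s \<longleftrightarrow> (\<exists>W. opn X W \<and> x \<in> W \<and> W \<subseteq> U \<and> restr X U W s \<in> Units (sect X W))"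

locale presheaf =
  fixes X :: "('x, 'r, 'z) ringed_space_scheme"
  assumes presheaf: "presheaf_of_rings X"
begin

lemma sect_cring: "opn X U \<Longrightarrow> cring (sect X U)"
  using presheaf unfolding presheaf_of_rings_def by simp

lemma restr_hom: "opn X U \<Longrightarrow> opn X V \<Longrightarrow> V \<subseteq> U \<Longrightarrow> restr X U V \<in> ring_hom (sect X U) (sect X V)"
  using presheaf unfolding presheaf_of_rings_def by simp

lemma restr_id [simp]: "opn X U \<Longrightarrow> s \<in> carrier (sect X U) \<Longrightarrow> restr X U U s = s"
  using presheaf unfolding presheaf_of_rings_def by simp

lemma restr_restr [simp]:
  "opn X U \<Longrightarrow> opn X V \<Longrightarrow> opn X W \<Longrightarrow> W \<subseteq> V \<Longrightarrow> V \<subseteq> U \<Longrightarrow> s \<in> carrier (sect X U) \<Longrightarrow>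
   restr X V W (restr X U V s) = restr X U W s"
  using presheaf unfolding presheaf_of_rings_def by simp

lemma restr_closed [simp]:
  "opn X U \<Longrightarrow> opn X V \<Longrightarrow> V \<subseteq> U \<Longrightarrow> s \<in> carrier (sect X U) \<Longrightarrow> restr X U V s \<in> carrier (sect X V)"
  by (rule ring_hom_closed[OF restr_hom])

lemma restr_one: "opn X U \<Longrightarrow> opn X V \<Longrightarrow> V \<subseteq> U \<Longrightarrow> restr X U V \<one>\<^bsub>sect X U\<^esub> = \<one>\<^bsub>sect X V\<^esub>"
  by (rule ring_hom_one[OF restr_hom])

lemma restr_zero: "opn X U \<Longrightarrow> opn X V \<Longrightarrow> V \<subseteq> U \<Longrightarrow> restr X U V \<zero>\<^bsub>sect X U\<^esub> = \<zero>\<^bsub>sect X V\<^esub>"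
  using ring_hom_zero_cring[OF sect_cring sect_cring restr_hom] by blast

lemma restr_mult: "opn X U \<Longrightarrow> opn X V \<Longrightarrow> V \<subseteq> U \<Longrightarrow> s \<in> carrier (sect X U) \<Longrightarrow> t \<in> carrier (sect X U) \<Longrightarrow>
    restr X U V (s \<otimes>\<^bsub>sect X U\<^esub> t) = restr X U V s \<otimes>\<^bsub>sect X V\<^esub> restr X U V t"
  by (rule ring_hom_mult[OF restr_hom])

lemma restr_add: "opn X U \<Longrightarrow> opn X V \<Longrightarrow> V \<subseteq> U \<Longrightarrow> s \<in> carrier (sect X U) \<Longrightarrow> t \<in> carrier (sect X U) \<Longrightarrow>
    restr X U V (s \<oplus>\<^bsub>sect X U\<^esub> t) = restr X U V s \<oplus>\<^bsub>sect X V\<^esub> restr X U V t"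
  by (rule ring_hom_add[OF restr_hom])

lemma restr_minus:
  assumes "opn X U" "opn X V" "V \<subseteq> U" "s \<in> carrier (sect X U)"
  shows "restr X U V (\<ominus>\<^bsub>sect X U\<^esub> s) = \<ominus>\<^bsub>sect X V\<^esub> restr X U V s"
proof -
  interpret ring_hom_cring "sect X U" "sect X V" "restr X U V"
    using sect_cring restr_hom assms by (simp add: ring_hom_cring_def ring_hom_cring_axioms_def)
  show ?thesis using assms by simp
qed

lemma restr_unit: "opn X U \<Longrightarrow> opn X V \<Longrightarrow> V \<subseteq> U \<Longrightarrow> s \<in> Units (sect X U) \<Longrightarrow> restr X U V s \<in> Units (sect X V)"
  using cring.units_ring_hom[OF sect_cring sect_cring restr_hom] by blast

lemma germ_self: "opn X U \<Longrightarrow> x \<in> U \<Longrightarrow> s \<in> carrier (sect X U) \<Longrightarrow> (U, s) \<in> germ_at X x U s"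
  unfolding germ_at_def by auto

lemma germ_eqI:
  assumes "(V, t) \<in> germ_at X x U s" "opn X U" "x \<in> U" "s \<in> carrier (sect X U)"
  shows "germ_at X x V t = germ_at X x U s"
proof -
  from assms(1) obtain W where W: "opn X W" "x \<in> W" "W \<subseteq> U \<inter> V" "restr X U W s = restr X V W t"
    and V: "opn X V" "x \<in> V" "t \<in> carrier (sect X V)" unfolding germ_at_def by blast
  \<comment> \<open>Two sections that agree near \<open>x\<close> with a third one agree with each
    other near \<open>x\<close>; one statement serves both inclusions.\<close>
  have aux: "\<exists>W'. opn X W' \<and> x \<in> W' \<and> W' \<subseteq> B \<inter> C \<and> restr X B W' b = restr X C W' c"
    if A: "opn X A" "x \<in> A" "a \<in> carrier (sect X A)" and B: "opn X B" "b \<in> carrier (sect X B)"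
      and C: "opn X C" "c \<in> carrier (sect X C)"
      and 1: "opn X W" "x \<in> W" "W \<subseteq> A \<inter> B" "restr X A W a = restr X B W b"
      and 2: "opn X W'" "x \<in> W'" "W' \<subseteq> A \<inter> C" "restr X A W' a = restr X C W' c"
    for A B C a b c W W'
  proof -
    have o: "opn X (W \<inter> W')" using 1 2 by blast
    have "restr X B (W \<inter> W') b = restr X W (W \<inter> W') (restr X B W b)" using B 1(1-3) 2(1-3) o by auto
    also have "\<dots> = restr X A (W \<inter> W') a" unfolding 1(4)[symmetric] using A 1(1-3) 2(1-3) o by auto
    also have "\<dots> = restr X W' (W \<inter> W') (restr X A W' a)" using A 1(1-3) 2(1-3) o by auto
    also have "\<dots> = restr X C (W \<inter> W') c" unfolding 2(4) using C 1(1-3) 2(1-3) o by auto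
    finally show ?thesis using o 1 2 by blast
  qed
  show ?thesis
  proof (intro subset_antisym subsetI)
    fix z assume "z \<in> germ_at X x V t"
    then obtain C c W' where z: "z = (C, c)" "opn X C" "x \<in> C" "c \<in> carrier (sect X C)"
      "opn X W'" "x \<in> W'" "W' \<subseteq> V \<inter> C" "restr X V W' t = restr X C W' c"
      unfolding germ_at_def by blast
    from aux[OF V assms(2,4) z(2,4) W(1,2) _ W(4)[symmetric] z(5-8)] W(3) z
    show "z \<in> germ_at X x U s" unfolding germ_at_def by blast
  next
    fix z assume "z \<in> germ_at X x U s"
    then obtain C c W' where z: "z = (C, c)" "opn X C" "x \<in> C" "c \<in> carrier (sect X C)"
      "opn X W'" "x \<in> W'" "W' \<subseteq> U \<inter> C" "restr X U W' s = restr X C W' c"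
      unfolding germ_at_def by blast
    from aux[OF assms(2-4) V(1,3) z(2,4) W z(5-8)] z
    show "z \<in> germ_at X x V t" unfolding germ_at_def by blast
  qed
qed

lemma germ_eq_iff:
  assumes "opn X U" "x \<in> U" "s \<in> carrier (sect X U)" "opn X V" "x \<in> V" "t \<in> carrier (sect X V)"
  shows "germ_at X x U s = germ_at X x V t \<longleftrightarrow>
    (\<exists>W. opn X W \<and> x \<in> W \<and> W \<subseteq> U \<inter> V \<and> restr X U W s = restr X V W t)"
proof
  assume "germ_at X x U s = germ_at X x V t"
  then have "(V, t) \<in> germ_at X x U s" using germ_self assms by blast
  then show "\<exists>W. opn X W \<and> x \<in> W \<and> W \<subseteq> U \<inter> V \<and> restr X U W s = restr X V W t"
    unfolding germ_at_def by blast
next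
  assume "\<exists>W. opn X W \<and> x \<in> W \<and> W \<subseteq> U \<inter> V \<and> restr X U W s = restr X V W t"
  then have "(V, t) \<in> germ_at X x U s" using assms unfolding germ_at_def by blast
  from germ_eqI[OF this assms(1-3)] show "germ_at X x U s = germ_at X x V t" by simp
qed

lemma germ_restr:
  assumes "opn X U" "opn X V" "x \<in> V" "V \<subseteq> U" "s \<in> carrier (sect X U)"
  shows "germ_at X x V (restr X U V s) = germ_at X x U s"
proof (subst germ_eq_iff)
  show "\<exists>W. opn X W \<and> x \<in> W \<and> W \<subseteq> V \<inter> U \<and> restr X V W (restr X U V s) = restr X U W s"
    using assms by (intro exI[of _ V]) auto
qed (use assms in auto)

lemma stalk_rep:
  assumes "g \<in> carrier (stalk X x)"
  obtains U s where "opn X U" "x \<in> U" "s \<in> carrier (sect X U)" "g = germ_at X x U s"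
  using assms unfolding stalk_def by auto

text \<open>A germ has a representative on every small enough neighbourhood, so several germs can be
  moved to a common one.\<close>

lemma stalk_rep_restr:
  assumes "g \<in> carrier (stalk X x)"
  obtains U where "opn X U" "x \<in> U"
    "\<And>V. opn X V \<Longrightarrow> V \<subseteq> U \<Longrightarrow> x \<in> V \<Longrightarrow> \<exists>s\<in>carrier (sect X V). g = germ_at X x V s"
proof -
  obtain U s where U: "opn X U" "x \<in> U" "s \<in> carrier (sect X U)" "g = germ_at X x U s"
    using stalk_rep assms by blast
  show thesis
  proof (rule that[OF U(1,2)])
    fix V assume "opn X V" "V \<subseteq> U" "x \<in> V"
    then show "\<exists>s\<in>carrier (sect X V). g = germ_at X x V s"
      using U germ_restr[of U V x s] by (intro bexI[of _ "restr X U V s"]) auto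
  qed
qed

lemma germ_closed [simp]:
  "opn X U \<Longrightarrow> x \<in> U \<Longrightarrow> s \<in> carrier (sect X U) \<Longrightarrow> germ_at X x U s \<in> carrier (stalk X x)"
  unfolding stalk_def by auto

lemma stalk_one: "opn X U \<Longrightarrow> x \<in> U \<Longrightarrow> \<one>\<^bsub>stalk X x\<^esub> = germ_at X x U \<one>\<^bsub>sect X U\<^esub>"
proof -
  assume U: "opn X U" "x \<in> U"
  interpret P: cring "sect X (points X)" using sect_cring by simp
  have "U \<subseteq> points X" using U openin_subset by blast
  then show ?thesis unfolding stalk_def
    using germ_restr[of "points X" U x "\<one>\<^bsub>sect X (points X)\<^esub>"] restr_one[of "points X" U] U by simp
qed

lemma stalk_zero: "opn X U \<Longrightarrow> x \<in> U \<Longrightarrow> \<zero>\<^bsub>stalk X x\<^esub> = germ_at X x U \<zero>\<^bsub>sect X U\<^esub>"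
proof -
  assume U: "opn X U" "x \<in> U"
  interpret P: cring "sect X (points X)" using sect_cring by simp
  have "U \<subseteq> points X" using U openin_subset by blast
  then show ?thesis unfolding stalk_def
    using germ_restr[of "points X" U x "\<zero>\<^bsub>sect X (points X)\<^esub>"] restr_zero[of "points X" U] U by simp
qed

text \<open>\<open>p\<close> stands for the product or the sum of sections. Commuting with
  restriction is what makes the germ of the result independent of the representatives.\<close>

lemma stalk_op_aux:
  assumes op: "\<And>U V s t. opn X U \<Longrightarrow> opn X V \<Longrightarrow> V \<subseteq> U \<Longrightarrow> s \<in> carrier (sect X U) \<Longrightarrow> t \<in> carrier (sect X U) \<Longrightarrow>
      restr X U V (p U s t) = p V (restr X U V s) (restr X U V t)"
    and cl: "\<And>U s t. opn X U \<Longrightarrow> s \<in> carrier (sect X U) \<Longrightarrow> t \<in> carrier (sect X U) \<Longrightarrow> p U s t \<in> carrier (sect X U)"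
    and U: "opn X U" "x \<in> U" "s \<in> carrier (sect X U)" "t \<in> carrier (sect X U)"
    and s: "(A, a) \<in> germ_at X x U s" and t: "(B, b) \<in> germ_at X x U t"
  shows "germ_at X x (A \<inter> B) (p (A \<inter> B) (restr X A (A \<inter> B) a) (restr X B (A \<inter> B) b)) = germ_at X x U (p U s t)"
proof -
  from s obtain V where V: "opn X V" "x \<in> V" "V \<subseteq> U \<inter> A" "restr X U V s = restr X A V a"
    and A: "opn X A" "x \<in> A" "a \<in> carrier (sect X A)" unfolding germ_at_def by blast
  from t obtain W where W: "opn X W" "x \<in> W" "W \<subseteq> U \<inter> B" "restr X U W t = restr X B W b"
    and B: "opn X B" "x \<in> B" "b \<in> carrier (sect X B)" unfolding germ_at_def by blast
  have o: "opn X (V \<inter> W)" "opn X (A \<inter> B)" "x \<in> V \<inter> W" "x \<in> A \<inter> B" "V \<inter> W \<subseteq> A \<inter> B" "V \<inter> W \<subseteq> U"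
    using V W A B by auto
  have 1: "restr X U (V \<inter> W) s = restr X A (V \<inter> W) a"
    using arg_cong[OF V(4), of "restr X V (V \<inter> W)"] V(1-3) W(1-3) A U o by simp
  have 2: "restr X U (V \<inter> W) t = restr X B (V \<inter> W) b"
    using arg_cong[OF W(4), of "restr X W (V \<inter> W)"] V(1-3) W(1-3) B U o by simp
  show ?thesis
  proof (subst germ_eq_iff)
    show "\<exists>S. opn X S \<and> x \<in> S \<and> S \<subseteq> A \<inter> B \<inter> U \<and>
        restr X (A \<inter> B) S (p (A \<inter> B) (restr X A (A \<inter> B) a) (restr X B (A \<inter> B) b)) = restr X U S (p U s t)"
    proof (intro exI[of _ "V \<inter> W"] conjI)
      show "restr X (A \<inter> B) (V \<inter> W) (p (A \<inter> B) (restr X A (A \<inter> B) a) (restr X B (A \<inter> B) b))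
          = restr X U (V \<inter> W) (p U s t)"
        using o U A B by (simp add: op 1 2 del: Int_subset_iff)
    qed (use o V in auto)
  qed (use U A B o in \<open>auto intro!: cl\<close>)
qed

lemma germ_mult:
  assumes "opn X U" "x \<in> U" "s \<in> carrier (sect X U)" "t \<in> carrier (sect X U)"
  shows "germ_at X x U s \<otimes>\<^bsub>stalk X x\<^esub> germ_at X x U t = germ_at X x U (s \<otimes>\<^bsub>sect X U\<^esub> t)"
  unfolding stalk_def
  using UN_pair_const[OF germ_self[OF assms(1-3)] germ_self[OF assms(1,2,4)]
      stalk_op_aux[of "\<lambda>U. (\<otimes>\<^bsub>sect X U\<^esub>)", OF restr_mult _ assms]]
    monoid.m_closed[OF comm_monoid.axioms(1)[OF cring.axioms(2)[OF sect_cring]]] by simp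

lemma germ_add:
  assumes "opn X U" "x \<in> U" "s \<in> carrier (sect X U)" "t \<in> carrier (sect X U)"
  shows "germ_at X x U s \<oplus>\<^bsub>stalk X x\<^esub> germ_at X x U t = germ_at X x U (s \<oplus>\<^bsub>sect X U\<^esub> t)"
  unfolding stalk_def
  using UN_pair_const[OF germ_self[OF assms(1-3)] germ_self[OF assms(1,2,4)]
      stalk_op_aux[of "\<lambda>U. (\<oplus>\<^bsub>sect X U\<^esub>)", OF restr_add _ assms]]
    ring.ring_simprules(1)[OF cring.axioms(1)[OF sect_cring]] by simp

lemma stalk_rep2:
  assumes "g \<in> carrier (stalk X x)" "h \<in> carrier (stalk X x)"
  obtains U s t where "opn X U" "x \<in> U" "s \<in> carrier (sect X U)" "t \<in> carrier (sect X U)"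
    "g = germ_at X x U s" "h = germ_at X x U t"
proof -
  obtain U where U: "opn X U" "x \<in> U"
    "\<And>V. opn X V \<Longrightarrow> V \<subseteq> U \<Longrightarrow> x \<in> V \<Longrightarrow> \<exists>s\<in>carrier (sect X V). g = germ_at X x V s"
    using stalk_rep_restr[OF assms(1)] by blast
  obtain V where V: "opn X V" "x \<in> V"
    "\<And>W. opn X W \<Longrightarrow> W \<subseteq> V \<Longrightarrow> x \<in> W \<Longrightarrow> \<exists>s\<in>carrier (sect X W). h = germ_at X x W s"
    using stalk_rep_restr[OF assms(2)] by blast
  have "opn X (U \<inter> V)" "x \<in> U \<inter> V" using U V by auto
  then show thesis using U(3)[of "U \<inter> V"] V(3)[of "U \<inter> V"] that by auto
qed

lemma stalk_rep3:
  assumes "g \<in> carrier (stalk X x)" "h \<in> carrier (stalk X x)" "k \<in> carrier (stalk X x)"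
  obtains U s t r where "opn X U" "x \<in> U" "s \<in> carrier (sect X U)" "t \<in> carrier (sect X U)"
    "r \<in> carrier (sect X U)" "g = germ_at X x U s" "h = germ_at X x U t" "k = germ_at X x U r"
proof -
  obtain U s t where U: "opn X U" "x \<in> U" "s \<in> carrier (sect X U)" "t \<in> carrier (sect X U)"
    "g = germ_at X x U s" "h = germ_at X x U t" using stalk_rep2 assms by blast
  obtain V where V: "opn X V" "x \<in> V"
    "\<And>W. opn X W \<Longrightarrow> W \<subseteq> V \<Longrightarrow> x \<in> W \<Longrightarrow> \<exists>s\<in>carrier (sect X W). k = germ_at X x W s"
    using stalk_rep_restr[OF assms(3)] by blast
  have o: "opn X (U \<inter> V)" "x \<in> U \<inter> V" using U V by auto
  then obtain r where r: "r \<in> carrier (sect X (U \<inter> V))" "k = germ_at X x (U \<inter> V) r"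
    using V(3)[of "U \<inter> V"] by auto
  show thesis
  proof (rule that[OF o _ _ r(1) _ _ r(2)])
    show "g = germ_at X x (U \<inter> V) (restr X U (U \<inter> V) s)" using germ_restr[of U "U \<inter> V" x s] o U by simp
    show "h = germ_at X x (U \<inter> V) (restr X U (U \<inter> V) t)" using germ_restr[of U "U \<inter> V" x t] o U by simp
  qed (use o U in auto)
qed

lemma stalk_cring:
  assumes x: "x \<in> points X"
  shows "cring (stalk X x)"
proof -
  have pt: "opn X (points X)" by simp
  interpret P: cring "sect X (points X)" using sect_cring pt by blast
  have one: "\<one>\<^bsub>stalk X x\<^esub> \<in> carrier (stalk X x)" "\<zero>\<^bsub>stalk X x\<^esub> \<in> carrier (stalk X x)"
    using stalk_one[OF pt x] stalk_zero[OF pt x] x by auto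
  have add: "g \<oplus>\<^bsub>stalk X x\<^esub> h \<in> carrier (stalk X x)"
    and addc: "g \<oplus>\<^bsub>stalk X x\<^esub> h = h \<oplus>\<^bsub>stalk X x\<^esub> g"
    and mul: "g \<otimes>\<^bsub>stalk X x\<^esub> h \<in> carrier (stalk X x)"
    and mulc: "g \<otimes>\<^bsub>stalk X x\<^esub> h = h \<otimes>\<^bsub>stalk X x\<^esub> g"
    if gh: "g \<in> carrier (stalk X x)" "h \<in> carrier (stalk X x)" for g h
  proof -
    obtain U s t where U: "opn X U" "x \<in> U" "s \<in> carrier (sect X U)" "t \<in> carrier (sect X U)"
      "g = germ_at X x U s" "h = germ_at X x U t" using stalk_rep2 gh by blast
    interpret U: cring "sect X U" using sect_cring U by blast
    show "g \<oplus>\<^bsub>stalk X x\<^esub> h \<in> carrier (stalk X x)" "g \<oplus>\<^bsub>stalk X x\<^esub> h = h \<oplus>\<^bsub>stalk X x\<^esub> g"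
      "g \<otimes>\<^bsub>stalk X x\<^esub> h \<in> carrier (stalk X x)" "g \<otimes>\<^bsub>stalk X x\<^esub> h = h \<otimes>\<^bsub>stalk X x\<^esub> g"
      using U by (auto simp: germ_add germ_mult U.a_comm U.m_comm)
  qed
  have unit: "\<zero>\<^bsub>stalk X x\<^esub> \<oplus>\<^bsub>stalk X x\<^esub> g = g" "\<one>\<^bsub>stalk X x\<^esub> \<otimes>\<^bsub>stalk X x\<^esub> g = g"
    "\<exists>h\<in>carrier (stalk X x). h \<oplus>\<^bsub>stalk X x\<^esub> g = \<zero>\<^bsub>stalk X x\<^esub>"
    if "g \<in> carrier (stalk X x)" for g
  proof -
    obtain U s where U: "opn X U" "x \<in> U" "s \<in> carrier (sect X U)" "g = germ_at X x U s"
      using stalk_rep \<open>g \<in> carrier (stalk X x)\<close> by blast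
    interpret U: cring "sect X U" using sect_cring U by blast
    show "\<zero>\<^bsub>stalk X x\<^esub> \<oplus>\<^bsub>stalk X x\<^esub> g = g" "\<one>\<^bsub>stalk X x\<^esub> \<otimes>\<^bsub>stalk X x\<^esub> g = g"
      using U by (simp_all add: stalk_zero[of U] stalk_one[of U] germ_add germ_mult)
    show "\<exists>h\<in>carrier (stalk X x). h \<oplus>\<^bsub>stalk X x\<^esub> g = \<zero>\<^bsub>stalk X x\<^esub>"
      using U by (intro bexI[of _ "germ_at X x U (\<ominus>\<^bsub>sect X U\<^esub> s)"])
        (auto simp: stalk_zero[of U] germ_add U.l_neg)
  qed
  have assoc: "(g \<oplus>\<^bsub>stalk X x\<^esub> h) \<oplus>\<^bsub>stalk X x\<^esub> k = g \<oplus>\<^bsub>stalk X x\<^esub> (h \<oplus>\<^bsub>stalk X x\<^esub> k)"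
    "(g \<otimes>\<^bsub>stalk X x\<^esub> h) \<otimes>\<^bsub>stalk X x\<^esub> k = g \<otimes>\<^bsub>stalk X x\<^esub> (h \<otimes>\<^bsub>stalk X x\<^esub> k)"
    "(g \<oplus>\<^bsub>stalk X x\<^esub> h) \<otimes>\<^bsub>stalk X x\<^esub> k = (g \<otimes>\<^bsub>stalk X x\<^esub> k) \<oplus>\<^bsub>stalk X x\<^esub> (h \<otimes>\<^bsub>stalk X x\<^esub> k)"
    if ghk: "g \<in> carrier (stalk X x)" "h \<in> carrier (stalk X x)" "k \<in> carrier (stalk X x)" for g h k
  proof -
    obtain U s t r where U: "opn X U" "x \<in> U" "s \<in> carrier (sect X U)" "t \<in> carrier (sect X U)"
      "r \<in> carrier (sect X U)" "g = germ_at X x U s" "h = germ_at X x U t" "k = germ_at X x U r"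
      using stalk_rep3[OF ghk] by blast
    interpret U: cring "sect X U" using sect_cring U by blast
    show "(g \<oplus>\<^bsub>stalk X x\<^esub> h) \<oplus>\<^bsub>stalk X x\<^esub> k = g \<oplus>\<^bsub>stalk X x\<^esub> (h \<oplus>\<^bsub>stalk X x\<^esub> k)"
      "(g \<otimes>\<^bsub>stalk X x\<^esub> h) \<otimes>\<^bsub>stalk X x\<^esub> k = g \<otimes>\<^bsub>stalk X x\<^esub> (h \<otimes>\<^bsub>stalk X x\<^esub> k)"
      "(g \<oplus>\<^bsub>stalk X x\<^esub> h) \<otimes>\<^bsub>stalk X x\<^esub> k = (g \<otimes>\<^bsub>stalk X x\<^esub> k) \<oplus>\<^bsub>stalk X x\<^esub> (h \<otimes>\<^bsub>stalk X x\<^esub> k)"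
      using U by (simp_all add: germ_add germ_mult U.a_assoc U.m_assoc U.l_distr)
  qed
  show ?thesis
  proof (rule cringI)
    show "abelian_group (stalk X x)"
      by (rule abelian_groupI) (use one add addc unit assoc in auto)
    show "Group.comm_monoid (stalk X x)"
      by (rule comm_monoidI) (use one mul mulc unit assoc in auto)
  qed (use assoc in auto)
qed

lemma germ_hom:
  assumes "opn X U" "x \<in> U"
  shows "germ_at X x U \<in> ring_hom (sect X U) (stalk X x)"
  using assms by (intro ring_hom_memI) (auto simp: germ_mult germ_add stalk_one)

text \<open>An inverse germ is represented on some neighbourhood and becomes an inverse of the
  section after shrinking. This lets locality of morphisms be tested with \<open>nv\<close>, which
  mentions sections only.\<close>

lemma nv_iff_unit:
  assumes U: "opn X U" "x \<in> U" "s \<in> carrier (sect X U)"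
  shows "germ_at X x U s \<in> Units (stalk X x) \<longleftrightarrow> nv X x U s"
proof
  have x: "x \<in> points X" using U openin_subset by blast
  interpret S: cring "stalk X x" by (rule stalk_cring[OF x])
  assume "germ_at X x U s \<in> Units (stalk X x)"
  then obtain g where g: "g \<in> carrier (stalk X x)" "g \<otimes>\<^bsub>stalk X x\<^esub> germ_at X x U s = \<one>\<^bsub>stalk X x\<^esub>"
    unfolding Units_def by blast
  from g(1) obtain V t where V: "opn X V" "x \<in> V" "t \<in> carrier (sect X V)" "g = germ_at X x V t"
    by (rule stalk_rep)
  let ?W = "U \<inter> V"
  have o: "opn X ?W" "x \<in> ?W" using U V by auto
  interpret W: cring "sect X ?W" using sect_cring[OF o(1)] .
  have "germ_at X x ?W (restr X V ?W t) \<otimes>\<^bsub>stalk X x\<^esub> germ_at X x ?W (restr X U ?W s) = \<one>\<^bsub>stalk X x\<^esub>"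
    using g(2) U V o by (simp add: germ_restr)
  then have "germ_at X x ?W (restr X V ?W t \<otimes>\<^bsub>sect X ?W\<^esub> restr X U ?W s) = germ_at X x ?W \<one>\<^bsub>sect X ?W\<^esub>"
    using U V o by (simp add: germ_mult stalk_one[OF o])
  then obtain N where N: "opn X N" "x \<in> N" "N \<subseteq> ?W"
    "restr X ?W N (restr X V ?W t \<otimes>\<^bsub>sect X ?W\<^esub> restr X U ?W s) = restr X ?W N \<one>\<^bsub>sect X ?W\<^esub>"
    using germ_eq_iff[OF o _ o] U V o by auto
  interpret N: cring "sect X N" using sect_cring[OF N(1)] .
  have "restr X V N t \<otimes>\<^bsub>sect X N\<^esub> restr X U N s = \<one>\<^bsub>sect X N\<^esub>"
    using N U V o by (simp add: restr_mult restr_one)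
  moreover have "restr X V N t \<in> carrier (sect X N)" "restr X U N s \<in> carrier (sect X N)"
    using N U V by auto
  ultimately have "restr X U N s \<in> Units (sect X N)"
    unfolding Units_def using N.m_comm by (metis (mono_tags, lifting) mem_Collect_eq)
  then show "nv X x U s" unfolding nv_def using N by blast
next
  assume "nv X x U s"
  then obtain W where W: "opn X W" "x \<in> W" "W \<subseteq> U" "restr X U W s \<in> Units (sect X W)"
    unfolding nv_def by blast
  have x: "x \<in> points X" using U openin_subset by blast
  have "germ_at X x W (restr X U W s) \<in> Units (stalk X x)"
    using cring.units_ring_hom[OF sect_cring stalk_cring germ_hom] W x by blast
  then show "germ_at X x U s \<in> Units (stalk X x)" using germ_restr[of U W x s] U W by simp
qed

lemma nv_restr:
  assumes "opn X U" "opn X V" "V \<subseteq> U" "x \<in> V" "s \<in> carrier (sect X U)"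
  shows "nv X x V (restr X U V s) \<longleftrightarrow> nv X x U s"
  using nv_iff_unit[of V x "restr X U V s"] nv_iff_unit[of U x s] germ_restr[of U V x s] assms by auto

end

section \<open>Local rings\<close>

lemma maximalideal_Units:
  assumes "cring R" "maximalideal M R" "a \<in> Units R"
  shows "a \<notin> M"
proof
  assume a: "a \<in> M"
  interpret cring R by fact
  interpret maximalideal M R by fact
  have "inv\<^bsub>R\<^esub> a \<otimes>\<^bsub>R\<^esub> a \<in> M" using assms(3) a I_l_closed by blast
  then show False using assms(3) I_notcarr one_imp_carrier by simp
qed

text \<open>A nonunit generates a proper ideal, which lies in a maximal ideal, and there is only one
  of these.\<close>

lemma local_ring_max_ideal:
  fixes R (structure)
  assumes "is_local_ring R"
  shows "maximalideal (the_max_ideal R) R" "the_max_ideal R = carrier R - Units R"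
proof -
  interpret cring R using assms unfolding is_local_ring_def by simp
  have ex: "\<exists>!M. maximalideal M R" using assms unfolding is_local_ring_def by simp
  then show max: "maximalideal (the_max_ideal R) R" unfolding the_max_ideal_def by (rule theI')
  interpret M: maximalideal "the_max_ideal R" R by fact
  have "a \<in> the_max_ideal R" if a: "a \<in> carrier R" "a \<notin> Units R" for a
  proof -
    have "\<one> \<notin> PIdl a"
    proof
      assume "\<one> \<in> PIdl a"
      then obtain r where "r \<in> carrier R" "\<one> = r \<otimes> a" unfolding cgenideal_def by auto
      then show False using a m_comm unfolding Units_def by auto
    qed
    then obtain P where P: "maximalideal P R" "PIdl a \<subseteq> P"
      using exists_maximal[OF cgenideal_ideal[OF a(1)]] by blast
    then show ?thesis using ex max cgenideal_self[OF a(1)] by blast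
  qed
  then show "the_max_ideal R = carrier R - Units R"
    using maximalideal_Units[OF is_cring max] M.a_subset by blast
qed

section \<open>Locally ringed spaces and their morphisms\<close>

locale lr_space =
  fixes X :: "('x, 'r, 'z) ringed_space_scheme"
  assumes lrs: "locally_ringed_space X"

sublocale lr_space \<subseteq> presheaf
  using lrs unfolding locally_ringed_space_def sheaf_of_rings_def by unfold_locales blast

context lr_space begin

lemma stalk_local: "x \<in> points X \<Longrightarrow> is_local_ring (stalk X x)"
  using lrs unfolding locally_ringed_space_def by blast

text \<open>Otherwise the stalk at \<open>x\<close> would be the zero ring, which has no maximal
  ideal.\<close>

lemma sect_nontrivial:
  assumes "opn X U" "x \<in> U" shows "\<one>\<^bsub>sect X U\<^esub> \<noteq> \<zero>\<^bsub>sect X U\<^esub>"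
proof
  assume eq: "\<one>\<^bsub>sect X U\<^esub> = \<zero>\<^bsub>sect X U\<^esub>"
  have x: "x \<in> points X" using assms openin_subset by blast
  interpret S: cring "stalk X x" by (rule stalk_cring[OF x])
  interpret M: maximalideal "the_max_ideal (stalk X x)" "stalk X x"
    by (rule local_ring_max_ideal(1)[OF stalk_local[OF x]])
  have "\<one>\<^bsub>stalk X x\<^esub> = \<zero>\<^bsub>stalk X x\<^esub>"
    using eq stalk_one[OF assms] stalk_zero[OF assms] by simp
  then show False using M.I_notcarr M.one_imp_carrier M.zero_closed by auto
qed

text \<open>It is the preimage of the maximal ideal of the stalk. In \<open>agree_points\<close>
  such a prime produces the point that identifies two values.\<close>

lemma vanishing_primeideal:
  assumes U: "opn X U" "x \<in> U"
  shows "primeideal {s \<in> carrier (sect X U). \<not> nv X x U s} (sect X U)"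
proof -
  have x: "x \<in> points X" using U openin_subset by blast
  interpret U: cring "sect X U" using sect_cring U by blast
  interpret S: cring "stalk X x" by (rule stalk_cring[OF x])
  interpret M: maximalideal "the_max_ideal (stalk X x)" "stalk X x"
    by (rule local_ring_max_ideal(1)[OF stalk_local[OF x]])
  interpret P: primeideal "the_max_ideal (stalk X x)" "stalk X x"
    by (rule S.maximalideal_prime[OF M.is_maximalideal])
  interpret h: ring_hom_ring "sect X U" "stalk X x" "germ_at X x U"
    by (rule ring_hom_ringI2[OF U.ring_axioms S.ring_axioms germ_hom[OF U]])
  have eq: "{s \<in> carrier (sect X U). \<not> nv X x U s}
      = {s \<in> carrier (sect X U). germ_at X x U s \<in> the_max_ideal (stalk X x)}"
    using local_ring_max_ideal(2)[OF stalk_local[OF x]] nv_iff_unit[OF U] germ_closed[OF U] by blast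
  show ?thesis unfolding eq by (rule h.primeideal_vimage[OF U.is_cring P.primeideal])
qed

end

lemma open_subspace_sel [simp]:
  "sect (open_subspace X U) = sect X" "restr (open_subspace X U) = restr X"
  "topo (open_subspace X U) = subtopology (topo X) U"
  by (simp_all add: open_subspace_def)

lemma open_subscheme_sel [simp]:
  "sect (open_subscheme X U) = sect X" "restr (open_subscheme X U) = restr X"
  "topo (open_subscheme X U) = subtopology (topo X) U"
  "struc (open_subscheme X U) = (\<lambda>a. restr X (points X) U (struc X a))"
  by (simp_all add: open_subscheme_def open_subspace_def)

lemma nv_sub:
  assumes "opn X U" "V \<subseteq> U" "sect Y = sect X" "restr Y = restr X" "topo Y = subtopology (topo X) U"
  shows "nv Y x V s \<longleftrightarrow> nv X x V s"
  unfolding nv_def using assms openin_open_subtopology[OF assms(1)] by auto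

lemma (in presheaf) presheaf_sub:
  assumes U: "opn X U" and Y: "sect Y = sect X" "restr Y = restr X" "topo Y = subtopology (topo X) U"
  shows "presheaf Y"
proof -
  have o: "opn X V" if "opn Y V" for V using that Y(3) openin_open_subtopology[OF U] by auto
  have "presheaf_of_rings Y"
    unfolding presheaf_of_rings_def Y(1,2)
  proof (intro conjI allI impI ballI)
    fix V assume "opn Y V"
    from o[OF this] show "cring (sect X V)" by (rule sect_cring)
  next
    fix V W assume *: "opn Y V \<and> opn Y W \<and> W \<subseteq> V"
    then have "opn X V" "opn X W" using o by blast+
    then show "restr X V W \<in> ring_hom (sect X V) (sect X W)" using * by (intro restr_hom) auto
  next
    fix V s assume "opn Y V" "s \<in> carrier (sect X V)"
    then show "restr X V V s = s" by (intro restr_id[OF o])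
  next
    fix V W T s assume *: "opn Y V \<and> opn Y W \<and> opn Y T \<and> T \<subseteq> W \<and> W \<subseteq> V" "s \<in> carrier (sect X V)"
    then have "opn X V" "opn X W" "opn X T" using o by blast+
    then show "restr X W T (restr X V W s) = restr X V T s" using * by (intro restr_restr) auto
  qed
  then show ?thesis by unfold_locales
qed

section \<open>Morphisms of ringed spaces, and isomorphisms with a named inverse\<close>

lemma rs_morphismD:
  assumes "rs_morphism X Y f"
  shows "continuous_map (topo X) (topo Y) (fst f)"
    and "opn Y V \<Longrightarrow> snd f V \<in> ring_hom (sect Y V) (sect X (preim X f V))"
    and "opn Y V \<Longrightarrow> opn Y W \<Longrightarrow> W \<subseteq> V \<Longrightarrow> s \<in> carrier (sect Y V) \<Longrightarrow>
      snd f W (restr Y V W s) = restr X (preim X f V) (preim X f W) (snd f V s)"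
  using assms unfolding rs_morphism_def by simp_all

lemma rs_preim_open: "rs_morphism X Y f \<Longrightarrow> opn Y V \<Longrightarrow> opn X (preim X f V)"
  unfolding preim_def by (rule openin_continuous_map_preimage[OF rs_morphismD(1)])

lemma rs_closed: "rs_morphism X Y f \<Longrightarrow> opn Y V \<Longrightarrow> s \<in> carrier (sect Y V) \<Longrightarrow>
    snd f V s \<in> carrier (sect X (preim X f V))"
  by (rule ring_hom_closed[OF rs_morphismD(2)])

lemma rs_point: "rs_morphism X Y f \<Longrightarrow> x \<in> points X \<Longrightarrow> fst f x \<in> points Y"
  using rs_morphismD(1) unfolding continuous_map_def by blast

lemma lrs_morphism_iff:
  assumes "presheaf X" "presheaf Y"
  shows "lrs_morphism X Y f \<longleftrightarrow> rs_morphism X Y f \<and>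
    (\<forall>x\<in>points X. \<forall>V. opn Y V \<and> fst f x \<in> V \<longrightarrow> (\<forall>s\<in>carrier (sect Y V).
       nv X x (preim X f V) (snd f V s) \<longrightarrow> nv Y (fst f x) V s))"
proof -
  interpret X: presheaf X by fact
  interpret Y: presheaf Y by fact
  have iff: "germ_at X x (preim X f V) (snd f V s) \<in> Units (stalk X x) \<longleftrightarrow> nv X x (preim X f V) (snd f V s)"
    "germ_at Y (fst f x) V s \<in> Units (stalk Y (fst f x)) \<longleftrightarrow> nv Y (fst f x) V s"
    if "rs_morphism X Y f" "x \<in> points X" "opn Y V" "fst f x \<in> V" "s \<in> carrier (sect Y V)" for x V s
  proof -
    have "x \<in> preim X f V" using that(2,4) by (simp add: preim_def)
    then show "germ_at X x (preim X f V) (snd f V s) \<in> Units (stalk X x) \<longleftrightarrow> nv X x (preim X f V) (snd f V s)"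
      using rs_preim_open[OF that(1,3)] rs_closed[OF that(1,3,5)] by (intro X.nv_iff_unit)
    show "germ_at Y (fst f x) V s \<in> Units (stalk Y (fst f x)) \<longleftrightarrow> nv Y (fst f x) V s"
      using that by (intro Y.nv_iff_unit)
  qed
  show ?thesis unfolding lrs_morphism_def
    using iff by (intro conj_cong refl ball_cong all_cong1 imp_cong) blast+
qed

text \<open>The inverse is named because it is used itself: in a chart, \<open>g\<close> turns
  primes into points and transports sections to the spectrum.\<close>

definition rs_inv ::
    "('x, 'r, 'z) ringed_space_scheme \<Rightarrow> ('y, 's, 'w) ringed_space_scheme \<Rightarrow>
     ('x, 'r, 'y, 's) mor \<Rightarrow> ('y, 's, 'x, 'r) mor \<Rightarrow> bool" where
  "rs_inv X Y f g \<longleftrightarrow> rs_morphism X Y f \<and> rs_morphism Y X g \<and>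
     mor_eq X X (mor_comp Y g f) mor_id \<and> mor_eq Y Y (mor_comp X f g) mor_id"

lemma rs_inv_sym: "rs_inv X Y f g \<Longrightarrow> rs_inv Y X g f"
  unfolding rs_inv_def by simp

lemma rs_invD:
  assumes "rs_inv X Y f g"
  shows "rs_morphism X Y f" "rs_morphism Y X g"
    and "x \<in> points X \<Longrightarrow> fst g (fst f x) = x"
    and "y \<in> points Y \<Longrightarrow> fst f (fst g y) = y"
    and "opn Y V \<Longrightarrow> s \<in> carrier (sect Y V) \<Longrightarrow> snd g (preim X f V) (snd f V s) = s"
    and "opn X U \<Longrightarrow> t \<in> carrier (sect X U) \<Longrightarrow> snd f (preim Y g U) (snd g U t) = t"
  using assms unfolding rs_inv_def mor_eq_def mor_comp_def mor_id_def by simp_all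

lemma rs_inv_preim:
  assumes fg: "rs_inv X Y f g" and V: "opn Y V"
  shows "preim Y g (preim X f V) = V"
proof -
  have "V \<subseteq> points Y" using V openin_subset by blast
  then show ?thesis
    unfolding preim_def using rs_invD(4)[OF fg] rs_point[OF rs_invD(2)[OF fg]] by auto
qed

lemma rs_inv_inj:
  assumes fg: "rs_inv X Y f g" and V: "opn Y V" "s \<in> carrier (sect Y V)" "t \<in> carrier (sect Y V)"
    and "snd f V s = snd f V t"
  shows "s = t"
  using rs_invD(5)[OF fg V(1,2)] rs_invD(5)[OF fg V(1,3)] assms(5) by metis

context lr_space begin

text \<open>The open sets on which \<open>s\<close> and \<open>t\<close> agree form a cover, to
  which the uniqueness axiom of sheaves applies.\<close>

lemma sheaf_eqI:
  assumes U: "opn X U" "s \<in> carrier (sect X U)" "t \<in> carrier (sect X U)"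
    and loc: "\<And>x. x \<in> U \<Longrightarrow> \<exists>W. opn X W \<and> x \<in> W \<and> W \<subseteq> U \<and> restr X U W s = restr X U W t"
  shows "s = t"
proof -
  define \<U> where "\<U> = {W. opn X W \<and> W \<subseteq> U \<and> restr X U W s = restr X U W t}"
  have eq: "\<Union>\<U> = U" using loc unfolding \<U>_def by blast
  have "sheaf_of_rings X" using lrs unfolding locally_ringed_space_def by simp
  then have "\<forall>U\<in>\<U>. opn X U \<Longrightarrow> \<forall>s\<in>carrier (sect X (\<Union>\<U>)). \<forall>t\<in>carrier (sect X (\<Union>\<U>)).
           (\<forall>U\<in>\<U>. restr X (\<Union>\<U>) U s = restr X (\<Union>\<U>) U t) \<longrightarrow> s = t"
    unfolding sheaf_of_rings_def by simp
  then show ?thesis using U unfolding eq unfolding \<U>_def by simp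
qed

end

section \<open>Affine charts\<close>

text \<open>The isomorphism with the spectrum is arbitrary. In particular the prime
  \<open>q x\<close> need not consist of the sections vanishing at \<open>x\<close>; the two are
  related through the endomorphism \<open>\<sigma>\<close> below.\<close>

locale affine_chart = lr_space X for X :: "('x, 'r, 'z) ringed_space_scheme" +
  fixes A f g
  assumes A: "opn X A"
    and fg: "rs_inv (open_subspace X A) (Spec (sect X A)) f g"
begin

abbreviation "R \<equiv> sect X A"
abbreviation "q \<equiv> fst f"

definition D where "D h = {y \<in> A. h \<notin> q y}"
definition fr where "fr h a s = snd f (basic_open R h) (frac_sec R (basic_open R h) a s)"

sublocale R: cring R using sect_cring[OF A] .

lemma A_sub: "A \<subseteq> points X" using A openin_subset by blast

lemma points_A: "points (open_subspace X A) = A" using A_sub by auto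

lemma opn_A: "opn (open_subspace X A) U \<longleftrightarrow> opn X U \<and> U \<subseteq> A"
  using openin_open_subtopology[OF A] by simp

lemma f: "rs_morphism (open_subspace X A) (Spec R) f" and g: "rs_morphism (Spec R) (open_subspace X A) g"
  using rs_invD(1,2)[OF fg] .

lemma q_prime: "x \<in> A \<Longrightarrow> primeideal (q x) R"
  using rs_point[OF f, of x] A_sub by auto

lemma g_A: "primeideal P R \<Longrightarrow> fst g P \<in> A"
  using rs_point[OF g, of P] by simp

lemma q_g: "primeideal P R \<Longrightarrow> q (fst g P) = P"
  using rs_invD(4)[OF fg, of P] by simp

lemma g_q: "x \<in> A \<Longrightarrow> fst g (q x) = x"
  using rs_invD(3)[OF fg, of x] points_A by metis

lemma q_inj: "x \<in> A \<Longrightarrow> y \<in> A \<Longrightarrow> q x = q y \<Longrightarrow> x = y"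
  using rs_invD(3)[OF fg, of x] rs_invD(3)[OF fg, of y] points_A by metis

lemma preim_basic: "preim (open_subspace X A) f (basic_open R h) = D h"
  unfolding preim_def D_def basic_open_def points_A using q_prime by auto

lemma D_one: "D \<one>\<^bsub>R\<^esub> = A"
  unfolding D_def using q_prime primeideal.one_diff by blast

lemma D_open: assumes "h \<in> carrier R" shows "opn X (D h)" "D h \<subseteq> A"
proof -
  have "opn (open_subspace X A) (D h)"
    using rs_preim_open[OF f, of "basic_open R h"] spec_open_basic[OF assms] preim_basic by simp
  then show "opn X (D h)" "D h \<subseteq> A" using opn_A by auto
qed

lemma D_basic: "x \<in> A \<Longrightarrow> q x \<in> basic_open R h \<longleftrightarrow> x \<in> D h"
  unfolding D_def basic_open_def using q_prime by auto

lemma basic_subset: "D h \<subseteq> D h' \<Longrightarrow> basic_open R h \<subseteq> basic_open R h'"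
proof
  fix p assume sub: "D h \<subseteq> D h'" and p: "p \<in> basic_open R h"
  then have P: "primeideal p R" by (simp add: basic_open_def)
  then have "fst g p \<in> D h" using D_basic[OF g_A[OF P], of h] q_g[OF P] p by simp
  then have "fst g p \<in> D h'" using sub by blast
  then show "p \<in> basic_open R h'" using D_basic[OF g_A[OF P], of h'] q_g[OF P] by simp
qed

text \<open>\<open>s\<close> has no zero on \<open>D h\<close>, so that the fraction \<open>fr h a s\<close> is a section there.\<close>

definition den where "den h s \<longleftrightarrow> h \<in> carrier R \<and> s \<in> carrier R \<and> D h \<subseteq> D s"

lemma den_basic: "den h s \<Longrightarrow> p \<in> basic_open R h \<Longrightarrow> s \<notin> p"
  unfolding den_def using basic_subset[of h s] by (auto simp: basic_open_def)

lemma den_one: "h \<in> carrier R \<Longrightarrow> den h \<one>\<^bsub>R\<^esub>"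
  unfolding den_def using D_one D_open by auto

lemma den_mult: assumes "den h s" "den h t" shows "den h (s \<otimes>\<^bsub>R\<^esub> t)"
proof -
  have "s \<otimes>\<^bsub>R\<^esub> t \<notin> q x" if "x \<in> D h" for x
  proof -
    have "x \<in> A" using that by (simp add: D_def)
    interpret primeideal "q x" R using q_prime \<open>x \<in> A\<close> .
    show ?thesis using that assms I_prime unfolding den_def D_def by blast
  qed
  then show ?thesis using assms unfolding den_def D_def by auto
qed

lemma den_self: "h \<in> carrier R \<Longrightarrow> den h h" unfolding den_def by simp

lemma den_mono: "den h s \<Longrightarrow> h' \<in> carrier R \<Longrightarrow> D h' \<subseteq> D h \<Longrightarrow> den h' s"
  unfolding den_def by auto

lemma frac_sec_closed: "a \<in> carrier R \<Longrightarrow> den h s \<Longrightarrow>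
    frac_sec R (basic_open R h) a s \<in> spec_sections R (basic_open R h)"
  by (rule frac_sec_mem[OF spec_open_basic _ _ den_basic]) (auto simp: den_def)

lemma fr_closed: "a \<in> carrier R \<Longrightarrow> den h s \<Longrightarrow> fr h a s \<in> carrier (sect X (D h))"
  unfolding fr_def using rs_closed[OF f, of "basic_open R h"] frac_sec_closed spec_open_basic[of h R]
  by (simp add: den_def preim_basic)

lemma f_hom: "h \<in> carrier R \<Longrightarrow> snd f (basic_open R h) \<in> ring_hom (sect (Spec R) (basic_open R h)) (sect X (D h))"
  using rs_morphismD(2)[OF f, of "basic_open R h"] spec_open_basic[of h R] by (simp add: preim_basic)

lemma fr_mult:
  assumes "a \<in> carrier R" "den h s" "b \<in> carrier R" "den h t"
  shows "fr h a s \<otimes>\<^bsub>sect X (D h)\<^esub> fr h b t = fr h (a \<otimes>\<^bsub>R\<^esub> b) (s \<otimes>\<^bsub>R\<^esub> t)"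
proof -
  have h: "h \<in> carrier R" "s \<in> carrier R" "t \<in> carrier R" using assms by (auto simp: den_def)
  show ?thesis unfolding fr_def
    using ring_hom_mult[OF f_hom[OF h(1)], of "frac_sec R (basic_open R h) a s" "frac_sec R (basic_open R h) b t"]
      frac_sec_closed assms
      frac_sec_mult[OF spec_open_basic[OF h(1)] assms(1) h(2) _ assms(3) h(3)] den_basic
    by (simp del: Spec_sel(6))
qed

lemma fr_add:
  assumes "a \<in> carrier R" "den h s" "b \<in> carrier R" "den h t"
  shows "fr h a s \<oplus>\<^bsub>sect X (D h)\<^esub> fr h b t = fr h (a \<otimes>\<^bsub>R\<^esub> t \<oplus>\<^bsub>R\<^esub> b \<otimes>\<^bsub>R\<^esub> s) (s \<otimes>\<^bsub>R\<^esub> t)"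
proof -
  have h: "h \<in> carrier R" "s \<in> carrier R" "t \<in> carrier R" using assms by (auto simp: den_def)
  show ?thesis unfolding fr_def
    using ring_hom_add[OF f_hom[OF h(1)], of "frac_sec R (basic_open R h) a s" "frac_sec R (basic_open R h) b t"]
      frac_sec_closed assms
      frac_sec_add[OF spec_open_basic[OF h(1)] assms(1) h(2) _ assms(3) h(3)] den_basic
    by (simp del: Spec_sel(7))
qed

lemma fr_one: "h \<in> carrier R \<Longrightarrow> fr h \<one>\<^bsub>R\<^esub> \<one>\<^bsub>R\<^esub> = \<one>\<^bsub>sect X (D h)\<^esub>"
  unfolding fr_def using ring_hom_one[OF f_hom] by (simp del: Spec_sel(4))

lemma fr_eqI:
  assumes "a \<in> carrier R" "den h s" "b \<in> carrier R" "den h t" "den h u"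
    "u \<otimes>\<^bsub>R\<^esub> (a \<otimes>\<^bsub>R\<^esub> t) = u \<otimes>\<^bsub>R\<^esub> (b \<otimes>\<^bsub>R\<^esub> s)"
  shows "fr h a s = fr h b t"
proof -
  have h: "h \<in> carrier R" "s \<in> carrier R" "t \<in> carrier R" "u \<in> carrier R" using assms by (auto simp: den_def)
  show ?thesis unfolding fr_def
    using frac_sec_eqI[OF spec_open_basic[OF h(1)] assms(1) h(2) _ assms(3) h(3) _ h(4) _ assms(6)]
      den_basic assms(2,4,5) by simp
qed

text \<open>By \<open>fr_add\<close> the element equals its own double, so it is zero.\<close>

lemma fr_zero: assumes "h \<in> carrier R" shows "fr h \<zero>\<^bsub>R\<^esub> \<one>\<^bsub>R\<^esub> = \<zero>\<^bsub>sect X (D h)\<^esub>"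
proof -
  interpret D: cring "sect X (D h)" using sect_cring D_open assms by blast
  have c: "fr h \<zero>\<^bsub>R\<^esub> \<one>\<^bsub>R\<^esub> \<in> carrier (sect X (D h))" using fr_closed den_one assms by simp
  have "fr h \<zero>\<^bsub>R\<^esub> \<one>\<^bsub>R\<^esub> \<oplus>\<^bsub>sect X (D h)\<^esub> fr h \<zero>\<^bsub>R\<^esub> \<one>\<^bsub>R\<^esub> = fr h \<zero>\<^bsub>R\<^esub> \<one>\<^bsub>R\<^esub>"
    using fr_add[of "\<zero>\<^bsub>R\<^esub>" h "\<one>\<^bsub>R\<^esub>" "\<zero>\<^bsub>R\<^esub>" "\<one>\<^bsub>R\<^esub>"] den_one assms by simp
  then show ?thesis using c D.add.r_cancel_one' by metis
qed

lemma fr_restr: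
  assumes "a \<in> carrier R" "den h s" "h' \<in> carrier R" "D h' \<subseteq> D h"
  shows "restr X (D h) (D h') (fr h a s) = fr h' a s"
proof -
  have h: "h \<in> carrier R" using assms by (auto simp: den_def)
  show ?thesis unfolding fr_def
    using rs_morphismD(3)[OF f, of "basic_open R h" "basic_open R h'" "frac_sec R (basic_open R h) a s"]
      frac_sec_closed assms spec_open_basic[OF h] spec_open_basic[OF assms(3)] basic_subset[OF assms(4)]
    by (simp add: preim_basic restrict_frac_sec)
qed

text \<open>A section over \<open>U\<close> is transported to the spectrum by \<open>g\<close>, is a
  fraction there on some open set, hence on a basic one inside it, and is transported back by
  \<open>f\<close>.\<close>

lemma section_local:
  assumes U: "opn X U" "U \<subseteq> A" "x \<in> U" and t: "t \<in> carrier (sect X U)"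
  obtains h a s where "h \<in> carrier R" "a \<in> carrier R" "den h s" "x \<in> D h" "D h \<subseteq> U"
    "restr X U (D h) t = fr h a s"
proof -
  have oU: "opn (open_subspace X A) U" using U opn_A by simp
  let ?V = "preim (Spec R) g U"
  have oV: "spec_open R ?V" using rs_preim_open[OF g oU] by simp
  have xA: "x \<in> A" using U by auto
  have gq: "fst g (q x) = x" using g_q[OF xA] .
  have xV: "q x \<in> ?V" unfolding preim_def using q_prime[OF xA] gq U by simp
  have tau: "snd g U t \<in> spec_sections R ?V" using rs_closed[OF g oU] t by simp
  obtain W a s where W: "spec_open R W" "q x \<in> W" "W \<subseteq> ?V" "a \<in> carrier R" "s \<in> carrier R"
    "\<And>q. q \<in> W \<Longrightarrow> s \<notin> q" "restrict (snd g U t) W = frac_sec R W a s"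
    using spec_section_local[OF tau xV] by blast
  obtain h where h: "h \<in> carrier R" "q x \<in> basic_open R h" "basic_open R h \<subseteq> W"
    using spec_open_basic_subset[OF W(1,2)] by blast
  have Dh: "D h \<subseteq> U"
  proof
    fix y assume y: "y \<in> D h"
    then have yA: "y \<in> A" by (simp add: D_def)
    then have "q y \<in> ?V" using y h W D_basic by blast
    then show "y \<in> U" unfolding preim_def using g_q[OF yA] by simp
  qed
  have den: "den h s" unfolding den_def
  proof (intro conjI h W(5) subsetI)
    fix y assume y: "y \<in> D h"
    then have yA: "y \<in> A" by (simp add: D_def)
    then show "y \<in> D s" using y h W(6) D_basic unfolding D_def by blast
  qed
  have "restr (Spec R) ?V (basic_open R h) (snd g U t) = frac_sec R (basic_open R h) a s"
  proof -
    have "restrict (snd g U t) (basic_open R h) = restrict (restrict (snd g U t) W) (basic_open R h)"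
      using h by (simp add: Int_absorb1)
    then show ?thesis using W(7) restrict_frac_sec[OF h(3)] by simp
  qed
  then have "fr h a s = snd f (basic_open R h) (restr (Spec R) ?V (basic_open R h) (snd g U t))"
    unfolding fr_def by simp
  also have "\<dots> = restr X (preim (open_subspace X A) f ?V) (D h) (snd f ?V (snd g U t))"
    using rs_morphismD(3)[OF f, of ?V "basic_open R h" "snd g U t"] oV tau h W spec_open_basic[OF h(1)]
    by (simp add: preim_basic)
  also have "preim (open_subspace X A) f ?V = U" using rs_inv_preim[OF rs_inv_sym[OF fg] oU] .
  also have "snd f ?V (snd g U t) = t" using rs_invD(6)[OF fg oU] t by simp
  finally have "restr X U (D h) t = fr h a s" by simp
  moreover have "x \<in> D h" using h(2) D_basic xA by blast
  ultimately show thesis using that h(1) W(4) den Dh by blast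
qed

text \<open>If the product of \<open>a/s\<close> with some \<open>b/t\<close> is 1 near
  \<open>x\<close>, then \<open>u a b = u s t\<close> for some \<open>u\<close> outside
  \<open>q x\<close>, and the right side is outside \<open>q x\<close>. Conversely, if
  \<open>a\<close> is outside \<open>q x\<close>, then \<open>s/a\<close> is an inverse near
  \<open>x\<close>.\<close>

lemma nv_fr:
  assumes a: "a \<in> carrier R" and den: "den h s" and x: "x \<in> D h"
  shows "nv X x (D h) (fr h a s) \<longleftrightarrow> a \<notin> q x"
proof
  have h: "h \<in> carrier R" "s \<in> carrier R" using den by (auto simp: den_def)
  have xA: "x \<in> A" using x by (simp add: D_def)
  interpret qx: primeideal "q x" R using q_prime[OF xA] .
  have oD: "opn X (D h)" using D_open h by blast
  {
    assume "nv X x (D h) (fr h a s)"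
    then obtain W where W: "opn X W" "x \<in> W" "W \<subseteq> D h" "restr X (D h) W (fr h a s) \<in> Units (sect X W)"
      unfolding nv_def by blast
    then obtain b' where b': "b' \<in> carrier (sect X W)"
      "restr X (D h) W (fr h a s) \<otimes>\<^bsub>sect X W\<^esub> b' = \<one>\<^bsub>sect X W\<^esub>" unfolding Units_def by blast
    have WA: "W \<subseteq> A" using W D_open h by blast
    obtain h' b t where h': "h' \<in> carrier R" "b \<in> carrier R" "den h' t" "x \<in> D h'" "D h' \<subseteq> W"
      "restr X W (D h') b' = fr h' b t" using section_local[OF W(1) WA W(2) b'(1)] by blast
    have den': "den h' s" using den_mono[OF den h'(1)] h' W by blast
    have t: "t \<in> carrier R" using h' by (simp add: den_def)
    have oD': "opn X (D h')" using D_open h' by blast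
    have sub: "D h' \<subseteq> D h" using h' W by auto
    have cl: "fr h a s \<in> carrier (sect X (D h))" using fr_closed a den by blast
    have "\<one>\<^bsub>sect X (D h')\<^esub> = restr X W (D h') (restr X (D h) W (fr h a s) \<otimes>\<^bsub>sect X W\<^esub> b')"
      unfolding b'(2) using restr_one[OF W(1) oD' h'(5)] by simp
    also have "\<dots> = restr X (D h) (D h') (fr h a s) \<otimes>\<^bsub>sect X (D h')\<^esub> fr h' b t"
      using W oD oD' h' b'(1) cl by (simp add: restr_mult)
    also have "\<dots> = fr h' (a \<otimes>\<^bsub>R\<^esub> b) (s \<otimes>\<^bsub>R\<^esub> t)"
      using fr_restr[OF a den h'(1) sub] fr_mult[OF a den' h'(2,3)] by simp
    finally have "fr h' (a \<otimes>\<^bsub>R\<^esub> b) (s \<otimes>\<^bsub>R\<^esub> t) = fr h' \<one>\<^bsub>R\<^esub> \<one>\<^bsub>R\<^esub>" using fr_one h' by simp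
    then have "frac_sec R (basic_open R h') (a \<otimes>\<^bsub>R\<^esub> b) (s \<otimes>\<^bsub>R\<^esub> t) = frac_sec R (basic_open R h') \<one>\<^bsub>R\<^esub> \<one>\<^bsub>R\<^esub>"
      unfolding fr_def using h' a den_mult[OF den' h'(3)] den_one[OF h'(1)] spec_open_basic[OF h'(1)]
      by (intro rs_inv_inj[OF fg, of "basic_open R h'"]) (simp_all add: frac_sec_closed)
    then have "frac_at R (q x) (a \<otimes>\<^bsub>R\<^esub> b) (s \<otimes>\<^bsub>R\<^esub> t) = frac_at R (q x) \<one>\<^bsub>R\<^esub> \<one>\<^bsub>R\<^esub>"
      using D_basic[OF xA, of h'] h'(4) by (auto simp: frac_sec_def dest: fun_cong[where x = "q x"])
    moreover have st: "s \<otimes>\<^bsub>R\<^esub> t \<in> carrier R - q x"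
      using den_mult[OF den' h'(3)] h'(4) unfolding den_def D_def by auto
    ultimately obtain u where u: "u \<in> carrier R - q x"
      "u \<otimes>\<^bsub>R\<^esub> ((a \<otimes>\<^bsub>R\<^esub> b) \<otimes>\<^bsub>R\<^esub> \<one>\<^bsub>R\<^esub>) = u \<otimes>\<^bsub>R\<^esub> (\<one>\<^bsub>R\<^esub> \<otimes>\<^bsub>R\<^esub> (s \<otimes>\<^bsub>R\<^esub> t))"
      using qx.frac_at_eq_iff[of "a \<otimes>\<^bsub>R\<^esub> b" "s \<otimes>\<^bsub>R\<^esub> t" "\<one>\<^bsub>R\<^esub>" "\<one>\<^bsub>R\<^esub>"] a h' qx.one_diff by auto
    have "u \<otimes>\<^bsub>R\<^esub> (s \<otimes>\<^bsub>R\<^esub> t) \<notin> q x" using qx.diff_mult[OF u(1) st] by blast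
    then have "u \<otimes>\<^bsub>R\<^esub> (a \<otimes>\<^bsub>R\<^esub> b) \<notin> q x" using u st a h' by simp
    then show "a \<notin> q x" using qx.I_l_closed qx.I_r_closed u(1) h' by blast
  }
  assume na: "a \<notin> q x"
  \<comment> \<open>On \<open>D ?h\<close> both \<open>s\<close> and \<open>a\<close> are admissible
    denominators, so that \<open>a/s\<close> and \<open>s/a\<close> are sections there.\<close>
  let ?h = "h \<otimes>\<^bsub>R\<^esub> a"
  have hc: "?h \<in> carrier R" using h a by simp
  have sub: "D ?h \<subseteq> D h" "D ?h \<subseteq> D a"
  proof -
    have "h \<notin> q y \<and> a \<notin> q y" if "y \<in> D ?h" for y
    proof -
      have yA: "y \<in> A" using that by (simp add: D_def)
      interpret qy: primeideal "q y" R using q_prime[OF yA] .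
      show ?thesis using that qy.I_l_closed qy.I_r_closed h a unfolding D_def by blast
    qed
    then show "D ?h \<subseteq> D h" "D ?h \<subseteq> D a" by (auto simp: D_def)
  qed
  have xh: "x \<in> D ?h" using x na qx.I_prime h a unfolding D_def by blast
  have d: "den ?h s" "den ?h a" using den_mono[OF den hc] sub hc a by (auto simp: den_def)
  have oD': "opn X (D ?h)" using D_open hc by blast
  have eq: "fr ?h a s \<otimes>\<^bsub>sect X (D ?h)\<^esub> fr ?h s a = \<one>\<^bsub>sect X (D ?h)\<^esub>"
    "fr ?h s a \<otimes>\<^bsub>sect X (D ?h)\<^esub> fr ?h a s = \<one>\<^bsub>sect X (D ?h)\<^esub>"
  proof -
    have "fr ?h (a \<otimes>\<^bsub>R\<^esub> s) (s \<otimes>\<^bsub>R\<^esub> a) = fr ?h \<one>\<^bsub>R\<^esub> \<one>\<^bsub>R\<^esub>"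
      using a h d den_mult den_one[OF hc] R.m_comm by (intro fr_eqI[where u = "\<one>\<^bsub>R\<^esub>"]) auto
    then show eq1: "fr ?h a s \<otimes>\<^bsub>sect X (D ?h)\<^esub> fr ?h s a = \<one>\<^bsub>sect X (D ?h)\<^esub>"
      using fr_mult[OF a d(1) h(2) d(2)] fr_one[OF hc] by simp
    interpret c: cring "sect X (D ?h)" using sect_cring[OF oD'] .
    show "fr ?h s a \<otimes>\<^bsub>sect X (D ?h)\<^esub> fr ?h a s = \<one>\<^bsub>sect X (D ?h)\<^esub>"
      using c.m_comm[of "fr ?h s a" "fr ?h a s"] eq1 fr_closed a h d by simp
  qed
  have "restr X (D h) (D ?h) (fr h a s) \<in> Units (sect X (D ?h))"
    unfolding fr_restr[OF a den hc sub(1)] Units_def using eq fr_closed a h d by blast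
  then show "nv X x (D h) (fr h a s)" unfolding nv_def using oD' xh sub by blast
qed

text \<open>The section over \<open>A\<close> that the chart assigns to the element
  \<open>r\<close>, read as a fraction with denominator 1. For the canonical chart this is the
  identity; in general it is an endomorphism that turns membership in \<open>q x\<close> into
  vanishing at \<open>x\<close>.\<close>

definition \<sigma> where "\<sigma> r = fr \<one>\<^bsub>R\<^esub> r \<one>\<^bsub>R\<^esub>"

lemma sigma_hom: "\<sigma> \<in> ring_hom R R"
proof (rule ring_hom_memI)
  note d = den_one[of "\<one>\<^bsub>R\<^esub>", simplified]
  show "\<sigma> r \<in> carrier R" if "r \<in> carrier R" for r
    using fr_closed[OF that d] by (simp add: \<sigma>_def D_one)
  show "\<sigma> (r \<otimes>\<^bsub>R\<^esub> s) = \<sigma> r \<otimes>\<^bsub>R\<^esub> \<sigma> s" if "r \<in> carrier R" "s \<in> carrier R" for r s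
    using fr_mult[OF that(1) d that(2) d] by (simp add: \<sigma>_def D_one)
  show "\<sigma> (r \<oplus>\<^bsub>R\<^esub> s) = \<sigma> r \<oplus>\<^bsub>R\<^esub> \<sigma> s" if "r \<in> carrier R" "s \<in> carrier R" for r s
    using fr_add[OF that(1) d that(2) d] that by (simp add: \<sigma>_def D_one)
  show "\<sigma> \<one>\<^bsub>R\<^esub> = \<one>\<^bsub>R\<^esub>" using fr_one[of "\<one>\<^bsub>R\<^esub>"] by (simp add: \<sigma>_def D_one)
qed

lemma nv_sigma: "r \<in> carrier R \<Longrightarrow> x \<in> A \<Longrightarrow> nv X x A (\<sigma> r) \<longleftrightarrow> r \<notin> q x"
  using nv_fr[of r "\<one>\<^bsub>R\<^esub>" "\<one>\<^bsub>R\<^esub>" x] den_one[of "\<one>\<^bsub>R\<^esub>"] by (simp add: \<sigma>_def D_one)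

text \<open>The sections \<open>\<sigma> r\<close> alone determine \<open>q x\<close>, and
  \<open>q\<close> is injective on the chart.\<close>

lemma nv_separates:
  assumes x: "x \<in> A" and y: "y \<in> A" and eq: "\<And>s. s \<in> carrier R \<Longrightarrow> nv X x A s \<longleftrightarrow> nv X y A s"
  shows "x = y"
proof -
  have "r \<in> q x \<longleftrightarrow> r \<in> q y" if "r \<in> carrier R" for r
    using nv_sigma[OF that x] nv_sigma[OF that y] eq ring_hom_closed[OF sigma_hom that] by blast
  moreover have "q z \<subseteq> carrier R" if "z \<in> A" for z
  proof -
    interpret primeideal "q z" R using q_prime[OF that] .
    show ?thesis by (rule a_subset)
  qed
  ultimately show ?thesis using q_inj[OF x y] x y by blast
qed

text \<open>Locally \<open>t\<close> is a fraction \<open>a/s\<close> on some \<open>D h\<close>.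
  Then \<open>a h\<close> lies in every prime: one that does not contain \<open>h\<close> is the
  prime of a point of \<open>D h\<close>, where \<open>t\<close> vanishes. So \<open>a h\<close> is
  nilpotent, hence zero as the space is reduced, and \<open>a/s\<close> is zero on
  \<open>D h\<close>.\<close>

lemma vanishing_everywhere:
  assumes red: "reduced_space X" and U: "opn X U" "U \<subseteq> A" and t: "t \<in> carrier (sect X U)"
    and van: "\<And>x. x \<in> U \<Longrightarrow> \<not> nv X x U t"
  shows "t = \<zero>\<^bsub>sect X U\<^esub>"
proof (rule sheaf_eqI[OF U(1) t])
  interpret U: cring "sect X U" using sect_cring[OF U(1)] .
  show "\<zero>\<^bsub>sect X U\<^esub> \<in> carrier (sect X U)" by simp
  fix x assume x: "x \<in> U"
  obtain h a s where h: "h \<in> carrier R" "a \<in> carrier R" "den h s" "x \<in> D h" "D h \<subseteq> U"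
    "restr X U (D h) t = fr h a s" using section_local[OF U x t] by blast
  have oD: "opn X (D h)" using D_open h by blast
  have s: "s \<in> carrier R" using h by (simp add: den_def)
  have a: "a \<in> q y" if "y \<in> D h" for y
    using nv_fr[OF h(2,3) that] nv_restr[OF U(1) oD h(5) that t] van h that by auto
  have "a \<otimes>\<^bsub>R\<^esub> h \<in> Q" if Q: "primeideal Q R" for Q
  proof -
    interpret Q: primeideal Q R by fact
    show ?thesis
    proof (cases "h \<in> Q")
      case True
      then show ?thesis using Q.I_l_closed h by blast
    next
      case False
      then have "fst g Q \<in> D h" using q_g[OF Q] g_A[OF Q] by (simp add: D_def)
      then have "a \<in> Q" using a q_g[OF Q] by metis
      then show ?thesis using Q.I_r_closed h by blast
    qed
  qed
  then obtain n where "(a \<otimes>\<^bsub>R\<^esub> h) [^]\<^bsub>R\<^esub> (n::nat) = \<zero>\<^bsub>R\<^esub>"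
    using R.nilpotent_if_in_all_primes h by blast
  then have "a \<otimes>\<^bsub>R\<^esub> h = \<zero>\<^bsub>R\<^esub>" using red A h unfolding reduced_space_def by blast
  then have "h \<otimes>\<^bsub>R\<^esub> (a \<otimes>\<^bsub>R\<^esub> \<one>\<^bsub>R\<^esub>) = h \<otimes>\<^bsub>R\<^esub> (\<zero>\<^bsub>R\<^esub> \<otimes>\<^bsub>R\<^esub> s)" using R.m_comm h s by simp
  then have "fr h a s = fr h \<zero>\<^bsub>R\<^esub> \<one>\<^bsub>R\<^esub>" using fr_eqI[OF h(2,3) _ den_one den_self] h by simp
  then have "restr X U (D h) t = restr X U (D h) \<zero>\<^bsub>sect X U\<^esub>"
    using h fr_zero[OF h(1)] restr_zero[OF U(1) oD h(5)] by simp
  then show "\<exists>W. opn X W \<and> x \<in> W \<and> W \<subseteq> U \<and> restr X U W t = restr X U W \<zero>\<^bsub>sect X U\<^esub>"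
    using oD h by blast
qed

end

lemma affine_open_chart:
  assumes "lr_space X" "affine_open X A"
  obtains f g where "affine_chart X A f g"
proof -
  obtain f where f: "opn X A" "lrs_iso (open_subspace X A) (Spec (sect X A)) f"
    using assms unfolding affine_open_def by blast
  then obtain g where "rs_inv (open_subspace X A) (Spec (sect X A)) f g"
    unfolding lrs_iso_def rs_inv_def lrs_morphism_def by auto
  then have "affine_chart X A f g" using assms f by (simp add: affine_chart_def affine_chart_axioms_def)
  then show thesis by (rule that)
qed

section \<open>Varieties\<close>

locale var =
  fixes k :: "'k ring" and X :: "('x, 'r, 'k) k_space"
  assumes variety: "variety k X"

sublocale var \<subseteq> lr_space X
  using variety unfolding variety_def scheme_over_def is_scheme_def by unfold_locales blast

context var begin

section \<open>Consequences of irreducibility and reducedness\<close>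

lemma red: "reduced_space X" using variety unfolding variety_def by simp

lemma irred: "irreducible_in (topo X) (points X)" using variety unfolding variety_def by simp

lemma open_Int_nonempty:
  assumes "opn X U" "U \<noteq> {}" "opn X V" "V \<noteq> {}" shows "U \<inter> V \<noteq> {}"
proof
  assume UV: "U \<inter> V = {}"
  have "closedin (topo X) (points X - U)" "closedin (topo X) (points X - V)" using assms by auto
  moreover have "points X \<subseteq> (points X - U) \<union> (points X - V)" using UV by auto
  ultimately have "points X \<subseteq> points X - U \<or> points X \<subseteq> points X - V"
    using irred unfolding irreducible_in_def by blast
  then show False using assms openin_subset by fastforce
qed

lemma chart:
  assumes "x \<in> points X"
  obtains A f g where "affine_open X A" "x \<in> A" "affine_chart X A f g"
proof -
  obtain A where A: "x \<in> A" "affine_open X A"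
    using variety assms unfolding variety_def scheme_over_def is_scheme_def by blast
  then show thesis using affine_open_chart[OF lr_space_axioms A(2)] that by blast
qed

text \<open>If \<open>t\<close> were invertible near some point of \<open>N\<close>, its restriction
  to a nonempty intersection with \<open>N'\<close> would be both a unit and zero. So
  \<open>t\<close> vanishes at every point of \<open>N\<close>, and
  \<open>vanishing_everywhere\<close> applies on affine neighbourhoods.\<close>

lemma zero_if_zero_on_open:
  assumes N: "opn X N" "t \<in> carrier (sect X N)" and N': "opn X N'" "N' \<noteq> {}" "N' \<subseteq> N"
    and zero: "restr X N N' t = \<zero>\<^bsub>sect X N'\<^esub>"
  shows "t = \<zero>\<^bsub>sect X N\<^esub>"
proof (rule sheaf_eqI[OF N])
  interpret N: cring "sect X N" using sect_cring[OF N(1)] .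
  show "\<zero>\<^bsub>sect X N\<^esub> \<in> carrier (sect X N)" by simp
  have van: "\<not> nv X y N t" if y: "y \<in> N" for y
  proof
    assume "nv X y N t"
    then obtain W where W: "opn X W" "y \<in> W" "W \<subseteq> N" "restr X N W t \<in> Units (sect X W)"
      unfolding nv_def by blast
    obtain z where z: "z \<in> W \<inter> N'" using open_Int_nonempty[OF W(1) _ N'(1,2)] W(2) by blast
    have o: "opn X (W \<inter> N')" using W N' by blast
    interpret c: cring "sect X (W \<inter> N')" using sect_cring[OF o] .
    have "restr X W (W \<inter> N') (restr X N W t) \<in> Units (sect X (W \<inter> N'))"
      using restr_unit[OF W(1) o _ W(4)] by simp
    then have "restr X N (W \<inter> N') t \<in> Units (sect X (W \<inter> N'))" using W N N' o by simp
    moreover have "restr X N (W \<inter> N') t = restr X N' (W \<inter> N') (restr X N N' t)" using N N' o by simp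
    moreover have "\<dots> = \<zero>\<^bsub>sect X (W \<inter> N')\<^esub>" unfolding zero using restr_zero[OF N'(1) o] by simp
    ultimately have "\<zero>\<^bsub>sect X (W \<inter> N')\<^esub> \<in> Units (sect X (W \<inter> N'))" by simp
    then have "\<one>\<^bsub>sect X (W \<inter> N')\<^esub> = \<zero>\<^bsub>sect X (W \<inter> N')\<^esub>" unfolding Units_def by auto
    then show False using sect_nontrivial[OF o z] by simp
  qed
  fix x assume x: "x \<in> N"
  then have "x \<in> points X" using N openin_subset by blast
  then obtain A f g where A: "affine_open X A" "x \<in> A" "affine_chart X A f g" by (rule chart)
  interpret A: affine_chart X A f g by fact
  have o: "opn X (N \<inter> A)" using N A.A by blast
  have "restr X N (N \<inter> A) t = \<zero>\<^bsub>sect X (N \<inter> A)\<^esub>"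
  proof (rule A.vanishing_everywhere[OF red o])
    fix y assume "y \<in> N \<inter> A"
    then show "\<not> nv X y (N \<inter> A) (restr X N (N \<inter> A) t)" using nv_restr[OF N(1) o _ _ N(2)] van by auto
  qed (use N o in auto)
  also have "\<dots> = restr X N (N \<inter> A) \<zero>\<^bsub>sect X N\<^esub>" using restr_zero[OF N(1) o] by simp
  finally show "\<exists>W. opn X W \<and> x \<in> W \<and> W \<subseteq> N \<and> restr X N W t = restr X N W \<zero>\<^bsub>sect X N\<^esub>"
    using o A x by blast
qed

text \<open>Sections can thus be compared on any nonempty open set, as if inside the function
  field.\<close>

lemma restr_inj:
  assumes N: "opn X N" "s \<in> carrier (sect X N)" "t \<in> carrier (sect X N)"
    and N': "opn X N'" "N' \<noteq> {}" "N' \<subseteq> N" and eq: "restr X N N' s = restr X N N' t"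
  shows "s = t"
proof -
  interpret N: cring "sect X N" using sect_cring[OF N(1)] .
  interpret N': cring "sect X N'" using sect_cring[OF N'(1)] .
  have "restr X N N' (s \<ominus>\<^bsub>sect X N\<^esub> t) = \<zero>\<^bsub>sect X N'\<^esub>"
    using N N' eq by (simp add: a_minus_def restr_add restr_minus N'.r_neg)
  then have "s \<ominus>\<^bsub>sect X N\<^esub> t = \<zero>\<^bsub>sect X N\<^esub>"
    using zero_if_zero_on_open[OF N(1) _ N'] N by simp
  then show ?thesis using N by simp
qed

text \<open>The elements \<open>d\<close> for which \<open>\<sigma> d\<close> clears the
  denominators of \<open>t\<close> form an ideal. A local expression \<open>a/s\<close> of
  \<open>t\<close> near the point of a maximal ideal \<open>P\<close> puts \<open>s\<close>, which
  is outside \<open>P\<close>, into this ideal. So it contains 1.\<close>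

lemma sigma_surj:
  assumes "affine_chart X A f g" and t: "t \<in> carrier (sect X A)"
  shows "\<exists>r\<in>carrier (sect X A). affine_chart.\<sigma> X A f r = t"
proof -
  interpret A: affine_chart X A f g by fact
  note hom = A.sigma_hom
  interpret s: ring_hom_cring A.R A.R A.\<sigma>
    using hom A.R.is_cring by (simp add: ring_hom_cring_def ring_hom_cring_axioms_def)
  define I where "I = {d \<in> carrier A.R. \<exists>a\<in>carrier A.R. A.\<sigma> d \<otimes>\<^bsub>A.R\<^esub> t = A.\<sigma> a}"
  have ideal: "ideal I A.R"
  proof (rule idealI)
    show "ring A.R" by (rule A.R.ring_axioms)
    have zero: "A.\<sigma> \<zero>\<^bsub>A.R\<^esub> \<otimes>\<^bsub>A.R\<^esub> t = A.\<sigma> \<zero>\<^bsub>A.R\<^esub>" using t by simp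
    have inv: "\<ominus>\<^bsub>A.R\<^esub> d \<in> I" if "d \<in> I" for d
    proof -
      from that obtain a where a: "d \<in> carrier A.R" "a \<in> carrier A.R" "A.\<sigma> d \<otimes>\<^bsub>A.R\<^esub> t = A.\<sigma> a"
        unfolding I_def by blast
      then have "A.\<sigma> (\<ominus>\<^bsub>A.R\<^esub> d) \<otimes>\<^bsub>A.R\<^esub> t = A.\<sigma> (\<ominus>\<^bsub>A.R\<^esub> a)" using t by (simp add: A.R.l_minus)
      then show ?thesis unfolding I_def using a by blast
    qed
    have sum: "d \<oplus>\<^bsub>A.R\<^esub> e \<in> I" if "d \<in> I" "e \<in> I" for d e
    proof -
      from that obtain a b where ab: "d \<in> carrier A.R" "a \<in> carrier A.R" "A.\<sigma> d \<otimes>\<^bsub>A.R\<^esub> t = A.\<sigma> a"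
        "e \<in> carrier A.R" "b \<in> carrier A.R" "A.\<sigma> e \<otimes>\<^bsub>A.R\<^esub> t = A.\<sigma> b"
        unfolding I_def by blast
      have "A.\<sigma> (d \<oplus>\<^bsub>A.R\<^esub> e) \<otimes>\<^bsub>A.R\<^esub> t = A.\<sigma> (a \<oplus>\<^bsub>A.R\<^esub> b)" using ab t by (simp add: A.R.l_distr)
      then show ?thesis unfolding I_def using ab by blast
    qed
    show "subgroup I (add_monoid A.R)"
    proof (rule A.R.add.subgroupI)
      show "I \<subseteq> carrier A.R" by (auto simp: I_def)
      show "I \<noteq> {}" using zero unfolding I_def by blast
    qed (use inv sum in \<open>auto simp: a_inv_def\<close>)
    fix d x assume "d \<in> I" and x: "x \<in> carrier A.R"
    then obtain a where a: "d \<in> carrier A.R" "a \<in> carrier A.R" "A.\<sigma> d \<otimes>\<^bsub>A.R\<^esub> t = A.\<sigma> a"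
      unfolding I_def by blast
    then have "A.\<sigma> (x \<otimes>\<^bsub>A.R\<^esub> d) \<otimes>\<^bsub>A.R\<^esub> t = A.\<sigma> (x \<otimes>\<^bsub>A.R\<^esub> a)"
      using t x by (simp add: A.R.m_assoc)
    then show "x \<otimes>\<^bsub>A.R\<^esub> d \<in> I" unfolding I_def using a x by blast
    then show "d \<otimes>\<^bsub>A.R\<^esub> x \<in> I" using A.R.m_comm a x by simp
  qed
  have "\<one>\<^bsub>A.R\<^esub> \<in> I"
  proof (rule ccontr)
    assume "\<one>\<^bsub>A.R\<^esub> \<notin> I"
    then obtain P where "maximalideal P A.R" and IP: "I \<subseteq> P" using A.R.exists_maximal[OF ideal] by blast
    then have P: "primeideal P A.R" using A.R.maximalideal_prime by blast
    let ?x = "fst g P"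
    have x: "?x \<in> A" "A.q ?x = P" using A.g_A[OF P] A.q_g[OF P] by auto
    obtain h a s where h: "h \<in> carrier A.R" "a \<in> carrier A.R" "A.den h s" "?x \<in> A.D h" "A.D h \<subseteq> A"
      "restr X A (A.D h) t = A.fr h a s" using A.section_local[OF A.A subset_refl x(1) t] by blast
    have s: "s \<in> carrier A.R" "s \<notin> P" using h x unfolding A.den_def A.D_def by auto
    have oD: "opn X (A.D h)" using A.D_open h by blast
    have r: "restr X A (A.D h) (A.\<sigma> b) = A.fr h b \<one>\<^bsub>A.R\<^esub>" if "b \<in> carrier A.R" for b
      using A.fr_restr[OF that A.den_one[of "\<one>\<^bsub>A.R\<^esub>"] h(1)] h(5) by (simp add: A.\<sigma>_def A.D_one)
    \<comment> \<open>The equation holds on \<open>D h\<close>; by \<open>restr_inj\<close> it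
      extends to all of \<open>A\<close> at once, in place of a gluing of local numerators.\<close>
    have "A.\<sigma> s \<otimes>\<^bsub>A.R\<^esub> t = A.\<sigma> a"
    proof (rule restr_inj[OF A.A _ _ oD _ h(5)])
      have "restr X A (A.D h) (A.\<sigma> s \<otimes>\<^bsub>A.R\<^esub> t) = A.fr h s \<one>\<^bsub>A.R\<^esub> \<otimes>\<^bsub>sect X (A.D h)\<^esub> A.fr h a s"
        using s h t oD A.A r by (simp add: restr_mult)
      also have "\<dots> = A.fr h (s \<otimes>\<^bsub>A.R\<^esub> a) (\<one>\<^bsub>A.R\<^esub> \<otimes>\<^bsub>A.R\<^esub> s)" using A.fr_mult A.den_one s h by simp
      also have "\<dots> = A.fr h a \<one>\<^bsub>A.R\<^esub>"
        using A.den_one s h A.R.m_comm by (intro A.fr_eqI[where u = "\<one>\<^bsub>A.R\<^esub>"]) auto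
      also have "\<dots> = restr X A (A.D h) (A.\<sigma> a)" using r h by simp
      finally show "restr X A (A.D h) (A.\<sigma> s \<otimes>\<^bsub>A.R\<^esub> t) = restr X A (A.D h) (A.\<sigma> a)" .
    qed (use h s t in auto)
    then have "s \<in> I" unfolding I_def using s h by blast
    then show False using IP s by blast
  qed
  then obtain a where a: "a \<in> carrier A.R" "A.\<sigma> \<one>\<^bsub>A.R\<^esub> \<otimes>\<^bsub>A.R\<^esub> t = A.\<sigma> a" unfolding I_def by blast
  then have "A.\<sigma> a = t" using t s.hom_one by simp
  then show ?thesis using a by blast
qed

text \<open>\<open>P\<close> consists of sections, while the chart needs a prime of the form
  \<open>q z\<close>. Pulling \<open>P\<close> back along \<open>\<sigma>\<close> converts one into
  the other, and surjectivity brings every section into the form \<open>\<sigma> r\<close>.\<close>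

lemma affine_point_of_prime:
  assumes A: "affine_open X A" and P: "primeideal P (sect X A)"
  shows "\<exists>z\<in>A. \<forall>s\<in>carrier (sect X A). nv X z A s \<longleftrightarrow> s \<notin> P"
proof -
  obtain f g where ch: "affine_chart X A f g" using affine_open_chart[OF lr_space_axioms A] by blast
  interpret A: affine_chart X A f g by fact
  interpret s: ring_hom_ring A.R A.R A.\<sigma>
    by (rule ring_hom_ringI2[OF A.R.ring_axioms A.R.ring_axioms A.sigma_hom])
  let ?Q = "{r \<in> carrier A.R. A.\<sigma> r \<in> P}"
  have Q: "primeideal ?Q A.R" by (rule s.primeideal_vimage[OF A.R.is_cring P])
  let ?z = "fst g ?Q"
  have z: "?z \<in> A" "A.q ?z = ?Q" using A.g_A[OF Q] A.q_g[OF Q] by auto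
  have "nv X ?z A s \<longleftrightarrow> s \<notin> P" if s: "s \<in> carrier A.R" for s
  proof -
    obtain r where r: "r \<in> carrier A.R" "A.\<sigma> r = s" using sigma_surj[OF ch s] by blast
    then show ?thesis using A.nv_sigma[OF r(1) z(1)] z(2) by auto
  qed
  then show ?thesis using z(1) by blast
qed

end

section \<open>Morphisms defined on open subsets\<close>

text \<open>Equals \<open>preim (open_subscheme X U) f V\<close> for open \<open>U\<close>. It
  depends on the map of points only, so that it is unaffected by restricting comorphisms.\<close>

definition pb :: "'x set \<Rightarrow> ('x, 'r, 'y, 's) mor \<Rightarrow> 'y set \<Rightarrow> 'x set" where
  "pb U f V = {x \<in> U. fst f x \<in> V}"

lemma preim_open_subscheme: "opn X U \<Longrightarrow> preim (open_subscheme X U) f V = pb U f V"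
  unfolding preim_def pb_def using openin_subset[of "topo X" U] by auto

lemma pb_subset: "pb U f V \<subseteq> U" and pb_mono: "V \<subseteq> W \<Longrightarrow> pb U f V \<subseteq> pb U f W"
  unfolding pb_def by auto

text \<open>A representative \<open>(U, f)\<close> of a rational map, except that \<open>U\<close>
  may be empty.\<close>

locale kmor = X: var k X + Y: var k Y
  for k :: "'k ring" and X :: "('x, 'r, 'k) k_space" and Y :: "('y, 's, 'k) k_space" +
  fixes U :: "'x set" and f :: "('x, 'r, 'y, 's) mor"
  assumes U: "opn X U"
    and mor: "k_morphism k (open_subscheme X U) Y f"

lemma (in var) struc_hom: "struc X \<in> ring_hom k (sect X (points X))"
  using variety unfolding variety_def scheme_over_def by simp

lemma (in var) struc_closed: "a \<in> carrier k \<Longrightarrow> struc X a \<in> carrier (sect X (points X))"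
  by (rule ring_hom_closed[OF struc_hom])

lemma (in var) presheaf_open:
  assumes "opn X U" shows "presheaf (open_subscheme X U)"
  by (rule presheaf_sub[OF assms]) simp_all

lemma (in var) opn_open: "opn X U \<Longrightarrow> opn (open_subscheme X U) V \<longleftrightarrow> opn X V \<and> V \<subseteq> U"
  using openin_open_subtopology by auto

lemma (in var) points_open: "opn X U \<Longrightarrow> points (open_subscheme X U) = U"
  using openin_subset[of "topo X" U] by auto

lemma (in var) nv_open: "opn X U \<Longrightarrow> V \<subseteq> U \<Longrightarrow> nv (open_subscheme X U) x V s \<longleftrightarrow> nv X x V s"
  by (rule nv_sub) simp_all

context kmor begin

lemma lrs_mor: "lrs_morphism (open_subscheme X U) Y f" and rs_mor: "rs_morphism (open_subscheme X U) Y f"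
  using mor unfolding k_morphism_def lrs_morphism_def by auto

lemma pb_open: "opn Y V \<Longrightarrow> opn X (pb U f V)"
  using rs_preim_open[OF rs_mor, of V] X.opn_open[OF U] by (simp add: preim_open_subscheme[OF U])

lemma hom: "opn Y V \<Longrightarrow> snd f V \<in> ring_hom (sect Y V) (sect X (pb U f V))"
  using rs_morphismD(2)[OF rs_mor, of V] by (simp add: preim_open_subscheme[OF U])

lemma closed: "opn Y V \<Longrightarrow> s \<in> carrier (sect Y V) \<Longrightarrow> snd f V s \<in> carrier (sect X (pb U f V))"
  by (rule ring_hom_closed[OF hom])

lemma compat: "opn Y V \<Longrightarrow> opn Y W \<Longrightarrow> W \<subseteq> V \<Longrightarrow> s \<in> carrier (sect Y V) \<Longrightarrow>
    snd f W (restr Y V W s) = restr X (pb U f V) (pb U f W) (snd f V s)"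
  using rs_morphismD(3)[OF rs_mor, of V W s] by (simp add: preim_open_subscheme[OF U])

lemma point: "x \<in> U \<Longrightarrow> fst f x \<in> points Y"
  using rs_point[OF rs_mor, of x] X.points_open[OF U] by blast

lemma pb_points: "pb U f (points Y) = U" unfolding pb_def using point by auto

lemma struc: "a \<in> carrier k \<Longrightarrow> snd f (points Y) (struc Y a) = restr X (points X) U (struc X a)"
  using mor unfolding k_morphism_def by simp

text \<open>One direction is the locality of the morphism; the other holds because ring
  homomorphisms preserve units.\<close>

lemma nv_pb:
  assumes x: "x \<in> U" "fst f x \<in> V" and V: "opn Y V" "s \<in> carrier (sect Y V)"
  shows "nv X x (pb U f V) (snd f V s) \<longleftrightarrow> nv Y (fst f x) V s"
proof
  have X': "presheaf (open_subscheme X U)" by (rule X.presheaf_open[OF U])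
  assume "nv X x (pb U f V) (snd f V s)"
  then have "nv (open_subscheme X U) x (preim (open_subscheme X U) f V) (snd f V s)"
    by (simp add: preim_open_subscheme[OF U] X.nv_open[OF U pb_subset])
  then show "nv Y (fst f x) V s"
    using lrs_mor[unfolded lrs_morphism_iff[OF X' Y.presheaf_axioms]] x V X.points_open[OF U]
    by (metis (no_types, lifting))
next
  assume "nv Y (fst f x) V s"
  then obtain W where W: "opn Y W" "fst f x \<in> W" "W \<subseteq> V" "restr Y V W s \<in> Units (sect Y W)"
    unfolding nv_def by blast
  have "snd f W (restr Y V W s) \<in> Units (sect X (pb U f W))"
    using cring.units_ring_hom[OF Y.sect_cring X.sect_cring hom] pb_open W by blast
  then have "restr X (pb U f V) (pb U f W) (snd f V s) \<in> Units (sect X (pb U f W))"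
    using compat V W by simp
  moreover have "x \<in> pb U f W" using x W by (simp add: pb_def)
  ultimately show "nv X x (pb U f V) (snd f V s)"
    unfolding nv_def using pb_open[OF W(1)] pb_mono[OF W(3)] by (intro exI[of _ "pb U f W"] conjI)
qed

end

lemma kmorI:
  fixes X :: "('x, 'r, 'k) k_space" and Y :: "('y, 's, 'k) k_space"
  assumes X: "var k X" and Y: "var k Y" and U: "opn X U"
    and point: "\<And>x. x \<in> U \<Longrightarrow> fst f x \<in> points Y"
    and pb_open: "\<And>V. opn Y V \<Longrightarrow> opn X (pb U f V)"
    and hom: "\<And>V. opn Y V \<Longrightarrow> snd f V \<in> ring_hom (sect Y V) (sect X (pb U f V))"
    and compat: "\<And>V W s. opn Y V \<Longrightarrow> opn Y W \<Longrightarrow> W \<subseteq> V \<Longrightarrow> s \<in> carrier (sect Y V) \<Longrightarrow>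
      snd f W (restr Y V W s) = restr X (pb U f V) (pb U f W) (snd f V s)"
    and struc: "\<And>a. a \<in> carrier k \<Longrightarrow> snd f (points Y) (struc Y a) = restr X (points X) U (struc X a)"
    and loc: "\<And>x V s. x \<in> U \<Longrightarrow> fst f x \<in> V \<Longrightarrow> opn Y V \<Longrightarrow> s \<in> carrier (sect Y V) \<Longrightarrow>
      nv X x (pb U f V) (snd f V s) \<Longrightarrow> nv Y (fst f x) V s"
  shows "kmor k X Y U f"
proof -
  interpret X: var k X by fact
  interpret Y: var k Y by fact
  note pre = preim_open_subscheme[OF U]
  have "rs_morphism (open_subscheme X U) Y f" unfolding rs_morphism_def
  proof (intro conjI allI impI ballI)
    show "continuous_map (topo (open_subscheme X U)) (topo Y) (fst f)"
      unfolding continuous_map_def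
    proof (intro conjI allI impI)
      show "fst f \<in> points (open_subscheme X U) \<rightarrow> points Y"
        unfolding X.points_open[OF U] using point by blast
      fix V assume "opn Y V"
      then have "opn (open_subscheme X U) (pb U f V)" using X.opn_open[OF U] pb_open pb_subset by metis
      then show "opn (open_subscheme X U) {x \<in> points (open_subscheme X U). fst f x \<in> V}"
        unfolding X.points_open[OF U] pb_def .
    qed
  qed (use hom compat in \<open>simp_all add: pre\<close>)
  moreover have "nv (open_subscheme X U) x (preim (open_subscheme X U) f V) (snd f V s) \<Longrightarrow> nv Y (fst f x) V s"
    if "x \<in> points (open_subscheme X U)" "opn Y V \<and> fst f x \<in> V" "s \<in> carrier (sect Y V)" for x V s
    using that loc X.points_open[OF U] unfolding pre X.nv_open[OF U pb_subset] by blast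
  ultimately have "lrs_morphism (open_subscheme X U) Y f"
    using lrs_morphism_iff[OF X.presheaf_open[OF U] Y.presheaf_axioms] by blast
  then have "k_morphism k (open_subscheme X U) Y f" using struc unfolding k_morphism_def by simp
  then show ?thesis using U by unfold_locales
qed

subsection \<open>Agreement on an open set\<close>

text \<open>Equality of the restrictions of \<open>f\<close> and \<open>g\<close> to
  \<open>W\<close>, with the restrictions of sections spelled out. As the maps of points agree on
  \<open>W\<close>, \<open>pb W f T\<close> stands for \<open>pb W g T\<close> as well.\<close>

definition agree ::
    "('x, 'r, 'k) k_space \<Rightarrow> ('y, 's, 'k) k_space \<Rightarrow> 'x set \<Rightarrow> ('x, 'r, 'y, 's) mor \<Rightarrow>
     'x set \<Rightarrow> ('x, 'r, 'y, 's) mor \<Rightarrow> 'x set \<Rightarrow> bool" where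
  "agree X Y U f V g W \<longleftrightarrow> opn X W \<and> W \<subseteq> U \<inter> V \<and> (\<forall>x\<in>W. fst f x = fst g x) \<and>
     (\<forall>T s. opn Y T \<longrightarrow> s \<in> carrier (sect Y T) \<longrightarrow>
        restr X (pb U f T) (pb W f T) (snd f T s) = restr X (pb V g T) (pb W f T) (snd g T s))"

lemma agreeD:
  assumes "agree X Y U f V g W"
  shows "opn X W" "W \<subseteq> U" "W \<subseteq> V" "x \<in> W \<Longrightarrow> fst f x = fst g x" "pb W f T = pb W g T"
    "opn Y T \<Longrightarrow> s \<in> carrier (sect Y T) \<Longrightarrow>
        restr X (pb U f T) (pb W f T) (snd f T s) = restr X (pb V g T) (pb W f T) (snd g T s)"
  using assms unfolding agree_def pb_def by auto

lemma agree_sym: "agree X Y U f V g W \<Longrightarrow> agree X Y V g U f W"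
  unfolding agree_def by (auto simp: pb_def cong: conj_cong)

lemma (in kmor) pb_sub_open: "opn X W \<Longrightarrow> W \<subseteq> U \<Longrightarrow> opn Y T \<Longrightarrow> opn X (pb W f T)"
proof -
  assume "opn X W" "W \<subseteq> U" "opn Y T"
  then have "opn X (pb U f T \<inter> W)" using pb_open by blast
  moreover have "pb U f T \<inter> W = pb W f T" using \<open>W \<subseteq> U\<close> by (auto simp: pb_def)
  ultimately show ?thesis by simp
qed

lemma pb_sub_mono: "W \<subseteq> U \<Longrightarrow> pb W f T \<subseteq> pb U f T" by (auto simp: pb_def)

lemma agree_mono:
  assumes f: "kmor k X Y U f" and g: "kmor k X Y V g" and ag: "agree X Y U f V g W"
    and W': "opn X W'" "W' \<subseteq> W"
  shows "agree X Y U f V g W'"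
proof -
  interpret f: kmor k X Y U f by fact
  interpret g: kmor k X Y V g by fact
  note D = agreeD[OF ag]
  show ?thesis unfolding agree_def
  proof (intro conjI ballI allI impI)
    fix T s assume T: "opn Y T" and s: "s \<in> carrier (sect Y T)"
    have o: "opn X (pb W' f T)" "opn X (pb W f T)" "pb W' f T \<subseteq> pb W f T"
      using f.pb_sub_open[OF W'(1) subset_trans[OF W'(2) D(2)] T] f.pb_sub_open[OF D(1,2) T] pb_sub_mono[OF W'(2), of f T] by simp_all
    have i: "pb W f T \<subseteq> pb U f T" "pb W f T \<subseteq> pb V g T"
      using pb_sub_mono[OF D(2), of f T] pb_sub_mono[OF D(3), of g T] D(5)[of T] by simp_all
    have "restr X (pb U f T) (pb W' f T) (snd f T s)
        = restr X (pb W f T) (pb W' f T) (restr X (pb U f T) (pb W f T) (snd f T s))"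
      using o i f.closed[OF T s] f.pb_open[OF T] by simp
    also have "\<dots> = restr X (pb V g T) (pb W' f T) (snd g T s)"
      unfolding D(6)[OF T s] using o i g.closed[OF T s] g.pb_open[OF T] by simp
    finally show "restr X (pb U f T) (pb W' f T) (snd f T s) = restr X (pb V g T) (pb W' f T) (snd g T s)" .
  qed (use W' D in auto)
qed

lemma mor_eq_agree:
  assumes f: "kmor k X Y U f" and g: "kmor k X Y V g" and W: "opn X W" "W \<subseteq> U \<inter> V"
  shows "mor_eq (open_subscheme X W) Y
      (mor_restrict (open_subscheme X U) f W) (mor_restrict (open_subscheme X V) g W) \<longleftrightarrow> agree X Y U f V g W"
proof -
  interpret f: kmor k X Y U f by fact
  interpret g: kmor k X Y V g by fact
  have "pb U f T \<inter> W = pb W f T" "pb V g T \<inter> W = pb W g T" for T using W by (auto simp: pb_def)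
  moreover have "(\<forall>x\<in>W. fst f x = fst g x) \<Longrightarrow> pb W g T = pb W f T" for T by (auto simp: pb_def)
  ultimately show ?thesis
    unfolding mor_eq_def mor_restrict_def agree_def f.X.points_open[OF W(1)]
      preim_open_subscheme[OF f.U] preim_open_subscheme[OF g.U] using W by auto
qed

subsection \<open>Separatedness\<close>

lemma (in var) affine_Int:
  assumes "affine_open X A" "affine_open X B"
  shows "affine_open X (A \<inter> B)"
    "generate_ring (sect X (A \<inter> B)) (restr X A (A \<inter> B) ` carrier (sect X A) \<union> restr X B (A \<inter> B) ` carrier (sect X B))
      = carrier (sect X (A \<inter> B))"
  using variety assms unfolding variety_def separated_scheme_def by auto

text \<open>
  Writing \<open>y = f x\<close> and \<open>y' = g x\<close> with affine neighbourhoods \<open>A\<close> and \<open>B\<close>, the ring of \<open>A \<inter> B\<close>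
  is generated by the rings of \<open>A\<close> and \<open>B\<close>, so its pullback to \<open>W\<close> extends to a neighbourhood \<open>N\<close>
  of \<open>x\<close>. The functions vanishing at \<open>x\<close> then define a point \<open>z\<close> of \<open>A \<inter> B\<close> which cannot be
  distinguished from \<open>y\<close> on \<open>A\<close>, nor from \<open>y'\<close> on \<open>B\<close>.
\<close>

theorem agree_points:
  assumes f: "kmor k X Y U f" and g: "kmor k X Y V g" and ag: "agree X Y U f V g W" and W0: "W \<noteq> {}"
    and x: "x \<in> U" "x \<in> V"
  shows "fst f x = fst g x"
proof -
  interpret f: kmor k X Y U f by fact
  interpret g: kmor k X Y V g by fact
  note D = agreeD[OF ag]
  obtain A fa ga where A: "affine_open Y A" "fst f x \<in> A" "affine_chart Y A fa ga"
    using f.Y.chart[OF f.point[OF x(1)]] by blast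
  obtain B fb gb where B: "affine_open Y B" "fst g x \<in> B" "affine_chart Y B fb gb"
    using f.Y.chart[OF g.point[OF x(2)]] by blast
  interpret A: affine_chart Y A fa ga by fact
  interpret B: affine_chart Y B fb gb by fact
  define C where "C = A \<inter> B"
  have C: "affine_open Y C" "opn Y C" "C \<subseteq> A" "C \<subseteq> B" unfolding C_def
    using f.Y.affine_Int(1)[OF A(1) B(1)] A.A B.A by auto
  \<comment> \<open>On \<open>N\<close> sections of \<open>A\<close> can be pulled back along
    \<open>f\<close> and sections of \<open>B\<close> along \<open>g\<close>. The point
    \<open>x\<close> is not yet known to be mapped into \<open>A \<inter> B\<close>, so sections
    over \<open>C\<close> are first pulled back to \<open>W'\<close> only.\<close>
  define N where "N = pb U f A \<inter> pb V g B"
  have oN: "opn X N" "x \<in> N" unfolding N_def using f.pb_open[OF A.A] g.pb_open[OF B.A] x A B by (auto simp: pb_def)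
  define W' where "W' = W \<inter> N"
  have oW': "opn X W'" "W' \<noteq> {}" "W' \<subseteq> N" "W' \<subseteq> W"
    using f.X.open_Int_nonempty[OF D(1) W0 oN(1)] oN D(1) by (auto simp: W'_def)
  note D' = agreeD[OF agree_mono[OF f g ag oW'(1,4)]]
  have W'C: "W' \<subseteq> pb U f C" "W' \<subseteq> pb U f A" "W' \<subseteq> pb U f B" "W' \<subseteq> pb V g B"
  proof -
    have "w \<in> U \<and> w \<in> V \<and> fst f w \<in> A \<and> fst f w \<in> B \<and> fst g w \<in> B" if "w \<in> W'" for w
    proof -
      have "fst f w = fst g w" using D'(4)[OF that] .
      moreover have "w \<in> N" using that oW'(3) by blast
      ultimately show ?thesis unfolding N_def pb_def by simp
    qed
    then show "W' \<subseteq> pb U f C" "W' \<subseteq> pb U f A" "W' \<subseteq> pb U f B" "W' \<subseteq> pb V g B"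
      unfolding C_def pb_def by blast+
  qed
  note oC = f.pb_open[OF C(2)] and oA = f.pb_open[OF A.A] and oB = f.pb_open[OF B.A] and oB' = g.pb_open[OF B.A]
  have NA: "N \<subseteq> pb U f A" "N \<subseteq> pb V g B" by (auto simp: N_def)
  define e where "e s = restr X (pb U f C) W' (snd f C s)" for s
  have e: "e \<in> ring_hom (sect Y C) (sect X W')"
    using ring_hom_trans[OF f.hom[OF C(2)] f.X.restr_hom[OF oC oW'(1) W'C(1)]]
    unfolding e_def comp_def .
  interpret C: cring "sect Y C" using f.Y.sect_cring[OF C(2)] .
  interpret N: cring "sect X N" using f.X.sect_cring[OF oN(1)] .
  interpret W': cring "sect X W'" using f.X.sect_cring[OF oW'(1)] .
  interpret e: ring_hom_cring "sect Y C" "sect X W'" e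
    using e by unfold_locales
  interpret r: ring_hom_cring "sect X N" "sect X W'" "restr X N W'"
    using f.X.restr_hom[OF oN(1) oW'(1,3)] by unfold_locales
  have eA: "restr X N W' (restr X (pb U f A) N (snd f A s)) = e (restr Y A C s)"
    and clA: "restr X (pb U f A) N (snd f A s) \<in> carrier (sect X N)" if "s \<in> carrier (sect Y A)" for s
    unfolding e_def
    using that f.compat[OF A.A C(2,3) that] f.closed[OF A.A that] oA oN oW' oC W'C NA pb_mono[OF C(3), of U f]
    by simp_all
  have eB: "restr X N W' (restr X (pb V g B) N (snd g B s)) = e (restr Y B C s)"
    and clB: "restr X (pb V g B) N (snd g B s) \<in> carrier (sect X N)" if s: "s \<in> carrier (sect Y B)" for s
  proof -
    show "restr X (pb V g B) N (snd g B s) \<in> carrier (sect X N)"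
      using g.closed[OF B.A s] oB' oN NA by simp
    have "pb W' f B = W'" using W'C(3) by (auto simp: pb_def)
    then have "restr X (pb V g B) W' (snd g B s) = restr X (pb U f B) W' (snd f B s)"
      using D'(6)[OF B.A s] by simp
    then show "restr X N W' (restr X (pb V g B) N (snd g B s)) = e (restr Y B C s)"
      unfolding e_def
      using s f.compat[OF B.A C(2,4) s] f.closed[OF B.A s] g.closed[OF B.A s] oB oB' oN oW' oC W'C NA pb_mono[OF C(4), of U f]
      by simp
  qed
  \<comment> \<open>Generators coming from \<open>A\<close> extend to \<open>N\<close> through
    \<open>f\<close>, those from \<open>B\<close> through \<open>g\<close>; the sections whose
    pullback extends are closed under the ring operations.\<close>
  have ext: "\<exists>t\<in>carrier (sect X N). restr X N W' t = e s" if "s \<in> carrier (sect Y C)" for s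
  proof -
    have "s \<in> generate_ring (sect Y C) (restr Y A C ` carrier (sect Y A) \<union> restr Y B C ` carrier (sect Y B))"
      using f.Y.affine_Int(2)[OF A(1) B(1), folded C_def] that by simp
    then have "s \<in> carrier (sect Y C) \<and> (\<exists>t\<in>carrier (sect X N). restr X N W' t = e s)"
    proof (induction rule: generate_ring.induct)
      case one
      show ?case using r.hom_one by (auto intro!: bexI[of _ "\<one>\<^bsub>sect X N\<^esub>"])
    next
      case (incl h)
      then consider s where "s \<in> carrier (sect Y A)" "h = restr Y A C s"
        | s where "s \<in> carrier (sect Y B)" "h = restr Y B C s" by blast
      then show ?case
      proof cases
        case 1
        then show ?thesis using eA[OF 1(1)] clA[OF 1(1)] A.A C by auto
      next
        case 2
        then show ?thesis using eB[OF 2(1)] clB[OF 2(1)] B.A C by auto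
      qed
    next
      case (a_inv h)
      then obtain t where "t \<in> carrier (sect X N)" "restr X N W' t = e h" by blast
      then show ?case using a_inv by (auto intro!: bexI[of _ "\<ominus>\<^bsub>sect X N\<^esub> t"])
    next
      case (eng_add h1 h2)
      then obtain t1 t2 where "t1 \<in> carrier (sect X N)" "restr X N W' t1 = e h1"
        "t2 \<in> carrier (sect X N)" "restr X N W' t2 = e h2" by blast
      then show ?case using eng_add by (auto intro!: bexI[of _ "t1 \<oplus>\<^bsub>sect X N\<^esub> t2"])
    next
      case (eng_mult h1 h2)
      then obtain t1 t2 where "t1 \<in> carrier (sect X N)" "restr X N W' t1 = e h1"
        "t2 \<in> carrier (sect X N)" "restr X N W' t2 = e h2" by blast
      then show ?case using eng_mult by (auto intro!: bexI[of _ "t1 \<otimes>\<^bsub>sect X N\<^esub> t2"])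
    qed
    then show ?thesis by blast
  qed
  \<comment> \<open>Restriction from \<open>N\<close> to \<open>W'\<close> is injective, so choosing
    an extension for each section yields a ring homomorphism.\<close>
  define h where "h s = (SOME t. t \<in> carrier (sect X N) \<and> restr X N W' t = e s)" for s
  have h: "h s \<in> carrier (sect X N)" "restr X N W' (h s) = e s" if "s \<in> carrier (sect Y C)" for s
    using someI_ex[of "\<lambda>t. t \<in> carrier (sect X N) \<and> restr X N W' t = e s"] ext[OF that]
    unfolding h_def by blast+
  have huniq: "h s = t" if "s \<in> carrier (sect Y C)" "t \<in> carrier (sect X N)" "restr X N W' t = e s" for s t
    by (rule f.X.restr_inj[OF oN(1) h(1)[OF that(1)] that(2) oW'(1,2,3)]) (simp add: h that)
  have hhom: "h \<in> ring_hom (sect Y C) (sect X N)"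
    by (rule ring_hom_memI) (auto intro!: huniq simp: h)
  interpret h: ring_hom_ring "sect Y C" "sect X N" h
    by (rule ring_hom_ringI2[OF C.ring_axioms N.ring_axioms hhom])
  have "primeideal {s \<in> carrier (sect Y C). h s \<in> {t \<in> carrier (sect X N). \<not> nv X x N t}} (sect Y C)"
    by (rule h.primeideal_vimage[OF C.is_cring f.X.vanishing_primeideal[OF oN]])
  from f.Y.affine_point_of_prime[OF C(1) this] obtain z where z: "z \<in> C"
    "\<And>s. s \<in> carrier (sect Y C) \<Longrightarrow> nv Y z C s \<longleftrightarrow> nv X x N (h s)" using h by auto
  have zA: "z \<in> A" "z \<in> B" using z C by auto
  have "z = fst f x"
  proof (rule A.nv_separates[OF zA(1) A(2)])
    fix s assume s: "s \<in> carrier (sect Y A)"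
    have "nv Y z A s \<longleftrightarrow> nv Y z C (restr Y A C s)" using f.Y.nv_restr[OF A.A C(2,3) z(1) s] by simp
    also have "\<dots> \<longleftrightarrow> nv X x N (h (restr Y A C s))" using z(2) s A.A C by simp
    also have "h (restr Y A C s) = restr X (pb U f A) N (snd f A s)"
      using huniq eA[OF s] clA[OF s] s A.A C by simp
    also have "nv X x N \<dots> \<longleftrightarrow> nv X x (pb U f A) (snd f A s)"
      using f.X.nv_restr[OF oA oN(1) NA(1) oN(2)] f.closed[OF A.A s] by simp
    also have "\<dots> \<longleftrightarrow> nv Y (fst f x) A s" using f.nv_pb[OF x(1) A(2) A.A s] .
    finally show "nv Y z A s \<longleftrightarrow> nv Y (fst f x) A s" .
  qed
  moreover have "z = fst g x"
  proof (rule B.nv_separates[OF zA(2) B(2)])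
    fix s assume s: "s \<in> carrier (sect Y B)"
    have "nv Y z B s \<longleftrightarrow> nv Y z C (restr Y B C s)" using f.Y.nv_restr[OF B.A C(2,4) z(1) s] by simp
    also have "\<dots> \<longleftrightarrow> nv X x N (h (restr Y B C s))" using z(2) s B.A C by simp
    also have "h (restr Y B C s) = restr X (pb V g B) N (snd g B s)"
      using huniq eB[OF s] clB[OF s] s B.A C by simp
    also have "nv X x N \<dots> \<longleftrightarrow> nv X x (pb V g B) (snd g B s)"
      using f.X.nv_restr[OF oB' oN(1) NA(2) oN(2)] g.closed[OF B.A s] by simp
    also have "\<dots> \<longleftrightarrow> nv Y (fst g x) B s" using g.nv_pb[OF x(2) B(2) B.A s] .
    finally show "nv Y z B s \<longleftrightarrow> nv Y (fst g x) B s" .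
  qed
  ultimately show ?thesis by simp
qed

section \<open>Restriction, composition and open immersions\<close>

lemma pb_cong: "fst f = fst g \<Longrightarrow> pb U f = pb U g" by (simp add: pb_def fun_eq_iff)

lemma pb_Int: "W \<subseteq> U \<Longrightarrow> pb U f T \<inter> W = pb W f T" by (auto simp: pb_def)

lemma fst_mor_restrict [simp]: "fst (mor_restrict X f W) = fst f" by (simp add: mor_restrict_def)

lemma pb_mor_restrict [simp]: "pb U (mor_restrict X f W) = pb U f" by (rule pb_cong) simp

lemma (in kmor) snd_restrict:
  "W \<subseteq> U \<Longrightarrow> snd (mor_restrict (open_subscheme X U) f W) T s = restr X (pb U f T) (pb W f T) (snd f T s)"
  by (simp add: mor_restrict_def preim_open_subscheme[OF U] pb_Int)

lemma (in kmor) kmor_restrict: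
  assumes W: "opn X W" "W \<subseteq> U"
  shows "kmor k X Y W (mor_restrict (open_subscheme X U) f W)"
proof (rule kmorI[OF X.var_axioms Y.var_axioms W(1)])
  note o = pb_sub_open[OF W] and i = pb_sub_mono[OF W(2), of f]
  show "fst (mor_restrict (open_subscheme X U) f W) x \<in> points Y" if "x \<in> W" for x
    using point W that by auto
  show "opn X (pb W (mor_restrict (open_subscheme X U) f W) V)" if "opn Y V" for V using o[OF that] by simp
  show "snd (mor_restrict (open_subscheme X U) f W) V \<in>
      ring_hom (sect Y V) (sect X (pb W (mor_restrict (open_subscheme X U) f W) V))" if "opn Y V" for V
    using ring_hom_trans[OF hom[OF that] X.restr_hom[OF pb_open[OF that] o[OF that] i]]
    by (simp add: comp_def snd_restrict[OF W(2), abs_def])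
  show "snd (mor_restrict (open_subscheme X U) f W) T (restr Y V T s) =
      restr X (pb W (mor_restrict (open_subscheme X U) f W) V) (pb W (mor_restrict (open_subscheme X U) f W) T)
        (snd (mor_restrict (open_subscheme X U) f W) V s)"
    if "opn Y V" "opn Y T" "T \<subseteq> V" "s \<in> carrier (sect Y V)" for V T s
    using that o pb_open i[of V] i[of T] closed[OF that(1,4)] pb_mono[OF that(3), of W f] pb_mono[OF that(3), of U f]
    by (simp add: snd_restrict[OF W(2)] compat)
  show "snd (mor_restrict (open_subscheme X U) f W) (points Y) (struc Y a) = restr X (points X) W (struc X a)"
    if "a \<in> carrier k" for a
  proof -
    have "pb W f (points Y) = W" using pb_Int[OF W(2), of f "points Y"] pb_points W by auto
    then show ?thesis
      using that W U X.struc_closed openin_subset[OF U]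
      by (simp add: snd_restrict[OF W(2)] pb_points struc)
  qed
  show "nv Y (fst (mor_restrict (open_subscheme X U) f W) x) V s"
    if "x \<in> W" "fst (mor_restrict (open_subscheme X U) f W) x \<in> V" "opn Y V" "s \<in> carrier (sect Y V)"
      "nv X x (pb W (mor_restrict (open_subscheme X U) f W) V) (snd (mor_restrict (open_subscheme X U) f W) V s)"
    for x V s
    using that X.nv_restr[OF pb_open[OF that(3)] o[OF that(3)] i, of x "snd f V s"] closed[OF that(3,4)] nv_pb[of x V s] W
    by (auto simp: snd_restrict[OF W(2)] pb_def)
qed

lemma (in kmor) agree_restrict:
  assumes W: "opn X W" "W \<subseteq> U"
  shows "agree X Y U f W (mor_restrict (open_subscheme X U) f W) W"
  unfolding agree_def
proof (intro conjI ballI allI impI)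
  fix T s assume T: "opn Y T" "s \<in> carrier (sect Y T)"
  show "restr X (pb U f T) (pb W f T) (snd f T s) =
     restr X (pb W (mor_restrict (open_subscheme X U) f W) T) (pb W f T) (snd (mor_restrict (open_subscheme X U) f W) T s)"
    using T W closed pb_open pb_sub_open[OF W T(1)] pb_sub_mono[OF W(2), of f T] by (simp add: snd_restrict)
qed (use W in auto)

text \<open>The representative that \<open>rat_comp\<close> forms from \<open>(U, f)\<close> and
  \<open>(V, g)\<close>; its domain is \<open>pb U f V\<close>.\<close>

definition rcomp where
  "rcomp X Y U f V g = mor_comp (open_subscheme Y V) g (mor_restrict (open_subscheme X U) f (pb U f V))"

lemma fst_rcomp [simp]: "fst (rcomp X Y U f V g) x = fst g (fst f x)"
  by (simp add: rcomp_def mor_comp_def)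

lemma pb_rcomp: "pb (pb U f V) (rcomp X Y U f V g) T = pb U f (pb V g T)"
  by (auto simp: pb_def)

lemma snd_rcomp:
  assumes f: "kmor k X Y U f" and g: "kmor k Y Z V g" and T: "opn Z T" "s \<in> carrier (sect Z T)"
  shows "snd (rcomp X Y U f V g) T s = snd f (pb V g T) (snd g T s)"
proof -
  interpret f: kmor k X Y U f by fact
  interpret g: kmor k Y Z V g by fact
  have "pb (pb U f V) f (pb V g T) = pb U f (pb V g T)" by (auto simp: pb_def)
  then show ?thesis
    using T f.closed g.closed g.pb_open f.pb_open
    by (simp add: rcomp_def mor_comp_def preim_open_subscheme[OF g.U] f.snd_restrict[OF pb_subset])
qed

lemma kmor_rcomp:
  assumes f: "kmor k X Y U f" and g: "kmor k Y Z V g"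
  shows "kmor k X Z (pb U f V) (rcomp X Y U f V g)"
proof -
  interpret f: kmor k X Y U f by fact
  interpret g: kmor k Y Z V g by fact
  note snd = snd_rcomp[OF f g]
  note cl = f.closed[OF g.pb_open g.closed]
  show ?thesis
  proof (rule kmorI[OF f.X.var_axioms g.Y.var_axioms f.pb_open[OF g.U]])
    show "fst (rcomp X Y U f V g) x \<in> points Z" if "x \<in> pb U f V" for x
      using that g.point by (simp add: pb_def)
    show "opn X (pb (pb U f V) (rcomp X Y U f V g) T)" if "opn Z T" for T
      unfolding pb_rcomp using that f.pb_open g.pb_open by simp
    show "snd (rcomp X Y U f V g) T \<in> ring_hom (sect Z T) (sect X (pb (pb U f V) (rcomp X Y U f V g) T))"
      if T: "opn Z T" for T
    proof -
      have h: "snd f (pb V g T) \<circ> snd g T \<in> ring_hom (sect Z T) (sect X (pb U f (pb V g T)))"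
        by (rule ring_hom_trans[OF g.hom[OF T] f.hom[OF g.pb_open[OF T]]])
      interpret Z: cring "sect Z T" using g.Y.sect_cring[OF T] .
      show ?thesis unfolding pb_rcomp
        by (rule ring_hom_memI)
          (use ring_hom_closed[OF h] ring_hom_mult[OF h] ring_hom_add[OF h] ring_hom_one[OF h] in \<open>simp_all add: snd[OF T]\<close>)
    qed
    show "snd (rcomp X Y U f V g) T' (restr Z T T' s) =
        restr X (pb (pb U f V) (rcomp X Y U f V g) T) (pb (pb U f V) (rcomp X Y U f V g) T') (snd (rcomp X Y U f V g) T s)"
      if "opn Z T" "opn Z T'" "T' \<subseteq> T" "s \<in> carrier (sect Z T)" for T T' s
      using that g.closed g.pb_open pb_mono[OF that(3), of V g] unfolding pb_rcomp
      by (simp add: snd g.compat f.compat)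
    show "snd (rcomp X Y U f V g) (points Z) (struc Z a) = restr X (points X) (pb U f V) (struc X a)"
      if a: "a \<in> carrier k" for a
    proof -
      have YY: "V \<subseteq> points Y" "U \<subseteq> points X" using openin_subset[OF g.U] openin_subset[OF f.U] by auto
      show ?thesis
        using a f.compat[of "points Y" V "struc Y a"] g.U f.U YY f.X.struc_closed f.Y.struc_closed f.pb_open[OF g.U]
          g.Y.struc_closed pb_subset[of U f V]
        by (simp add: snd g.pb_points g.struc f.struc f.pb_points)
    qed
    show "nv Z (fst (rcomp X Y U f V g) x) T s"
      if "x \<in> pb U f V" "fst (rcomp X Y U f V g) x \<in> T" "opn Z T" "s \<in> carrier (sect Z T)"
        "nv X x (pb (pb U f V) (rcomp X Y U f V g) T) (snd (rcomp X Y U f V g) T s)" for x T s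
      using that f.nv_pb[of x "pb V g T" "snd g T s"] g.pb_open[OF that(3)] g.closed[OF that(3,4)] g.nv_pb[of "fst f x" T s]
      unfolding pb_rcomp by (simp add: snd pb_def)
  qed
qed

text \<open>A section is pulled back along \<open>g\<close> and \<open>g'\<close> to sections that
  agree on \<open>Q\<close>. Both sides are then pullbacks of the common section \<open>r\<close>
  over \<open>Q\<close>, once along \<open>f\<close> and once along \<open>f'\<close>.\<close>

lemma agree_rcomp:
  assumes f: "kmor k X Y U f" and f': "kmor k X Y U' f'" and g: "kmor k Y Z V g" and g': "kmor k Y Z V' g'"
    and A: "agree X Y U f U' f' W" and B: "agree Y Z V g V' g' S"
  shows "agree X Z (pb U f V) (rcomp X Y U f V g) (pb U' f' V') (rcomp X Y U' f' V' g') (pb W f S)"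
proof -
  interpret f: kmor k X Y U f by fact
  interpret f': kmor k X Y U' f' by fact
  interpret g: kmor k Y Z V g by fact
  interpret g': kmor k Y Z V' g' by fact
  note A' = agreeD[OF A] and B' = agreeD[OF B]
  show ?thesis unfolding agree_def
  proof (intro conjI ballI allI impI)
    show "opn X (pb W f S)" by (rule f.pb_sub_open[OF A'(1,2) B'(1)])
    show "pb W f S \<subseteq> pb U f V \<inter> pb U' f' V'" using A'(2-4) B'(2,3) by (auto simp: pb_def)
    show "fst (rcomp X Y U f V g) x = fst (rcomp X Y U' f' V' g') x" if "x \<in> pb W f S" for x
      using that A'(4) B'(4) by (auto simp: pb_def)
    fix T s assume T: "opn Z T" and s: "s \<in> carrier (sect Z T)"
    define Q where "Q = pb S g T"
    have oQ: "opn Y Q" unfolding Q_def by (rule g.pb_sub_open[OF B'(1,2) T])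
    have Q: "Q \<subseteq> pb V g T" "Q \<subseteq> pb V' g' T"
      using pb_sub_mono[OF B'(2), of g T] pb_sub_mono[OF B'(3), of g' T] B'(5)[of T] by (simp_all add: Q_def)
    have eqS: "pb (pb W f S) (rcomp X Y U f V g) T = pb W f Q" by (auto simp: pb_def Q_def)
    have oS: "opn X (pb W f Q)" by (rule f.pb_sub_open[OF A'(1,2) oQ])
    have iS: "pb W f Q \<subseteq> pb U f Q" "pb W f Q \<subseteq> pb U' f' Q"
      using pb_sub_mono[OF A'(2), of f Q] pb_sub_mono[OF A'(3), of f' Q] A'(5)[of Q] by simp_all
    define r where "r = restr Y (pb V g T) Q (snd g T s)"
    have r: "r \<in> carrier (sect Y Q)"
      using g.closed[OF T s] g.pb_open[OF T] oQ Q by (simp add: r_def)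
    have r': "r = restr Y (pb V' g' T) Q (snd g' T s)"
      using B'(6)[OF T s, folded Q_def] by (simp add: r_def)
    have "restr X (pb U f (pb V g T)) (pb W f Q) (snd f (pb V g T) (snd g T s))
        = restr X (pb U f Q) (pb W f Q) (snd f Q r)"
      using f.compat[OF g.pb_open[OF T] oQ Q(1) g.closed[OF T s]] f.pb_open[OF g.pb_open[OF T]] f.pb_open[OF oQ]
        f.closed[OF g.pb_open[OF T] g.closed[OF T s]] oS iS pb_mono[OF Q(1), of U f] by (simp add: r_def)
    also have "\<dots> = restr X (pb U' f' Q) (pb W f Q) (snd f' Q r)" by (rule A'(6)[OF oQ r])
    also have "\<dots> = restr X (pb U' f' (pb V' g' T)) (pb W f Q) (snd f' (pb V' g' T) (snd g' T s))"
      using f'.compat[OF g'.pb_open[OF T] oQ Q(2) g'.closed[OF T s]] f'.pb_open[OF g'.pb_open[OF T]] f'.pb_open[OF oQ]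
        f'.closed[OF g'.pb_open[OF T] g'.closed[OF T s]] oS iS pb_mono[OF Q(2), of U' f'] by (simp add: r')
    finally show "restr X (pb (pb U f V) (rcomp X Y U f V g) T) (pb (pb W f S) (rcomp X Y U f V g) T)
         (snd (rcomp X Y U f V g) T s) =
        restr X (pb (pb U' f' V') (rcomp X Y U' f' V' g') T) (pb (pb W f S) (rcomp X Y U f V g) T)
         (snd (rcomp X Y U' f' V' g') T s)"
      unfolding eqS pb_rcomp snd_rcomp[OF f g T s] snd_rcomp[OF f' g' T s] .
  qed
qed

lemma agree_trans:
  assumes f: "kmor k X Y U f" and g: "kmor k X Y V g" and h: "kmor k X Y T h"
    and A: "agree X Y U f V g W" and B: "agree X Y V g T h S"
  shows "agree X Y U f T h (W \<inter> S)"
proof -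
  interpret f: kmor k X Y U f by fact
  have o: "opn X (W \<inter> S)" using agreeD(1)[OF A] agreeD(1)[OF B] by blast
  note A' = agreeD[OF agree_mono[OF f g A o]] and B' = agreeD[OF agree_mono[OF g h B o]]
  show ?thesis unfolding agree_def
    using o A'(2,4,5,6) B'(3,4,6) by auto
qed

lemma pb_id [simp]: "pb A mor_id T = A \<inter> T"
  by (auto simp: pb_def mor_id_def)

lemma (in var) pb_points_id: "opn X T \<Longrightarrow> points X \<inter> T = T"
  using openin_subset by blast

lemma (in var) kmor_id: "kmor k X X (points X) mor_id"
proof (rule kmorI[OF var_axioms var_axioms])
  show "opn X (pb (points X) mor_id V)" if "opn X V" for V :: "'x set" using that by (simp add: pb_points_id)
  show "snd mor_id V \<in> ring_hom (sect X V) (sect X (pb (points X) mor_id V))" if "opn X V" for V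
    using that unfolding pb_id by (simp add: pb_points_id mor_id_def ring_hom_def)
  show "nv X (fst mor_id x) V s" if "x \<in> points X" "fst mor_id x \<in> V" "opn X V" "s \<in> carrier (sect X V)"
    "nv X x (pb (points X) mor_id V) (snd mor_id V s)" for x V s
    using that(5) unfolding pb_id pb_points_id[OF that(3)] by (simp add: mor_id_def)
  show "snd mor_id W (restr X V W s) = restr X (pb (points X) mor_id V) (pb (points X) mor_id W) (snd mor_id V s)"
    if "opn X V" "opn X W" for V W s
    unfolding pb_id pb_points_id[OF that(1)] pb_points_id[OF that(2)] by (simp add: mor_id_def)
  show "snd mor_id (points X) (struc X a) = restr X (points X) (points X) (struc X a)" if "a \<in> carrier k" for a
    using struc_closed[OF that] by (simp add: mor_id_def)
qed (simp_all add: mor_id_def)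

subsection \<open>Open immersions\<close>

text \<open>Open immersions without reference to an inverse, a form that passes easily to
  restrictions and composites. On sections a bijection suffices, since a bijective ring homomorphism
  has a homomorphism as inverse.\<close>

definition oi ::
    "('x, 'r, 'k) k_space \<Rightarrow> ('y, 's, 'k) k_space \<Rightarrow> 'x set \<Rightarrow> ('x, 'r, 'y, 's) mor \<Rightarrow> bool" where
  "oi X Y U f \<longleftrightarrow> inj_on (fst f) U \<and> (\<forall>W. opn X W \<longrightarrow> W \<subseteq> U \<longrightarrow> opn Y (fst f ` W)) \<and>
     (\<forall>T. opn Y T \<longrightarrow> T \<subseteq> fst f ` U \<longrightarrow> bij_betw (snd f T) (carrier (sect Y T)) (carrier (sect X (pb U f T))))"

locale oimm = kmor +
  assumes oi: "oi X Y U f"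
begin

abbreviation "V \<equiv> fst f ` U"

lemma inj: "inj_on (fst f) U" using oi by (simp add: oi_def)

lemma open_image: "opn X W \<Longrightarrow> W \<subseteq> U \<Longrightarrow> opn Y (fst f ` W)" using oi by (simp add: oi_def)

lemma V_open: "opn Y V" using open_image[OF U] by simp

lemma pb_image: "W \<subseteq> U \<Longrightarrow> pb U f (fst f ` W) = W"
  unfolding pb_def using inj by (auto simp: inj_on_def)

lemma image_pb: "fst f ` pb U f T = T \<inter> V"
  unfolding pb_def by auto

lemma bij: "opn Y T \<Longrightarrow> T \<subseteq> V \<Longrightarrow> bij_betw (snd f T) (carrier (sect Y T)) (carrier (sect X (pb U f T)))"
  using oi by (simp add: oi_def)

lemma bij_image: "opn X W \<Longrightarrow> W \<subseteq> U \<Longrightarrow>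
    bij_betw (snd f (fst f ` W)) (carrier (sect Y (fst f ` W))) (carrier (sect X W))"
  using bij[OF open_image, of W] pb_image[of W] by (simp add: image_mono)

text \<open>Inverse of the comorphism, indexed by the open set in the source.\<close>

definition e where "e W = inv_into (carrier (sect Y (fst f ` W))) (snd f (fst f ` W))"

lemma e_iso: assumes "opn X W" "W \<subseteq> U" shows "e W \<in> ring_iso (sect X W) (sect Y (fst f ` W))"
proof -
  have "ring (sect Y (fst f ` W))" using Y.sect_cring[OF open_image[OF assms]] by (simp add: cring_def)
  moreover have "snd f (fst f ` W) \<in> ring_iso (sect Y (fst f ` W)) (sect X W)"
    using hom[OF open_image[OF assms]] bij_image[OF assms] pb_image[OF assms(2)] by (simp add: ring_iso_def)
  ultimately show ?thesis unfolding e_def by (rule ring_iso_set_sym)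
qed

lemma e_hom: "opn X W \<Longrightarrow> W \<subseteq> U \<Longrightarrow> e W \<in> ring_hom (sect X W) (sect Y (fst f ` W))"
  using e_iso unfolding ring_iso_def by blast

lemma e_closed: "opn X W \<Longrightarrow> W \<subseteq> U \<Longrightarrow> t \<in> carrier (sect X W) \<Longrightarrow> e W t \<in> carrier (sect Y (fst f ` W))"
  by (rule ring_hom_closed[OF e_hom])

lemma f_e: "opn X W \<Longrightarrow> W \<subseteq> U \<Longrightarrow> t \<in> carrier (sect X W) \<Longrightarrow> snd f (fst f ` W) (e W t) = t"
  unfolding e_def using bij_betw_inv_into_right[OF bij_image] by blast

lemma e_f: "opn X W \<Longrightarrow> W \<subseteq> U \<Longrightarrow> s \<in> carrier (sect Y (fst f ` W)) \<Longrightarrow> e W (snd f (fst f ` W) s) = s"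
  unfolding e_def using bij_betw_inv_into_left[OF bij_image] by blast

lemma e_compat:
  assumes W: "opn X W" "W \<subseteq> U" "opn X W'" "W' \<subseteq> W" and t: "t \<in> carrier (sect X W)"
  shows "e W' (restr X W W' t) = restr Y (fst f ` W) (fst f ` W') (e W t)"
proof -
  have W'U: "W' \<subseteq> U" using W by auto
  note oW = open_image[OF W(1,2)] and oW' = open_image[OF W(3) W'U]
  have s: "restr Y (fst f ` W) (fst f ` W') (e W t) \<in> carrier (sect Y (fst f ` W'))"
    using e_closed[OF W(1,2) t] oW oW' image_mono[OF W(4), of "fst f"] by simp
  have "restr X W W' t = snd f (fst f ` W') (restr Y (fst f ` W) (fst f ` W') (e W t))"
    using compat[OF oW oW' image_mono[OF W(4)] e_closed[OF W(1,2) t]] f_e[OF W(1,2) t] pb_image[OF W(2)] pb_image[OF W'U]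
    by simp
  then show ?thesis using e_f[OF W(3) W'U s] by simp
qed

text \<open>The inverse morphism, defined on the image of \<open>U\<close>. Its comorphism first
  restricts to \<open>W \<inter> U\<close>, since the preimage of \<open>W\<close> under it is the
  image of \<open>W \<inter> U\<close>.\<close>

definition finv where "finv = (inv_into U (fst f), \<lambda>W t. e (W \<inter> U) (restr X W (W \<inter> U) t))"

lemma fst_finv: "x \<in> U \<Longrightarrow> fst finv (fst f x) = x"
  unfolding finv_def using inj by simp

lemma pb_finv: "pb V finv W = fst f ` (W \<inter> U)"
  unfolding pb_def using fst_finv by auto

lemma snd_finv: "snd finv W t = e (W \<inter> U) (restr X W (W \<inter> U) t)" by (simp add: finv_def)

lemma finv_image: "fst finv ` V = U" using fst_finv by (force simp: image_iff)

lemma nv_e: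
  assumes "x \<in> W" "opn X W" "W \<subseteq> U" "t \<in> carrier (sect X W)"
  shows "nv Y (fst f x) (fst f ` W) (e W t) \<longleftrightarrow> nv X x W t"
  using nv_pb[of x "fst f ` W" "e W t"] open_image[OF assms(2,3)] e_closed[OF assms(2-4)] f_e[OF assms(2-4)]
    pb_image[OF assms(3)] assms by auto

lemma kmor_finv: "kmor k Y X V finv"
proof (rule kmorI[OF Y.var_axioms X.var_axioms V_open])
  show "fst finv y \<in> points X" if "y \<in> V" for y using that fst_finv openin_subset[OF U] by auto
  have o: "opn X (W \<inter> U)" if "opn X W" for W using that U by blast
  show "opn Y (pb V finv W)" if "opn X W" for W unfolding pb_finv using open_image[OF o[OF that]] by simp
  show "snd finv W \<in> ring_hom (sect X W) (sect Y (pb V finv W))" if "opn X W" for W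
    using ring_hom_trans[OF X.restr_hom[OF that o[OF that]] e_hom[OF o[OF that]]]
    by (simp add: finv_def comp_def pb_finv[unfolded finv_def])
  show "snd finv W' (restr X W W' s) = restr Y (pb V finv W) (pb V finv W') (snd finv W s)"
    if "opn X W" "opn X W'" "W' \<subseteq> W" "s \<in> carrier (sect X W)" for W W' s
    using that o e_compat[OF o[OF that(1)] _ o[OF that(2)], of "restr X W (W \<inter> U) s"]
    by (simp add: snd_finv pb_finv le_infI1)
  show "snd finv (points X) (struc X a) = restr Y (points Y) V (struc Y a)" if a: "a \<in> carrier k" for a
  proof -
    have UX: "points X \<inter> U = U" using openin_subset[OF U] by auto
    have V: "V \<subseteq> points Y" using openin_subset[OF V_open] .
    have "restr X (points X) U (struc X a) = snd f V (restr Y (points Y) V (struc Y a))"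
      using struc[OF a] compat[of "points Y" V "struc Y a"] V_open V Y.struc_closed[OF a] pb_image[of U]
        pb_points X.struc_closed[OF a] U openin_subset[OF U] by simp
    then show ?thesis
      unfolding snd_finv UX using e_f[OF U subset_refl, of "restr Y (points Y) V (struc Y a)"] V V_open Y.struc_closed[OF a]
      by simp
  qed
  show "nv X (fst finv y) W s" if "y \<in> V" "fst finv y \<in> W" "opn X W" "s \<in> carrier (sect X W)"
    "nv Y y (pb V finv W) (snd finv W s)" for y W s
  proof -
    from that(1) obtain x where x: "x \<in> U" "y = fst f x" by blast
    then have xW: "x \<in> W \<inter> U" using that(2) fst_finv by simp
    have "nv Y (fst f x) (fst f ` (W \<inter> U)) (e (W \<inter> U) (restr X W (W \<inter> U) s))"
      using that(5) x unfolding pb_finv snd_finv by simp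
    then have "nv X x (W \<inter> U) (restr X W (W \<inter> U) s)"
      using nv_e[OF xW o[OF that(3)]] that o[OF that(3)] by simp
    then show ?thesis using X.nv_restr[OF that(3) o[OF that(3)] _ xW that(4)] x fst_finv by simp
  qed
qed

lemma oi_finv: "oi Y X V finv"
  unfolding oi_def
proof (intro conjI allI impI)
  show "inj_on (fst finv) V" using fst_finv by (auto simp: inj_on_def)
  show "opn X (fst finv ` W)" if "opn Y W" "W \<subseteq> V" for W
  proof -
    have "fst finv ` W = pb U f W" using that fst_finv by (force simp: pb_def image_iff)
    then show ?thesis using pb_open[OF that(1)] by simp
  qed
  show "bij_betw (snd finv T) (carrier (sect X T)) (carrier (sect Y (pb V finv T)))"
    if T: "opn X T" "T \<subseteq> fst finv ` V" for T
  proof -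
    have TU: "T \<inter> U = T" "T \<subseteq> U" using T finv_image by auto
    have "bij_betw (e T) (carrier (sect X T)) (carrier (sect Y (fst f ` T)))"
      using e_iso[OF T(1) TU(2)] by (simp add: ring_iso_def)
    then show ?thesis
      unfolding pb_finv TU by (rule bij_betw_cong[THEN iffD1, rotated]) (use T TU in \<open>simp add: snd_finv\<close>)
  qed
qed

text \<open>The identity law is stated as agreement on \<open>U\<close>, which is what classes of
  rational maps compare.\<close>

lemma agree_finv_f: "agree X X U (rcomp X Y U f V finv) (points X) mor_id U"
  unfolding agree_def
proof (intro conjI ballI allI impI)
  show "fst (rcomp X Y U f V finv) x = fst mor_id x" if "x \<in> U" for x
    using that by (simp add: fst_finv mor_id_def)
  fix T s assume T: "opn X T" and s: "s \<in> carrier (sect X T)"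
  have o: "opn X (T \<inter> U)" using T U by blast
  have pbU: "pb U (rcomp X Y U f V finv) T = T \<inter> U" using fst_finv by (auto simp: pb_def)
  have "snd (rcomp X Y U f V finv) T s = restr X T (T \<inter> U) s"
    unfolding snd_rcomp[OF kmor_axioms kmor_finv T s] snd_finv pb_finv using f_e[OF o] T s o by simp
  then show "restr X (pb U (rcomp X Y U f V finv) T) (pb U (rcomp X Y U f V finv) T) (snd (rcomp X Y U f V finv) T s) =
      restr X (pb (points X) mor_id T) (pb U (rcomp X Y U f V finv) T) (snd mor_id T s)"
    unfolding pbU pb_id X.pb_points_id[OF T] using T s o by (simp add: mor_id_def)
qed (use U openin_subset[OF U] in auto)

lemma agree_f_finv: "agree Y Y V (rcomp Y X V finv U f) (points Y) mor_id V"
  unfolding agree_def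
proof (intro conjI ballI allI impI)
  show "fst (rcomp Y X V finv U f) y = fst mor_id y" if "y \<in> V" for y
    using that by (auto simp: fst_finv mor_id_def)
  fix T s assume T: "opn Y T" and s: "s \<in> carrier (sect Y T)"
  have o: "opn Y (T \<inter> V)" using T V_open by blast
  have pbV: "pb V (rcomp Y X V finv U f) T = T \<inter> V" using fst_finv by (auto simp: pb_def)
  have pbTV: "pb U f (T \<inter> V) = pb U f T" by (auto simp: pb_def)
  have "snd f T s = snd f (T \<inter> V) (restr Y T (T \<inter> V) s)"
    using compat[OF T o _ s] pbTV closed[OF T s] pb_open[OF T] by simp
  moreover have "pb U f T \<inter> U = pb U f T" by (auto simp: pb_def)
  ultimately have "snd (rcomp Y X V finv U f) T s = e (pb U f T) (snd f (T \<inter> V) (restr Y T (T \<inter> V) s))"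
    unfolding snd_rcomp[OF kmor_finv kmor_axioms T s] snd_finv using closed[OF T s] pb_open[OF T] by simp
  then have "snd (rcomp Y X V finv U f) T s = restr Y T (T \<inter> V) s"
    using e_f[OF pb_open[OF T] pb_subset, unfolded image_pb] T s o by simp
  then show "restr Y (pb V (rcomp Y X V finv U f) T) (pb V (rcomp Y X V finv U f) T) (snd (rcomp Y X V finv U f) T s) =
      restr Y (pb (points Y) mor_id T) (pb V (rcomp Y X V finv U f) T) (snd mor_id T s)"
    unfolding pbV pb_id Y.pb_points_id[OF T] using T s o by (simp add: mor_id_def)
qed (use V_open openin_subset[OF V_open] in auto)

end

text \<open>With the given inverse \<open>g\<close>, the image of an open set is its preimage under
  \<open>g\<close>, hence open, and \<open>snd g\<close> inverts the comorphisms.\<close>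

lemma open_immersionD:
  assumes "kmor k X Y U f" and "open_immersion k (open_subscheme X U) Y f"
  shows "oi X Y U f"
proof -
  interpret kmor k X Y U f by fact
  obtain V g where V: "opn Y V" and fg: "rs_inv (open_subscheme X U) (open_subscheme Y V) f g"
    using assms(2) unfolding open_immersion_def lrs_iso_def rs_inv_def lrs_morphism_def by auto
  note pX = X.points_open[OF U] and pY = Y.points_open[OF V]
  note gf = rs_invD(3)[OF fg, unfolded pX] and fg' = rs_invD(4)[OF fg, unfolded pY]
  have fV: "fst f x \<in> V" if "x \<in> U" for x using rs_point[OF rs_invD(1)[OF fg], of x] pX pY that by blast
  have gU: "fst g y \<in> U" if "y \<in> V" for y using rs_point[OF rs_invD(2)[OF fg], of y] pX pY that by blast
  have img: "fst f ` U = V" using fV gU fg' by (force simp: image_iff)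
  have pre: "preim (open_subscheme Y V) g W = fst f ` W" if "W \<subseteq> U" for W
    unfolding preim_open_subscheme[OF V] pb_def using that fV gU fg' gf by (force simp: image_iff)
  show ?thesis unfolding oi_def
  proof (intro conjI allI impI)
    show "inj_on (fst f) U" using gf by (metis inj_onI)
    show "opn Y (fst f ` W)" if "opn X W" "W \<subseteq> U" for W
      using rs_preim_open[OF rs_invD(2)[OF fg], of W] X.opn_open[OF U] Y.opn_open[OF V] pre that by auto
    fix T assume T: "opn Y T" "T \<subseteq> fst f ` U"
    have oT: "opn (open_subscheme Y V) T" using T Y.opn_open[OF V] img by simp
    have oP: "opn (open_subscheme X U) (pb U f T)" using pb_open[OF T(1)] X.opn_open[OF U] pb_subset by metis
    have bk: "preim (open_subscheme Y V) g (pb U f T) = T"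
      using rs_inv_preim[OF fg oT] preim_open_subscheme[OF U] by metis
    show "bij_betw (snd f T) (carrier (sect Y T)) (carrier (sect X (pb U f T)))"
      unfolding bij_betw_def
    proof (intro conjI subset_antisym)
      show "inj_on (snd f T) (carrier (sect Y T))"
        by (rule inj_onI) (rule rs_inv_inj[OF fg oT], simp_all)
      show "snd f T ` carrier (sect Y T) \<subseteq> carrier (sect X (pb U f T))" using closed[OF T(1)] by blast
      show "carrier (sect X (pb U f T)) \<subseteq> snd f T ` carrier (sect Y T)"
      proof
        fix t assume t: "t \<in> carrier (sect X (pb U f T))"
        then have "snd f T (snd g (pb U f T) t) = t" using rs_invD(6)[OF fg oP] bk by simp
        moreover have "snd g (pb U f T) t \<in> carrier (sect Y T)"
          using rs_closed[OF rs_invD(2)[OF fg] oP] t bk by simp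
        ultimately show "t \<in> snd f T ` carrier (sect Y T)" by force
      qed
    qed
  qed
qed

text \<open>Locality is inherited because nonvanishing at a point of \<open>V\<close> means the same
  in \<open>Y\<close> and in its open subscheme.\<close>

lemma (in kmor) lrs_morphism_into_open:
  assumes V: "opn Y V" "fst f ` U \<subseteq> V"
  shows "lrs_morphism (open_subscheme X U) (open_subscheme Y V) f"
proof -
  have "rs_morphism (open_subscheme X U) (open_subscheme Y V) f"
    unfolding rs_morphism_def
  proof (intro conjI allI impI ballI)
    show "continuous_map (topo (open_subscheme X U)) (topo (open_subscheme Y V)) (fst f)"
      using rs_morphismD(1)[OF rs_mor] V(2) X.points_open[OF U]
      by (simp add: continuous_map_in_subtopology image_subset_iff_funcset)
  qed (use Y.opn_open[OF V(1)] hom compat in \<open>auto simp: preim_open_subscheme[OF U]\<close>)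
  moreover have "nv (open_subscheme Y V) (fst f x) T s"
    if "x \<in> points (open_subscheme X U)" "opn (open_subscheme Y V) T \<and> fst f x \<in> T"
      "s \<in> carrier (sect (open_subscheme Y V) T)"
      "nv (open_subscheme X U) x (preim (open_subscheme X U) f T) (snd f T s)" for x T s
  proof -
    have T: "opn Y T" "T \<subseteq> V" using that(2) Y.opn_open[OF V(1)] by blast+
    have x: "x \<in> U" using that(1) X.points_open[OF U] by blast
    have "nv X x (pb U f T) (snd f T s)"
      using that(4) by (simp add: preim_open_subscheme[OF U] X.nv_open[OF U pb_subset])
    then show ?thesis using nv_pb[OF x _ T(1)] that Y.nv_open[OF V(1) T(2)] by simp
  qed
  ultimately show ?thesis
    using lrs_morphism_iff[OF X.presheaf_open[OF U] Y.presheaf_open[OF V(1)]] by blast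
qed

text \<open>The converse of \<open>open_immersionD\<close>, with \<open>finv\<close> as the inverse
  morphism.\<close>

lemma (in oimm) open_immersion: "open_immersion k (open_subscheme X U) Y f"
  unfolding open_immersion_def lrs_iso_def
proof (intro conjI exI)
  show "k_morphism k (open_subscheme X U) Y f" by (rule mor)
  show "opn Y V" by (rule V_open)
  show "lrs_morphism (open_subscheme X U) (open_subscheme Y V) f"
    by (rule lrs_morphism_into_open[OF V_open subset_refl])
  interpret i: kmor k Y X V finv by (rule kmor_finv)
  show "lrs_morphism (open_subscheme Y V) (open_subscheme X U) finv"
    by (rule i.lrs_morphism_into_open[OF U]) (simp add: finv_image)
  show "mor_eq (open_subscheme X U) (open_subscheme X U) (mor_comp (open_subscheme Y V) finv f) mor_id"
    unfolding mor_eq_def X.points_open[OF U] X.opn_open[OF U]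
  proof (intro conjI ballI allI impI)
    fix W s assume W: "opn X W \<and> W \<subseteq> U" and "s \<in> carrier (sect (open_subscheme X U) W)"
    then have s: "s \<in> carrier (sect X W)" and WU: "W \<inter> U = W" by auto
    have "snd (mor_comp (open_subscheme Y V) finv f) W s = snd f (fst f ` W) (e W s)"
      using W s by (simp add: mor_comp_def preim_open_subscheme[OF V_open] pb_finv snd_finv WU)
    then show "snd (mor_comp (open_subscheme Y V) finv f) W s = snd mor_id W s"
      using f_e W s by (simp add: mor_id_def)
  qed (simp add: mor_comp_def mor_id_def fst_finv)
  show "mor_eq (open_subscheme Y V) (open_subscheme Y V) (mor_comp (open_subscheme X U) f finv) mor_id"
    unfolding mor_eq_def Y.points_open[OF V_open] Y.opn_open[OF V_open]
  proof (intro conjI ballI allI impI)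
    fix T s assume T: "opn Y T \<and> T \<subseteq> V" and "s \<in> carrier (sect (open_subscheme Y V) T)"
    then have s: "s \<in> carrier (sect Y T)" by simp
    have 1: "pb U f T \<inter> U = pb U f T" "fst f ` pb U f T = T" using T by (auto simp: pb_def)
    have "snd (mor_comp (open_subscheme X U) f finv) T s = e (pb U f T) (snd f T s)"
      using T s closed pb_open by (simp add: mor_comp_def preim_open_subscheme[OF U] snd_finv 1(1))
    then show "snd (mor_comp (open_subscheme X U) f finv) T s = snd mor_id T s"
      using e_f[OF pb_open[of T] pb_subset[of U f T], unfolded 1(2), of s] T s by (simp add: mor_id_def)
  qed (auto simp: mor_comp_def mor_id_def fst_finv)
qed

lemma (in kmor) open_immersion_iff: "open_immersion k (open_subscheme X U) Y f \<longleftrightarrow> oi X Y U f"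
  using open_immersionD[OF kmor_axioms] oimm.open_immersion[OF oimm.intro[OF kmor_axioms oimm_axioms.intro]] by blast

lemma (in oimm) oimm_restrict:
  assumes W: "opn X W" "W \<subseteq> U"
  shows "oimm k X Y W (mor_restrict (open_subscheme X U) f W)"
proof (rule oimm.intro[OF kmor_restrict[OF W] oimm_axioms.intro])
  show "oi X Y W (mor_restrict (open_subscheme X U) f W)"
    unfolding oi_def
  proof (intro conjI allI impI)
    fix T assume T: "opn Y T" "T \<subseteq> fst (mor_restrict (open_subscheme X U) f W) ` W"
    then have TV: "T \<subseteq> fst f ` W" by simp
    have eq: "pb W f T = pb U f T" using TV pb_image[OF W(2)] pb_mono[OF TV, of U f] by (auto simp: pb_def)
    have "bij_betw (snd f T) (carrier (sect Y T)) (carrier (sect X (pb U f T)))"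
      using bij[OF T(1)] TV W by blast
    then show "bij_betw (snd (mor_restrict (open_subscheme X U) f W) T) (carrier (sect Y T))
        (carrier (sect X (pb W (mor_restrict (open_subscheme X U) f W) T)))"
      unfolding pb_mor_restrict eq
      by (rule bij_betw_cong[THEN iffD1, rotated])
        (use T closed pb_open in \<open>simp add: snd_restrict[OF W(2)] eq\<close>)
  qed (use W inj open_image in \<open>auto intro: inj_on_subset\<close>)
qed

lemma oimm_rcomp:
  assumes f: "oimm k X Y U f" and g: "oimm k Y Z V g"
  shows "oimm k X Z (pb U f V) (rcomp X Y U f V g)"
proof -
  interpret f: oimm k X Y U f by fact
  interpret g: oimm k Y Z V g by fact
  note km = f.kmor_axioms g.kmor_axioms
  show ?thesis
  proof (rule oimm.intro[OF kmor_rcomp[OF km] oimm_axioms.intro])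
    show "oi X Z (pb U f V) (rcomp X Y U f V g)"
      unfolding oi_def
    proof (intro conjI allI impI)
      show "inj_on (fst (rcomp X Y U f V g)) (pb U f V)"
        using f.inj g.inj by (auto simp: inj_on_def pb_def)
      show "opn Z (fst (rcomp X Y U f V g) ` W)" if W: "opn X W" "W \<subseteq> pb U f V" for W
      proof -
        have "fst f ` W \<subseteq> V" "W \<subseteq> U" using W by (auto simp: pb_def)
        moreover have "fst (rcomp X Y U f V g) ` W = fst g ` fst f ` W" by (auto simp: image_iff)
        ultimately show ?thesis using g.open_image f.open_image W by simp
      qed
      fix T assume T: "opn Z T" "T \<subseteq> fst (rcomp X Y U f V g) ` pb U f V"
      have TV: "T \<subseteq> fst g ` V" and P: "pb V g T \<subseteq> fst f ` U"
      proof -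
        show "T \<subseteq> fst g ` V" using T(2) by (auto simp: pb_def)
        \<comment> \<open>A point of \<open>V\<close> sent to \<open>T\<close> has the same image
          under \<open>g\<close> as a point in the image of \<open>f\<close>; the two coincide as
          \<open>g\<close> is injective on \<open>V\<close>.\<close>
        show "pb V g T \<subseteq> fst f ` U"
        proof
          fix y assume "y \<in> pb V g T"
          then have y: "y \<in> V" "fst g y \<in> T" by (auto simp: pb_def)
          then obtain x where "x \<in> U" "fst f x \<in> V" "fst g y = fst g (fst f x)" using T(2) by (auto simp: pb_def)
          then show "y \<in> fst f ` U" using g.inj y by (auto simp: inj_on_def)
        qed
      qed
      have "bij_betw (snd f (pb V g T) \<circ> snd g T) (carrier (sect Z T)) (carrier (sect X (pb U f (pb V g T))))"
        by (rule bij_betw_trans[OF g.bij[OF T(1) TV] f.bij[OF g.pb_open[OF T(1)] P]])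
      then show "bij_betw (snd (rcomp X Y U f V g) T) (carrier (sect Z T))
          (carrier (sect X (pb (pb U f V) (rcomp X Y U f V g) T)))"
        unfolding pb_rcomp by (rule bij_betw_cong[THEN iffD1, rotated]) (simp add: snd_rcomp[OF km T(1)])
    qed
  qed
qed

lemma (in var) oimm_id: "oimm k X X (points X) mor_id"
proof (rule oimm.intro[OF kmor_id oimm_axioms.intro])
  show "oi X X (points X) mor_id"
    unfolding oi_def
  proof (intro conjI allI impI)
    fix T assume "opn X T"
    then show "bij_betw (snd mor_id T) (carrier (sect X T)) (carrier (sect X (pb (points X) mor_id T)))"
      unfolding pb_id by (simp add: pb_points_id mor_id_def bij_betw_def)
  qed (auto simp: mor_id_def)
qed

section \<open>Rational and birational maps\<close>

lemma rat_reps_iff: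
  assumes "var k X" "var k Y"
  shows "(U, f) \<in> rat_reps k X Y \<longleftrightarrow> U \<noteq> {} \<and> kmor k X Y U f"
  using assms unfolding rat_reps_def kmor_def kmor_axioms_def by auto

lemma rat_rel_iff:
  assumes XY: "var k X" "var k Y"
  shows "((U, f), (V, g)) \<in> rat_rel k X Y \<longleftrightarrow> U \<noteq> {} \<and> V \<noteq> {} \<and> kmor k X Y U f \<and> kmor k X Y V g \<and>
     (\<exists>W. W \<noteq> {} \<and> agree X Y U f V g W)"
proof -
  have "(\<exists>W. opn X W \<and> W \<noteq> {} \<and> W \<subseteq> U \<inter> V \<and>
      mor_eq (open_subscheme X W) Y (mor_restrict (open_subscheme X U) f W) (mor_restrict (open_subscheme X V) g W))
    \<longleftrightarrow> (\<exists>W. W \<noteq> {} \<and> agree X Y U f V g W)" if "kmor k X Y U f" "kmor k X Y V g"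
    using mor_eq_agree[OF that] agreeD(1-3) by (metis Int_greatest)
  then show ?thesis unfolding rat_rel_def using rat_reps_iff[OF XY] by auto
qed

lemma (in kmor) agree_refl: "agree X Y U f U f U"
  unfolding agree_def using U by simp

text \<open>Transitivity uses irreducibility: the two open sets of agreement meet.\<close>

lemma equiv_rat_rel:
  assumes X: "var k X" and Y: "var k Y"
  shows "equiv (rat_reps k X Y) (rat_rel k X Y)"
proof (rule equivI)
  interpret X: var k X by fact
  note iff = rat_rel_iff[OF X Y] and rep = rat_reps_iff[OF X Y]
  show "rat_rel k X Y \<subseteq> rat_reps k X Y \<times> rat_reps k X Y" by (auto simp: rat_rel_def)
  show "refl_on (rat_reps k X Y) (rat_rel k X Y)"
  proof (rule refl_onI)
    fix a assume a: "a \<in> rat_reps k X Y"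
    obtain U f where [simp]: "a = (U, f)" by (metis prod.exhaust)
    from a have "U \<noteq> {}" "kmor k X Y U f" using rep[of U f] by simp_all
    then show "(a, a) \<in> rat_rel k X Y" using kmor.agree_refl[of k X Y U f] by (auto simp: iff)
  qed
  show "sym (rat_rel k X Y)"
  proof (rule symI)
    fix a b assume ab: "(a, b) \<in> rat_rel k X Y"
    obtain U f V g where [simp]: "a = (U, f)" "b = (V, g)" by (metis prod.exhaust)
    from ab obtain W where *: "U \<noteq> {}" "V \<noteq> {}" "kmor k X Y U f" "kmor k X Y V g"
      "W \<noteq> {}" "agree X Y U f V g W" by (auto simp: iff)
    from agree_sym[OF *(6)] show "(b, a) \<in> rat_rel k X Y" using * by (auto simp: iff)
  qed
  show "trans (rat_rel k X Y)"
  proof (rule transI)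
    fix a b c assume ab: "(a, b) \<in> rat_rel k X Y" and bc: "(b, c) \<in> rat_rel k X Y"
    obtain U f V g T h where [simp]: "a = (U, f)" "b = (V, g)" "c = (T, h)" by (metis prod.exhaust)
    from ab bc obtain W S where *: "U \<noteq> {}" "T \<noteq> {}" "kmor k X Y U f" "kmor k X Y V g" "kmor k X Y T h"
      "W \<noteq> {}" "S \<noteq> {}" "agree X Y U f V g W" "agree X Y V g T h S" by (auto simp: iff)
    have "W \<inter> S \<noteq> {}" using X.open_Int_nonempty[OF agreeD(1)[OF *(8)] _ agreeD(1)[OF *(9)]] * by blast
    then have "((U, f), (T, h)) \<in> rat_rel k X Y"
      unfolding iff by (intro conjI exI[of _ "W \<inter> S"] *(1,2,3,5) agree_trans[OF *(3,4,5,8,9)])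
    then show "(a, c) \<in> rat_rel k X Y" by simp
  qed
qed

context
  fixes k :: "'k ring" and X :: "('x, 'r, 'k) k_space" and Y :: "('y, 's, 'k) k_space"
  assumes X: "var k X" and Y: "var k Y"
begin

interpretation X: var k X by (rule X)
interpretation Y: var k Y by (rule Y)

lemma rat_class:
  assumes "rational_map k X Y \<phi>" "(U, f) \<in> \<phi>"
  shows "\<phi> = rat_rel k X Y `` {(U, f)}" "kmor k X Y U f" "U \<noteq> {}"
proof -
  have q: "\<phi> \<in> rat_reps k X Y // rat_rel k X Y" using assms by (simp add: rational_map_def)
  show "\<phi> = rat_rel k X Y `` {(U, f)}"
  proof -
    from q obtain r where r: "\<phi> = rat_rel k X Y `` {r}" by (rule quotientE)
    then have "(r, (U, f)) \<in> rat_rel k X Y" using assms(2) by simp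
    from equiv_class_eq[OF equiv_rat_rel[OF X Y] this] show ?thesis unfolding r .
  qed
  have "(U, f) \<in> rat_reps k X Y" using in_quotient_imp_subset[OF equiv_rat_rel[OF X Y] q] assms(2) by blast
  then show "kmor k X Y U f" "U \<noteq> {}" using rat_reps_iff[OF X Y] by auto
qed

lemma rat_mem_iff:
  assumes "rational_map k X Y \<phi>" "(U, f) \<in> \<phi>"
  shows "(V, g) \<in> \<phi> \<longleftrightarrow> V \<noteq> {} \<and> kmor k X Y V g \<and> (\<exists>W. W \<noteq> {} \<and> agree X Y U f V g W)"
  using rat_class[OF assms] rat_rel_iff[OF X Y] by auto

lemma rat_of_kmor:
  assumes "kmor k X Y U f" "U \<noteq> {}"
  shows "rational_map k X Y (rat_rel k X Y `` {(U, f)})" "(U, f) \<in> rat_rel k X Y `` {(U, f)}"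
proof -
  have r: "(U, f) \<in> rat_reps k X Y" using assms rat_reps_iff[OF X Y] by blast
  show "rational_map k X Y (rat_rel k X Y `` {(U, f)})" unfolding rational_map_def by (rule quotientI[OF r])
  show "(U, f) \<in> rat_rel k X Y `` {(U, f)}" by (rule equiv_class_self[OF equiv_rat_rel[OF X Y] r])
qed

lemma rat_class_eqI:
  assumes "kmor k X Y U f" "kmor k X Y V g" "agree X Y U f V g W" "W \<noteq> {}"
  shows "rat_rel k X Y `` {(U, f)} = rat_rel k X Y `` {(V, g)}"
proof -
  have "((U, f), (V, g)) \<in> rat_rel k X Y"
    unfolding rat_rel_iff[OF X Y]
  proof (intro conjI exI)
    show "U \<noteq> {}" "V \<noteq> {}" using agreeD(2,3)[OF assms(3)] assms(4) by auto
  qed (rule assms)+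
  then show ?thesis by (rule equiv_class_eq[OF equiv_rat_rel[OF X Y]])
qed

lemma rat_restrict_mem:
  assumes "rational_map k X Y \<phi>" "(U, f) \<in> \<phi>" "opn X W" "W \<subseteq> U" "W \<noteq> {}"
  shows "(W, mor_restrict (open_subscheme X U) f W) \<in> \<phi>"
proof -
  interpret kmor k X Y U f by (rule rat_class[OF assms(1,2)])
  show ?thesis
    using rat_mem_iff[OF assms(1,2)] kmor_restrict[OF assms(3,4)] agree_restrict[OF assms(3,4)] assms(5) by blast
qed

lemma birational_oimm:
  assumes "birational_map k X Y \<phi>"
  obtains U f where "(U, f) \<in> \<phi>" "oimm k X Y U f" "U \<noteq> {}" "rational_map k X Y \<phi>"
proof -
  from assms obtain U f where *: "rational_map k X Y \<phi>" "(U, f) \<in> \<phi>" "open_immersion k (open_subscheme X U) Y f"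
    unfolding birational_map_def by blast
  interpret kmor k X Y U f by (rule rat_class[OF *(1,2)])
  have "oimm k X Y U f" using *(3) open_immersion_iff by unfold_locales blast
  then show thesis using that * rat_class(3)[OF *(1,2)] by blast
qed

lemma birational_of_oimm:
  assumes "oimm k X Y U f" "U \<noteq> {}"
  shows "birational_map k X Y (rat_rel k X Y `` {(U, f)})"
  using rat_of_kmor[OF oimm.axioms(1)[OF assms(1)] assms(2)] oimm.open_immersion[OF assms(1)]
  unfolding birational_map_def by blast

lemma birational_rational: "birational_map k X Y \<phi> \<Longrightarrow> rational_map k X Y \<phi>"
  unfolding birational_map_def by blast

text \<open>\<open>f\<close> need not be an immersion, but it agrees on a nonempty open
  \<open>W\<close> with a representative that is one. The image of \<open>W\<close> under the latter
  is open and so meets \<open>V\<close>.\<close>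

lemma birational_dominant:
  assumes \<phi>: "birational_map k X Y \<phi>" "(U, f) \<in> \<phi>" and V: "opn Y V" "V \<noteq> {}"
  shows "pb U f V \<noteq> {}"
proof -
  obtain U0 f0 where 0: "(U0, f0) \<in> \<phi>" "oimm k X Y U0 f0" "U0 \<noteq> {}" "rational_map k X Y \<phi>"
    using birational_oimm[OF \<phi>(1)] by blast
  interpret f0: oimm k X Y U0 f0 by fact
  obtain W where W: "W \<noteq> {}" "agree X Y U0 f0 U f W" using rat_mem_iff[OF 0(4,1)] \<phi>(2) by blast
  note D = agreeD[OF W(2)]
  have "fst f0 ` W \<inter> V \<noteq> {}"
    using Y.open_Int_nonempty[OF f0.open_image[OF D(1,2)] _ V] W by blast
  then obtain x where "x \<in> W" "fst f0 x \<in> V" by blast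
  then have "x \<in> pb U f V" using D(3) D(4)[of x] by (auto simp: pb_def)
  then show ?thesis by blast
qed

end

text \<open>\<open>rat_comp\<close> unites the classes of the composites of all representatives.
  These classes coincide because \<open>\<phi>\<close> is dominant, so that the composites agree on
  a nonempty open set.\<close>

lemma rat_comp_eq:
  fixes k :: "'k ring" and X :: "('x, 'r, 'k) k_space" and Y :: "('y, 's, 'k) k_space" and Z :: "('z, 't, 'k) k_space"
  assumes X: "var k X" and Y: "var k Y" and Z: "var k Z"
    and \<phi>: "birational_map k X Y \<phi>" and \<psi>: "rational_map k Y Z \<psi>"
    and f: "(U, f) \<in> \<phi>" and g: "(V, g) \<in> \<psi>"
  shows "rat_comp k X Y Z \<psi> \<phi> = rat_rel k X Z `` {(pb U f V, rcomp X Y U f V g)}"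
proof -
  note \<phi>r = birational_rational[OF X Y \<phi>]
  have eq: "rat_rel k X Z `` {(pb U' f' V', rcomp X Y U' f' V' g')} = rat_rel k X Z `` {(pb U f V, rcomp X Y U f V g)}"
    if f': "(U', f') \<in> \<phi>" and g': "(V', g') \<in> \<psi>" for U' f' V' g'
  proof -
    note F = rat_class(2)[OF X Y \<phi>r f] and F' = rat_class(2)[OF X Y \<phi>r f']
    note G = rat_class(2)[OF Y Z \<psi> g] and G' = rat_class(2)[OF Y Z \<psi> g']
    interpret F': kmor k X Y U' f' by (rule F')
    obtain W where W: "W \<noteq> {}" "agree X Y U' f' U f W" using rat_mem_iff[OF X Y \<phi>r f'] f by blast
    obtain S where S: "S \<noteq> {}" "agree Y Z V' g' V g S" using rat_mem_iff[OF Y Z \<psi> g'] g by blast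
    have "(W, mor_restrict (open_subscheme X U') f' W) \<in> \<phi>"
      using rat_restrict_mem[OF X Y \<phi>r f'] agreeD(1,2)[OF W(2)] W(1) by blast
    then have "pb W f' S \<noteq> {}"
      using birational_dominant[OF X Y \<phi> _ agreeD(1)[OF S(2)] S(1)] by fastforce
    then show ?thesis
      by (rule rat_class_eqI[OF X Z kmor_rcomp[OF F' G'] kmor_rcomp[OF F G] agree_rcomp[OF F' F G' G W(2) S(2)]])
  qed
  have op: "opn X U'" "opn Y V'" if "(U', f') \<in> \<phi>" "(V', g') \<in> \<psi>" for U' f' V' g'
    using rat_class(2)[OF X Y \<phi>r that(1)] rat_class(2)[OF Y Z \<psi> that(2)]
    by (simp_all add: kmor_def kmor_axioms_def)
  have "(let U'' = preim (open_subscheme X U') f' V' in rat_rel k X Z ``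
       {(U'', mor_comp (open_subscheme Y V') g' (mor_restrict (open_subscheme X U') f' U''))})
      = rat_rel k X Z `` {(pb U f V, rcomp X Y U f V g)}"
    if "(U', f') \<in> \<phi>" "(V', g') \<in> \<psi>" for U' f' V' g'
    using eq[OF that] unfolding Let_def preim_open_subscheme[OF op(1)[OF that]] rcomp_def .
  from UN_pair_const[OF f g this] show ?thesis unfolding rat_comp_def by simp
qed

lemma rat_comp_mem:
  assumes X: "var k X" and Y: "var k Y" and Z: "var k Z"
    and \<phi>: "birational_map k X Y \<phi>" and \<psi>: "rational_map k Y Z \<psi>"
    and f: "(U, f) \<in> \<phi>" and g: "(V, g) \<in> \<psi>"
  shows "(pb U f V, rcomp X Y U f V g) \<in> rat_comp k X Y Z \<psi> \<phi>" "rational_map k X Z (rat_comp k X Y Z \<psi> \<phi>)"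
proof -
  have "pb U f V \<noteq> {}"
    using birational_dominant[OF X Y \<phi> f] rat_class(2,3)[OF Y Z \<psi> g] by (simp add: kmor_def kmor_axioms_def)
  then show "(pb U f V, rcomp X Y U f V g) \<in> rat_comp k X Y Z \<psi> \<phi>" "rational_map k X Z (rat_comp k X Y Z \<psi> \<phi>)"
    using rat_comp_eq[OF assms]
      rat_of_kmor[OF X Z kmor_rcomp[OF rat_class(2)[OF X Y birational_rational[OF X Y \<phi>] f] rat_class(2)[OF Y Z \<psi> g]]]
    by simp_all
qed

lemma birational_comp:
  assumes X: "var k X" and Y: "var k Y" and Z: "var k Z"
    and \<phi>: "birational_map k X Y \<phi>" and \<psi>: "birational_map k Y Z \<psi>"
  shows "birational_map k X Z (rat_comp k X Y Z \<psi> \<phi>)"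
proof -
  obtain U f where f: "(U, f) \<in> \<phi>" "oimm k X Y U f" using birational_oimm[OF X Y \<phi>] by blast
  obtain V g where g: "(V, g) \<in> \<psi>" "oimm k Y Z V g" using birational_oimm[OF Y Z \<psi>] by blast
  show ?thesis
    using rat_comp_mem[OF X Y Z \<phi> birational_rational[OF Y Z \<psi>] f(1) g(1)]
      oimm.open_immersion[OF oimm_rcomp[OF f(2) g(2)]]
    unfolding birational_map_def by blast
qed

text \<open>Both sides are represented on the same open set by composites with equal
  comorphisms.\<close>

lemma rat_comp_assoc:
  assumes X: "var k X" and Y: "var k Y" and Z: "var k Z" and T: "var k T"
    and \<phi>: "birational_map k X Y \<phi>" and \<psi>: "birational_map k Y Z \<psi>" and \<chi>: "birational_map k Z T \<chi>"
  shows "rat_comp k X Y T (rat_comp k Y Z T \<chi> \<psi>) \<phi> = rat_comp k X Z T \<chi> (rat_comp k X Y Z \<psi> \<phi>)"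
proof -
  obtain U f where f: "(U, f) \<in> \<phi>" "oimm k X Y U f" using birational_oimm[OF X Y \<phi>] by blast
  obtain V g where g: "(V, g) \<in> \<psi>" "oimm k Y Z V g" using birational_oimm[OF Y Z \<psi>] by blast
  obtain W h where h: "(W, h) \<in> \<chi>" "oimm k Z T W h" using birational_oimm[OF Z T \<chi>] by blast
  note F = oimm.axioms(1)[OF f(2)] and G = oimm.axioms(1)[OF g(2)] and H = oimm.axioms(1)[OF h(2)]
  note GH = kmor_rcomp[OF G H] and FG = kmor_rcomp[OF F G]
  interpret F: kmor k X Y U f by (rule F)
  interpret G: kmor k Y Z V g by (rule G)
  interpret H: kmor k Z T W h by (rule H)
  note \<chi>r = birational_rational[OF Z T \<chi>] and \<psi>r = birational_rational[OF Y Z \<psi>]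
  note gh = rat_comp_mem[OF Y Z T \<psi> \<chi>r g(1) h(1)] and fg = rat_comp_mem[OF X Y Z \<phi> \<psi>r f(1) g(1)]
  let ?l = "rcomp X Y U f (pb V g W) (rcomp Y Z V g W h)" and ?r = "rcomp X Z (pb U f V) (rcomp X Y U f V g) W h"
  let ?S = "pb U f (pb V g W)"
  have ag: "agree X T ?S ?l (pb (pb U f V) (rcomp X Y U f V g) W) ?r ?S"
    unfolding agree_def pb_rcomp[of U f V X Y g W]
  proof (intro conjI ballI allI impI)
    show "opn X ?S" using F.pb_open G.pb_open H.U by blast
    fix P s assume P: "opn T P" "s \<in> carrier (sect T P)"
    have "snd ?l P s = snd ?r P s"
      using P H.pb_open H.closed
      by (simp add: snd_rcomp[OF F GH P] snd_rcomp[OF G H P] snd_rcomp[OF FG H P] snd_rcomp[OF F G] pb_rcomp)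
    moreover have "pb ?S ?l P = pb ?S ?r P" by (auto simp: pb_def)
    ultimately show "restr X (pb ?S ?l P) (pb ?S ?l P) (snd ?l P s) = restr X (pb ?S ?r P) (pb ?S ?l P) (snd ?r P s)"
      by simp
  qed auto
  have ne: "?S \<noteq> {}"
    using birational_dominant[OF X Y \<phi> f(1) G.pb_open[OF H.U]] rat_class(3)[OF Y T gh(2,1)] by blast
  show ?thesis
    unfolding rat_comp_eq[OF X Y T \<phi> gh(2) f(1) gh(1)]
      rat_comp_eq[OF X Z T birational_comp[OF X Y Z \<phi> \<psi>] \<chi>r fg(1) h(1)]
    by (rule rat_class_eqI[OF X T kmor_rcomp[OF F GH] kmor_rcomp[OF FG H] ag ne])
qed

lemma (in var) points_nonempty: "points X \<noteq> {}"
  using irred by (simp add: irreducible_in_def)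

lemma birational_id: "var k X \<Longrightarrow> birational_map k X X (rat_id k X)"
  unfolding rat_id_def using birational_of_oimm var.oimm_id var.points_nonempty by blast

lemma id_mem: "var k X \<Longrightarrow> (points X, mor_id) \<in> rat_id k X"
  unfolding rat_id_def by (rule rat_of_kmor(2)[OF _ _ var.kmor_id var.points_nonempty])

lemma rat_comp_id_right:
  assumes X: "var k X" and Y: "var k Y" and \<phi>: "birational_map k X Y \<phi>"
  shows "rat_comp k X X Y \<phi> (rat_id k X) = \<phi>"
proof -
  interpret X: var k X by (rule X)
  note \<phi>r = birational_rational[OF X Y \<phi>]
  obtain U f where f: "(U, f) \<in> \<phi>" "oimm k X Y U f" using birational_oimm[OF X Y \<phi>] by blast
  interpret f: oimm k X Y U f by (rule f)
  have UX: "points X \<inter> U = U" using openin_subset[OF f.U] by blast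
  have "agree X Y U (rcomp X X (points X) mor_id U f) U f U"
    unfolding agree_def
  proof (intro conjI ballI allI impI)
    fix P s assume P: "opn Y P" "s \<in> carrier (sect Y P)"
    have "snd (rcomp X X (points X) mor_id U f) P s = snd f P s"
      unfolding snd_rcomp[OF X.kmor_id f.kmor_axioms P] by (simp add: mor_id_def)
    moreover have "pb U (rcomp X X (points X) mor_id U f) P = pb U f P" by (auto simp: pb_def mor_id_def)
    ultimately show "restr X (pb U (rcomp X X (points X) mor_id U f) P) (pb U (rcomp X X (points X) mor_id U f) P)
         (snd (rcomp X X (points X) mor_id U f) P s) =
        restr X (pb U f P) (pb U (rcomp X X (points X) mor_id U f) P) (snd f P s)" by simp
  qed (use f.U in \<open>auto simp: mor_id_def\<close>)
  then have "rat_rel k X Y `` {(U, rcomp X X (points X) mor_id U f)} = rat_rel k X Y `` {(U, f)}"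
    using rat_class_eqI[OF X Y kmor_rcomp[OF X.kmor_id f.kmor_axioms] f.kmor_axioms]
      rat_class(3)[OF X Y \<phi>r f(1)] unfolding pb_id UX by blast
  then show ?thesis
    unfolding rat_comp_eq[OF X X Y birational_id[OF X] \<phi>r id_mem[OF X] f(1)] pb_id UX
    using rat_class(1)[OF X Y \<phi>r f(1)] by simp
qed

lemma rat_comp_id_left:
  assumes X: "var k X" and Y: "var k Y" and \<phi>: "birational_map k X Y \<phi>"
  shows "rat_comp k X Y Y (rat_id k Y) \<phi> = \<phi>"
proof -
  interpret Y: var k Y by (rule Y)
  note \<phi>r = birational_rational[OF X Y \<phi>]
  obtain U f where f: "(U, f) \<in> \<phi>" "oimm k X Y U f" using birational_oimm[OF X Y \<phi>] by blast
  interpret f: oimm k X Y U f by (rule f)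
  have "agree X Y U (rcomp X Y U f (points Y) mor_id) U f U"
    unfolding agree_def
  proof (intro conjI ballI allI impI)
    fix P s assume P: "opn Y P" "s \<in> carrier (sect Y P)"
    have "snd (rcomp X Y U f (points Y) mor_id) P s = snd f P s"
      unfolding snd_rcomp[OF f.kmor_axioms Y.kmor_id P] pb_id Y.pb_points_id[OF P(1)] by (simp add: mor_id_def)
    moreover have "pb U (rcomp X Y U f (points Y) mor_id) P = pb U f P" by (auto simp: pb_def mor_id_def)
    ultimately show "restr X (pb U (rcomp X Y U f (points Y) mor_id) P) (pb U (rcomp X Y U f (points Y) mor_id) P)
         (snd (rcomp X Y U f (points Y) mor_id) P s) =
        restr X (pb U f P) (pb U (rcomp X Y U f (points Y) mor_id) P) (snd f P s)" by simp
  qed (use f.U in \<open>auto simp: mor_id_def\<close>)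
  then have "rat_rel k X Y `` {(U, rcomp X Y U f (points Y) mor_id)} = rat_rel k X Y `` {(U, f)}"
    using rat_class_eqI[OF X Y kmor_rcomp[OF f.kmor_axioms Y.kmor_id] f.kmor_axioms]
      rat_class(3)[OF X Y \<phi>r f(1)] unfolding f.pb_points by blast
  then show ?thesis
    unfolding rat_comp_eq[OF X Y Y \<phi> birational_rational[OF Y Y birational_id[OF Y]] f(1) id_mem[OF Y]] f.pb_points
    using rat_class(1)[OF X Y \<phi>r f(1)] by simp
qed

subsection \<open>Inverses\<close>

lemma rat_inverse_of_oimm:
  assumes X: "var k X" and Y: "var k Y" and f: "oimm k X Y U f" "U \<noteq> {}"
  defines "\<phi> \<equiv> rat_rel k X Y `` {(U, f)}"
    and "\<psi> \<equiv> rat_rel k Y X `` {(fst f ` U, oimm.finv X Y U f)}"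
  shows "birational_map k Y X \<psi>" "rat_comp k X Y X \<psi> \<phi> = rat_id k X" "rat_comp k Y X Y \<phi> \<psi> = rat_id k Y"
proof -
  interpret f: oimm k X Y U f by (rule f)
  interpret g: oimm k Y X f.V f.finv by (rule oimm.intro[OF f.kmor_finv oimm_axioms.intro[OF f.oi_finv]])
  have V0: "f.V \<noteq> {}" using f(2) by simp
  show \<psi>: "birational_map k Y X \<psi>" unfolding \<psi>_def by (rule birational_of_oimm[OF Y X g.oimm_axioms V0])
  have \<phi>: "birational_map k X Y \<phi>" unfolding \<phi>_def by (rule birational_of_oimm[OF X Y f])
  have mf: "(U, f) \<in> \<phi>" unfolding \<phi>_def by (rule rat_of_kmor(2)[OF X Y f.kmor_axioms f(2)])
  have mg: "(f.V, f.finv) \<in> \<psi>" unfolding \<psi>_def by (rule rat_of_kmor(2)[OF Y X g.kmor_axioms V0])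
  have pbU: "pb U f f.V = U" and pbV: "pb f.V f.finv U = f.V" using f.pb_image[of U] f.pb_finv[of U] by auto
  show "rat_comp k X Y X \<psi> \<phi> = rat_id k X"
    unfolding rat_comp_eq[OF X Y X \<phi> birational_rational[OF Y X \<psi>] mf mg] pbU rat_id_def
    using rat_class_eqI[OF X X kmor_rcomp[OF f.kmor_axioms g.kmor_axioms, unfolded pbU] f.X.kmor_id f.agree_finv_f f(2)] .
  show "rat_comp k Y X Y \<phi> \<psi> = rat_id k Y"
    unfolding rat_comp_eq[OF Y X Y \<psi> birational_rational[OF X Y \<phi>] mg mf] pbV rat_id_def
    using rat_class_eqI[OF Y Y kmor_rcomp[OF g.kmor_axioms f.kmor_axioms, unfolded pbV] f.Y.kmor_id f.agree_f_finv V0] .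
qed

text \<open>\<open>birational_inv\<close> is a definite description, so uniqueness has to be shown;
  this is the usual uniqueness of two-sided inverses.\<close>

lemma birational_inv_eqI:
  assumes X: "var k X" and Y: "var k Y" and \<phi>: "birational_map k X Y \<phi>" and \<psi>: "birational_map k Y X \<psi>"
    and 1: "rat_comp k X Y X \<psi> \<phi> = rat_id k X" and 2: "rat_comp k Y X Y \<phi> \<psi> = rat_id k Y"
  shows "birational_inv k X Y \<phi> = \<psi>"
  unfolding birational_inv_def
proof (rule the_equality)
  fix \<chi> assume \<chi>: "birational_map k Y X \<chi> \<and> rat_comp k X Y X \<chi> \<phi> = rat_id k X \<and> rat_comp k Y X Y \<phi> \<chi> = rat_id k Y"
  then have "\<chi> = rat_comp k Y X X (rat_comp k X Y X \<psi> \<phi>) \<chi>"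
    using rat_comp_id_left[OF Y X, of \<chi>] 1 by simp
  also have "\<dots> = rat_comp k Y Y X \<psi> (rat_comp k Y X Y \<phi> \<chi>)"
    using rat_comp_assoc[OF Y X Y X _ \<phi> \<psi>] \<chi> by simp
  also have "\<dots> = \<psi>" using \<chi> rat_comp_id_right[OF Y X \<psi>] by simp
  finally show "\<chi> = \<psi>" .
qed (use \<psi> 1 2 in simp)

text \<open>Besides the inverse laws this gives a concrete representative of the inverse, from which
  its isomorphism points are read off.\<close>

lemma birational_inv_rep:
  assumes X: "var k X" and Y: "var k Y" and \<phi>: "birational_map k X Y \<phi>"
    and f: "(U, f) \<in> \<phi>" "oimm k X Y U f"
  shows "birational_map k Y X (birational_inv k X Y \<phi>)"
    "rat_comp k X Y X (birational_inv k X Y \<phi>) \<phi> = rat_id k X"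
    "rat_comp k Y X Y \<phi> (birational_inv k X Y \<phi>) = rat_id k Y"
    "(fst f ` U, oimm.finv X Y U f) \<in> birational_inv k X Y \<phi>"
proof -
  note c = rat_class[OF X Y birational_rational[OF X Y \<phi>] f(1)]
  interpret f: oimm k X Y U f by (rule f)
  note r = rat_inverse_of_oimm[OF X Y f(2) c(3), folded c(1)]
  note i = birational_inv_eqI[OF X Y \<phi> r]
  show "birational_map k Y X (birational_inv k X Y \<phi>)"
    "rat_comp k X Y X (birational_inv k X Y \<phi>) \<phi> = rat_id k X"
    "rat_comp k Y X Y \<phi> (birational_inv k X Y \<phi>) = rat_id k Y" unfolding i by (rule r)+
  show "(fst f ` U, oimm.finv X Y U f) \<in> birational_inv k X Y \<phi>"
    unfolding i by (rule rat_of_kmor(2)[OF Y X f.kmor_finv]) (use c(3) in simp)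
qed

lemma birational_inv:
  assumes X: "var k X" and Y: "var k Y" and \<phi>: "birational_map k X Y \<phi>"
  shows "birational_map k Y X (birational_inv k X Y \<phi>)"
    "rat_comp k X Y X (birational_inv k X Y \<phi>) \<phi> = rat_id k X"
    "rat_comp k Y X Y \<phi> (birational_inv k X Y \<phi>) = rat_id k Y"
    "birational_inv k Y X (birational_inv k X Y \<phi>) = \<phi>"
proof -
  obtain U f where f: "(U, f) \<in> \<phi>" "oimm k X Y U f" using birational_oimm[OF X Y \<phi>] by blast
  note r = birational_inv_rep[OF X Y \<phi> f]
  show "birational_map k Y X (birational_inv k X Y \<phi>)"
    "rat_comp k X Y X (birational_inv k X Y \<phi>) \<phi> = rat_id k X"
    "rat_comp k Y X Y \<phi> (birational_inv k X Y \<phi>) = rat_id k Y" by (rule r)+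
  show "birational_inv k Y X (birational_inv k X Y \<phi>) = \<phi>"
    by (rule birational_inv_eqI[OF Y X r(1) \<phi> r(3,2)])
qed

lemma group_Bir:
  assumes X: "var k X" shows "group (Bir k X)"
proof (rule groupI)
  show "\<phi> \<otimes>\<^bsub>Bir k X\<^esub> \<psi> \<in> carrier (Bir k X)" if "\<phi> \<in> carrier (Bir k X)" "\<psi> \<in> carrier (Bir k X)" for \<phi> \<psi>
    using that birational_comp[OF X X X] by (simp add: Bir_def)
  show "\<one>\<^bsub>Bir k X\<^esub> \<in> carrier (Bir k X)" using birational_id[OF X] by (simp add: Bir_def)
  show "\<phi> \<otimes>\<^bsub>Bir k X\<^esub> \<psi> \<otimes>\<^bsub>Bir k X\<^esub> \<chi> = \<phi> \<otimes>\<^bsub>Bir k X\<^esub> (\<psi> \<otimes>\<^bsub>Bir k X\<^esub> \<chi>)"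
    if "\<phi> \<in> carrier (Bir k X)" "\<psi> \<in> carrier (Bir k X)" "\<chi> \<in> carrier (Bir k X)" for \<phi> \<psi> \<chi>
    using that rat_comp_assoc[OF X X X X] by (simp add: Bir_def)
  show "\<one>\<^bsub>Bir k X\<^esub> \<otimes>\<^bsub>Bir k X\<^esub> \<phi> = \<phi>" if "\<phi> \<in> carrier (Bir k X)" for \<phi>
    using that rat_comp_id_left[OF X X] by (simp add: Bir_def)
  show "\<exists>\<psi>\<in>carrier (Bir k X). \<psi> \<otimes>\<^bsub>Bir k X\<^esub> \<phi> = \<one>\<^bsub>Bir k X\<^esub>" if "\<phi> \<in> carrier (Bir k X)" for \<phi>
    using that birational_inv[OF X X] by (auto simp: Bir_def)
qed

section \<open>Points of codimension one\<close>

text \<open>Intersect the chain with \<open>U\<close>, map it over and take closures. All members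
  contain \<open>x\<close>, so they meet \<open>U\<close>; \<open>trace\<close> recovers the
  intersections from the closures.\<close>

lemma irreducible_chain_homeo:
  assumes U: "openin S U" and inj: "inj_on f U"
    and op: "\<And>W. openin S W \<Longrightarrow> W \<subseteq> U \<Longrightarrow> openin T (f ` W)"
    and cont: "\<And>O'. openin T O' \<Longrightarrow> openin S {u \<in> U. f u \<in> O'}"
    and x: "x \<in> U" and C: "irreducible_chain S C n" "C 0 = S closure_of {x}"
  shows "\<exists>C'. irreducible_chain T C' n \<and> C' 0 = T closure_of {f x}"
proof -
  have UT: "U \<subseteq> topspace S" using U openin_subset by blast
  have V: "f ` U \<subseteq> topspace T" using op[OF U] openin_subset by blast
  define C' where "C' i = T closure_of (f ` (C i \<inter> U))" for i
  have irr: "closedin S (C i)" "C i \<subseteq> topspace S"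
    "\<And>A B. closedin S A \<Longrightarrow> closedin S B \<Longrightarrow> C i \<subseteq> A \<union> B \<Longrightarrow> C i \<subseteq> A \<or> C i \<subseteq> B" if "i \<le> n" for i
    using C(1) that unfolding irreducible_chain_def irreducible_closed_def irreducible_in_def by auto
  have xC: "x \<in> C i" if "i \<le> n" for i
    using that
  proof (induction i)
    case 0
    then show ?case using C(2) x UT by (auto simp: in_closure_of)
  next
    case (Suc i)
    then have "C i \<subseteq> C (Suc i)" using C(1) unfolding irreducible_chain_def by (simp add: Suc_le_eq psubset_imp_subset)
    then show ?case using Suc by auto
  qed
  \<comment> \<open>The image of \<open>U - C i\<close> is open and disjoint from the image of
    \<open>C i \<inter> U\<close>, hence from the closure of the latter.\<close>
  have trace: "C' i \<inter> f ` U = f ` (C i \<inter> U)" if i: "i \<le> n" for i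
  proof
    have "openin S (U - C i)" using U irr(1)[OF i] by (simp add: openin_diff)
    then have "closedin T (topspace T - f ` (U - C i))" using op by auto
    moreover have "f ` (C i \<inter> U) \<subseteq> topspace T - f ` (U - C i)"
      using V inj by (auto simp: inj_on_def)
    ultimately have "C' i \<subseteq> topspace T - f ` (U - C i)" unfolding C'_def by (rule closure_of_minimal[rotated])
    then show "C' i \<inter> f ` U \<subseteq> f ` (C i \<inter> U)" by auto
    show "f ` (C i \<inter> U) \<subseteq> C' i \<inter> f ` U"
      unfolding C'_def using V closure_of_subset[of "f ` (C i \<inter> U)" T] by auto
  qed
  have "irreducible_chain T C' n"
    unfolding irreducible_chain_def
  proof (intro conjI allI impI)
    fix i assume i: "i \<le> n"
    show "irreducible_closed T (C' i)"
      unfolding irreducible_closed_def irreducible_in_def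
    proof (intro conjI allI impI)
      show "closedin T (C' i)" by (simp add: C'_def)
      then show "C' i \<subseteq> topspace T" by (rule closedin_subset)
      have "f x \<in> C' i" using trace[OF i] xC[OF i] x by auto
      then show "C' i \<noteq> {}" by auto
      fix A B assume AB: "closedin T A \<and> closedin T B \<and> C' i \<subseteq> A \<union> B"
      have cl: "closedin S (topspace S - {u \<in> U. f u \<in> topspace T - A})" if "closedin T A" for A
        using cont[of "topspace T - A"] that by auto
      have "C i \<subseteq> (topspace S - {u \<in> U. f u \<in> topspace T - A}) \<union> (topspace S - {u \<in> U. f u \<in> topspace T - B})"
      proof
        fix u assume u: "u \<in> C i"
        then have "u \<in> U \<Longrightarrow> f u \<in> A \<union> B" using AB trace[OF i] by blast
        then show "u \<in> (topspace S - {u \<in> U. f u \<in> topspace T - A}) \<union> (topspace S - {u \<in> U. f u \<in> topspace T - B})"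
          using u irr(2)[OF i] by blast
      qed
      then have "C i \<subseteq> topspace S - {u \<in> U. f u \<in> topspace T - A} \<or> C i \<subseteq> topspace S - {u \<in> U. f u \<in> topspace T - B}"
        using irr(3)[OF i cl cl] AB by blast
      then have "f ` (C i \<inter> U) \<subseteq> A \<or> f ` (C i \<inter> U) \<subseteq> B" using V by blast
      then show "C' i \<subseteq> A \<or> C' i \<subseteq> B" unfolding C'_def using AB closure_of_minimal by blast
    qed
  next
    fix i assume i: "i < n"
    then have sub: "C i \<subset> C (Suc i)" using C(1) unfolding irreducible_chain_def by auto
    have "C' i \<subseteq> C' (Suc i)" unfolding C'_def by (rule closure_of_mono) (use sub in auto)
    moreover have "C' i \<noteq> C' (Suc i)"
    proof
      assume "C' i = C' (Suc i)"
      then have "f ` (C i \<inter> U) = f ` (C (Suc i) \<inter> U)" using trace[of i] trace[of "Suc i"] i by simp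
      then have eq: "C i \<inter> U = C (Suc i) \<inter> U"
        using inj_on_image_eq_iff[OF inj, of "C i \<inter> U" "C (Suc i) \<inter> U"] by simp
      \<comment> \<open>With equal traces, the irreducible \<open>C (Suc i)\<close> would be covered
        by \<open>C i\<close> and the complement of \<open>U\<close>; the first is too small, the
        second misses \<open>x\<close>.\<close>
      have "C (Suc i) \<subseteq> C i \<union> (topspace S - U)" using eq irr(2)[of "Suc i"] i by auto
      then have "C (Suc i) \<subseteq> C i \<or> C (Suc i) \<subseteq> topspace S - U"
        using irr(3)[of "Suc i" "C i" "topspace S - U"] irr(1)[of i] i U by auto
      then show False using sub xC[of "Suc i"] i x by auto
    qed
    ultimately show "C' i \<subset> C' (Suc i)" by blast
  qed
  moreover have "C' 0 = T closure_of {f x}"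
  proof
    have "f ` (C 0 \<inter> U) \<subseteq> T closure_of {f x}"
    proof
      fix y assume "y \<in> f ` (C 0 \<inter> U)"
      then obtain u where u: "u \<in> S closure_of {x}" "u \<in> U" "y = f u" using C(2) by blast
      show "y \<in> T closure_of {f x}"
        unfolding in_closure_of
      proof (intro conjI allI impI)
        show "y \<in> topspace T" using u V by blast
        fix O' assume O': "y \<in> O' \<and> openin T O'"
        then have u': "u \<in> {u \<in> U. f u \<in> O'}" using u by simp
        have o: "openin S {u \<in> U. f u \<in> O'}" using cont O' by simp
        have "x \<in> N" if "u \<in> N" "openin S N" for N using u(1) that by (auto simp: in_closure_of)
        from this[OF u' o] have "x \<in> {u \<in> U. f u \<in> O'}" .
        then show "\<exists>z. z \<in> {f x} \<and> z \<in> O'" by simp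
      qed
    qed
    then show "C' 0 \<subseteq> T closure_of {f x}" unfolding C'_def by (rule closure_of_minimal) simp
    show "T closure_of {f x} \<subseteq> C' 0" unfolding C'_def by (rule closure_of_mono) (use xC[of 0] x in auto)
  qed
  ultimately show ?thesis by blast
qed

text \<open>Chains are transported in both directions, by \<open>f\<close> and by its inverse, so
  both suprema range over the same set.\<close>

lemma (in oimm) codim_point_image:
  assumes x: "x \<in> U" shows "codim_point (topo Y) (fst f x) = codim_point (topo X) x"
proof -
  interpret g: oimm k Y X V finv by (rule oimm.intro[OF kmor_finv oimm_axioms.intro[OF oi_finv]])
  have 1: "\<exists>C'. irreducible_chain (topo Y) C' n \<and> C' 0 = topo Y closure_of {fst f x}"
    if "irreducible_chain (topo X) C n" "C 0 = topo X closure_of {x}" for C n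
    by (rule irreducible_chain_homeo[OF U inj open_image _ x that])
      (use pb_open in \<open>auto simp: pb_def\<close>)
  have 2: "\<exists>C'. irreducible_chain (topo X) C' n \<and> C' 0 = topo X closure_of {x}"
    if "irreducible_chain (topo Y) C n" "C 0 = topo Y closure_of {fst f x}" for C n
  proof -
    have "openin (topo Y) {y \<in> V. fst finv y \<in> O'}" if "openin (topo X) O'" for O'
      using g.pb_open[OF that] unfolding pb_def .
    from irreducible_chain_homeo[OF V_open g.inj g.open_image this _ that] show ?thesis
      using x fst_finv[OF x] by simp
  qed
  have "{enat n |n. \<exists>C. irreducible_chain (topo Y) C n \<and> C 0 = topo Y closure_of {fst f x}}
      = {enat n |n. \<exists>C. irreducible_chain (topo X) C n \<and> C 0 = topo X closure_of {x}}"
  proof -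
    have "(\<exists>C. irreducible_chain (topo Y) C n \<and> C 0 = topo Y closure_of {fst f x}) \<longleftrightarrow>
        (\<exists>C. irreducible_chain (topo X) C n \<and> C 0 = topo X closure_of {x})" for n
      using 1[of _ n] 2[of _ n] by (intro iffI; elim exE conjE)
    then show ?thesis by simp
  qed
  then show ?thesis unfolding codim_point_def codim_irred_def by simp
qed

lemma irreducible_closure_of_point:
  assumes "x \<in> topspace T" shows "irreducible_closed T (T closure_of {x})"
  unfolding irreducible_closed_def irreducible_in_def
proof (intro conjI allI impI)
  have x: "x \<in> T closure_of {x}" using assms by (auto simp: in_closure_of)
  then show "T closure_of {x} \<noteq> {}" by auto
  fix A B assume AB: "closedin T A \<and> closedin T B \<and> T closure_of {x} \<subseteq> A \<union> B"
  then have "x \<in> A \<or> x \<in> B" using x by blast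
  then show "T closure_of {x} \<subseteq> A \<or> T closure_of {x} \<subseteq> B" using AB closure_of_minimal[of "{x}"] by auto
qed (auto simp: closure_of_subset_topspace)

section \<open>Finiteness of the set of codimension one points outside an open set\<close>

definition codim1_points :: "'a topology \<Rightarrow> 'a set" where
  "codim1_points T = {x \<in> topspace T. codim_point T x = 1}"

text \<open>The two closures and the whole space would form a chain of length 2.\<close>

lemma (in var) codim1_maximal:
  assumes x: "codim_point (topo X) x = 1" "x \<in> points X" and x': "x' \<in> points X"
    and cl: "topo X closure_of {x} \<subset> topo X closure_of {x'}" "topo X closure_of {x'} \<noteq> points X"
  shows False
proof -
  define C where "C = (\<lambda>i::nat. if i = 0 then topo X closure_of {x} else if i = 1 then topo X closure_of {x'} else points X)"
  have "irreducible_closed (topo X) (points X)" using irred by (simp add: irreducible_closed_def)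
  then have "irreducible_chain (topo X) C 2"
    using irreducible_closure_of_point[OF x(2)] irreducible_closure_of_point[OF x'] cl closure_of_subset_topspace[of "topo X" "{x'}"]
    unfolding irreducible_chain_def C_def by (auto simp: less_2_cases_iff)
  moreover have "C 0 = topo X closure_of {x}" by (simp add: C_def)
  ultimately have "enat 2 \<le> codim_point (topo X) x"
    unfolding codim_point_def codim_irred_def by (intro Sup_upper) blast
  then show False using x(1) by (simp add: one_enat_def)
qed

text \<open>The points of codimension one in \<open>Z \<inter> A\<close> give minimal primes over
  the ideal \<open>J\<close> of \<open>Z\<close>. A prime between \<open>J\<close> and
  \<open>q x\<close> belongs to a point of \<open>Z\<close> whose closure contains \<open>x\<close>.
  If it were strictly smaller than \<open>q x\<close>, this closure would lie strictly between that
  of \<open>x\<close> and the whole space.\<close>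

lemma (in var) finite_codim1_chart:
  assumes A: "affine_open X A" and noeth: "cring.noeth (sect X A) (carrier (sect X A))"
    and Z: "closedin (topo X) Z" "Z \<noteq> points X"
  shows "finite {x \<in> codim1_points (topo X). x \<in> Z \<and> x \<in> A}"
proof -
  obtain f g where "affine_chart X A f g" using affine_open_chart[OF lr_space_axioms A] by blast
  then interpret A: affine_chart X A f g .
  have nbhd: "\<exists>h\<in>carrier A.R. x \<in> A.D h \<and> A.D h \<subseteq> N" if N: "opn X N" "x \<in> N" "x \<in> A" for N x
  proof -
    have o: "opn X (N \<inter> A)" using N A.A by blast
    interpret c: cring "sect X (N \<inter> A)" using sect_cring[OF o] .
    \<comment> \<open>\<open>section_local\<close> is applied to the zero section in order to obtain
      a basic open neighbourhood.\<close>
    show ?thesis using A.section_local[OF o Int_lower2 IntI[OF N(2,3)] c.zero_closed] by (metis Int_subset_iff)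
  qed
  \<comment> \<open>These are the elements lying in the prime of every point of
    \<open>Z \<inter> A\<close>; by \<open>JZ\<close> the ideal they generate cuts out
    \<open>Z\<close> on the chart.\<close>
  define J0 where "J0 = {h \<in> carrier A.R. A.D h \<inter> Z = {}}"
  define J where "J = Idl\<^bsub>A.R\<^esub> J0"
  have J0: "J0 \<subseteq> carrier A.R" by (auto simp: J0_def)
  have J: "ideal J A.R" unfolding J_def by (rule A.R.genideal_ideal[OF J0])
  have JZ: "J \<subseteq> A.q x \<longleftrightarrow> x \<in> Z" if x: "x \<in> A" for x
  proof -
    interpret P: primeideal "A.q x" A.R using A.q_prime[OF x] .
    have "J \<subseteq> A.q x \<longleftrightarrow> J0 \<subseteq> A.q x"
      using A.R.genideal_minimal[OF P.is_ideal, of J0] A.R.genideal_self[OF J0] unfolding J_def by blast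
    also have "\<dots> \<longleftrightarrow> x \<in> Z"
    proof
      assume sub: "J0 \<subseteq> A.q x"
      show "x \<in> Z"
      proof (rule ccontr)
        assume "x \<notin> Z"
        moreover have "opn X (points X - Z)" using Z by blast
        ultimately obtain h where "h \<in> carrier A.R" "x \<in> A.D h" "A.D h \<subseteq> points X - Z"
          using nbhd[of "points X - Z" x] x A.A_sub by blast
        then have "h \<in> J0" "h \<notin> A.q x" by (auto simp: J0_def A.D_def)
        then show False using sub by blast
      qed
    next
      assume "x \<in> Z"
      then show "J0 \<subseteq> A.q x" using x by (auto simp: J0_def A.D_def)
    qed
    finally show ?thesis .
  qed
  have min: "A.R.minprime J (A.q x)" if x: "x \<in> codim1_points (topo X)" "x \<in> Z" "x \<in> A" for x
    unfolding A.R.minprime_def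
  proof (intro conjI allI impI)
    show "primeideal (A.q x) A.R" by (rule A.q_prime[OF x(3)])
    show "J \<subseteq> A.q x" using JZ x by blast
    fix Q assume Q: "primeideal Q A.R \<and> J \<subseteq> Q \<and> Q \<subseteq> A.q x"
    let ?x = "fst g Q"
    have x': "?x \<in> A" "A.q ?x = Q" using Q A.g_A A.q_g by auto
    then have x'Z: "?x \<in> Z" using JZ Q by metis
    have X: "x \<in> points X" "?x \<in> points X" using x x' A.A_sub by auto
    show "Q = A.q x"
    proof (rule ccontr)
      assume ne: "Q \<noteq> A.q x"
      have "x \<in> topo X closure_of {?x}"
        unfolding in_closure_of
      proof (intro conjI allI impI)
        fix N assume N: "x \<in> N \<and> opn X N"
        then obtain h where "h \<in> carrier A.R" "x \<in> A.D h" "A.D h \<subseteq> N" using nbhd[of N x] x by blast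
        then have "?x \<in> N" using Q x' by (auto simp: A.D_def)
        then show "\<exists>y. y \<in> {?x} \<and> y \<in> N" by simp
      qed (rule X)
      then have sub: "topo X closure_of {x} \<subseteq> topo X closure_of {?x}" by (intro closure_of_minimal) auto
      obtain h where h: "h \<in> A.q x" "h \<notin> Q" using ne Q by blast
      interpret P: primeideal "A.q x" A.R using A.q_prime[OF x(3)] .
      have hc: "h \<in> carrier A.R" using h by simp
      have "?x \<in> A.D h" "x \<notin> A.D h" using h x x' by (auto simp: A.D_def)
      then have "?x \<notin> topo X closure_of {x}" using A.D_open(1)[OF hc] unfolding in_closure_of by blast
      moreover have "?x \<in> topo X closure_of {?x}" using X by (auto simp: in_closure_of)
      ultimately have "topo X closure_of {x} \<subset> topo X closure_of {?x}" using sub by blast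
      moreover have "topo X closure_of {?x} \<noteq> points X"
        using closure_of_minimal[of "{?x}" Z "topo X"] x'Z Z closedin_subset[OF Z(1)] by auto
      ultimately show False using codim1_maximal[OF _ X] x(1) by (simp add: codim1_points_def)
    qed
  qed
  have "finite {P. A.R.minprime J P}" by (rule A.R.finite_minprimes[OF noeth J])
  then show ?thesis
    by (rule inj_on_finite[where f = A.q, rotated 2]) (use min A.q_inj in \<open>auto simp: inj_on_def\<close>)
qed

lemma (in var) noeth_affine:
  assumes k: "field k" and A: "affine_open X A"
    and S: "finite S" "S \<subseteq> carrier (sect X A)"
      "generate_ring (sect X A) (struc (open_subscheme X A) ` carrier k \<union> S) = carrier (sect X A)"
  shows "cring.noeth (sect X A) (carrier (sect X A))"
proof -
  have oA: "opn X A" using A by (simp add: affine_open_def)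
  interpret R: cring "sect X A" using sect_cring[OF oA] .
  have "struc (open_subscheme X A) \<in> ring_hom k (sect X A)"
    using ring_hom_trans[OF struc_hom restr_hom[of "points X" A]] oA openin_subset[OF oA] by (simp add: comp_def)
  from R.noeth_hom_image_field[OF k this] have "R.noeth (generate_ring (sect X A) (struc (open_subscheme X A) ` carrier k \<union> S))"
    by (rule R.noeth_generate[OF _ _ S(1,2)])
  then show ?thesis unfolding S(3) .
qed

text \<open>Finite type gives finitely many Noetherian charts, and the complement of
  \<open>U\<close> is a proper closed set.\<close>

theorem (in var) finite_codim1:
  assumes k: "field k" and U: "opn X U" "U \<noteq> {}"
  shows "finite (codim1_points (topo X) - U)"
proof -
  obtain \<U> where \<U>: "finite \<U>" "\<Union>\<U> = points X" "\<And>A. A \<in> \<U> \<Longrightarrow> affine_open X A"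
    "\<And>A. A \<in> \<U> \<Longrightarrow> \<exists>S. finite S \<and> S \<subseteq> carrier (sect X A) \<and>
              generate_ring (sect X A) (struc (open_subscheme X A) ` carrier k \<union> S) = carrier (sect X A)"
  proof -
    from variety have "finite_type_over k X" by (simp add: variety_def)
    then show thesis unfolding finite_type_over_def using that by (elim exE conjE) simp
  qed
  have "finite {x \<in> codim1_points (topo X). x \<in> points X - U \<and> x \<in> A}" if A: "A \<in> \<U>" for A
  proof (rule finite_codim1_chart[OF \<U>(3)[OF A]])
    show "cring.noeth (sect X A) (carrier (sect X A))" using \<U>(4)[OF A] noeth_affine[OF k \<U>(3)[OF A]] by blast
    show "closedin (topo X) (points X - U)" using U by blast
    show "points X - U \<noteq> points X" using U openin_subset[OF U(1)] by blast
  qed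
  then have "finite (\<Union>A\<in>\<U>. {x \<in> codim1_points (topo X). x \<in> points X - U \<and> x \<in> A})" using \<U>(1) by simp
  moreover have "codim1_points (topo X) - U \<subseteq> (\<Union>A\<in>\<U>. {x \<in> codim1_points (topo X). x \<in> points X - U \<and> x \<in> A})"
    using \<U>(2) by (auto simp: codim1_points_def)
  ultimately show ?thesis by (rule finite_subset[rotated])
qed

section \<open>Residue fields\<close>

lemma ring_iso_Units:
  assumes R: "cring R" and S: "cring S" and h: "h \<in> ring_iso R S" and a: "a \<in> carrier R"
  shows "h a \<in> Units S \<longleftrightarrow> a \<in> Units R"
proof
  assume "h a \<in> Units S"
  moreover have "inv_into (carrier R) h \<in> ring_iso S R"
    using ring_iso_set_sym[OF _ h] R by (simp add: cring_def)
  ultimately have "inv_into (carrier R) h (h a) \<in> Units R"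
    using cring.units_ring_hom[OF S R] unfolding ring_iso_def by blast
  then show "a \<in> Units R" using h a unfolding ring_iso_def bij_betw_def by simp
next
  assume "a \<in> Units R"
  then show "h a \<in> Units S" using cring.units_ring_hom[OF R S] h unfolding ring_iso_def by blast
qed

text \<open>The kernel of \<open>R \<rightarrow> S \<rightarrow> S/m\<close> is the set of nonunits
  of \<open>R\<close>, because \<open>h\<close> preserves and reflects units; the rest is the first
  isomorphism theorem.\<close>

lemma residue_ring_iso:
  assumes R: "is_local_ring R" and S: "is_local_ring S" and h: "h \<in> ring_iso R S"
  shows "\<exists>h'\<in>ring_iso (R Quot the_max_ideal R) (S Quot the_max_ideal S).
    \<forall>a\<in>carrier R. h' (the_max_ideal R +>\<^bsub>R\<^esub> a) = the_max_ideal S +>\<^bsub>S\<^esub> h a"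
proof -
  interpret R: cring R using R by (simp add: is_local_ring_def)
  interpret S: cring S using S by (simp add: is_local_ring_def)
  interpret M: maximalideal "the_max_ideal S" S by (rule local_ring_max_ideal(1)[OF S])
  have hh: "h \<in> ring_hom R S" "h ` carrier R = carrier S" using h by (auto simp: ring_iso_def bij_betw_def)
  let ?p = "\<lambda>a. the_max_ideal S +>\<^bsub>S\<^esub> h a"
  have p: "?p \<in> ring_hom R (S Quot the_max_ideal S)"
    using ring_hom_trans[OF hh(1) M.rcos_ring_hom] by (simp add: comp_def)
  interpret p: ring_hom_ring R "S Quot the_max_ideal S" ?p
    by (rule ring_hom_ringI2[OF R.ring_axioms M.quotient_is_ring p])
  have "a_kernel R (S Quot the_max_ideal S) ?p = the_max_ideal R"
  proof -
    have "?p a = \<zero>\<^bsub>S Quot the_max_ideal S\<^esub> \<longleftrightarrow> a \<in> the_max_ideal R" if a: "a \<in> carrier R" for a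
    proof -
      have ha: "h a \<in> carrier S" using hh a by blast
      have "?p a = \<zero>\<^bsub>S Quot the_max_ideal S\<^esub> \<longleftrightarrow> h a \<in> the_max_ideal S"
        using M.rcos_const_imp_mem[OF ha] S.a_rcos_zero[OF M.is_ideal] by (auto simp: FactRing_def)
      also have "\<dots> \<longleftrightarrow> a \<in> the_max_ideal R"
        using ring_iso_Units[OF R.is_cring S.is_cring h a] ha a
        by (simp add: local_ring_max_ideal(2)[OF R] local_ring_max_ideal(2)[OF S])
      finally show ?thesis .
    qed
    then show ?thesis
      using local_ring_max_ideal(2)[OF R] unfolding a_kernel_def' by blast
  qed
  note ker = this
  have surj: "?p ` carrier R = carrier (S Quot the_max_ideal S)"
    unfolding FactRing_def A_RCOSETS_def' hh(2)[symmetric] by auto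
  show ?thesis
    using p.FactRing_iso_set[OF surj] p.the_elem_simp unfolding ker by (intro bexI) auto
qed

text \<open>Germs at the image point are pulled back to germs at \<open>x\<close>. A small
  neighbourhood of \<open>x\<close> is the preimage of its own image, and the map on sections over
  it is bijective.\<close>

lemma (in oimm) stalk_iso:
  assumes x: "x \<in> U"
  shows "\<exists>h\<in>ring_iso (stalk Y (fst f x)) (stalk X x).
    \<forall>T s. opn Y T \<longrightarrow> fst f x \<in> T \<longrightarrow> s \<in> carrier (sect Y T) \<longrightarrow>
      h (germ_at Y (fst f x) T s) = germ_at X x (pb U f T) (snd f T s)"
proof -
  let ?y = "fst f x"
  \<comment> \<open>By \<open>eqn\<close> all representatives contribute the same germ, so the union
    is that germ.\<close>
  define h where "h G = (\<Union>(T, s)\<in>G. germ_at X x (pb U f T) (snd f T s))" for G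
  have eqn: "germ_at X x (pb U f T') (snd f T' s') = germ_at X x (pb U f T) (snd f T s)"
    if "(T', s') \<in> germ_at Y ?y T s" "opn Y T" "?y \<in> T" "s \<in> carrier (sect Y T)" for T' s' T s
  proof -
    from that(1) obtain N where N: "opn Y N" "?y \<in> N" "N \<subseteq> T \<inter> T'" "restr Y T N s = restr Y T' N s'"
      and T': "opn Y T'" "?y \<in> T'" "s' \<in> carrier (sect Y T')" unfolding germ_at_def by blast
    have "restr X (pb U f T') (pb U f N) (snd f T' s') = restr X (pb U f T) (pb U f N) (snd f T s)"
      using compat[OF T'(1) N(1) _ T'(3)] compat[OF that(2) N(1) _ that(4)] N by simp
    moreover have "x \<in> pb U f T'" "x \<in> pb U f T" "x \<in> pb U f N" using x T' that N by (auto simp: pb_def)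
    moreover have "pb U f N \<subseteq> pb U f T' \<inter> pb U f T" using N(3) by (auto simp: pb_def)
    ultimately show ?thesis
      using pb_open[OF N(1)]
      by (subst X.germ_eq_iff[OF pb_open[OF T'(1)] _ closed[OF T'(1,3)] pb_open[OF that(2)] _ closed[OF that(2,4)]])
        (auto intro!: exI[of _ "pb U f N"])
  qed
  have h: "h (germ_at Y ?y T s) = germ_at X x (pb U f T) (snd f T s)"
    if "opn Y T" "?y \<in> T" "s \<in> carrier (sect Y T)" for T s
  proof -
    have "(\<Union>(T, s)\<in>germ_at Y ?y T s. germ_at X x (pb U f T) (snd f T s)) = germ_at X x (pb U f T) (snd f T s)"
    proof (rule SUP_eq_const)
      show "germ_at Y ?y T s \<noteq> {}" using Y.germ_self[OF that] by blast
      fix z assume z: "z \<in> germ_at Y ?y T s"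
      obtain T' s' where [simp]: "z = (T', s')" by (metis prod.exhaust)
      show "(case z of (T, s) \<Rightarrow> germ_at X x (pb U f T) (snd f T s)) = germ_at X x (pb U f T) (snd f T s)"
        using eqn[OF z[simplified] that] by simp
    qed
    then show ?thesis unfolding h_def .
  qed
  have "h \<in> ring_iso (stalk Y ?y) (stalk X x)"
  proof -
    have hom: "h \<in> ring_hom (stalk Y ?y) (stalk X x)"
    proof (rule ring_hom_memI)
      fix G assume "G \<in> carrier (stalk Y ?y)"
      then obtain T s where *: "opn Y T" "?y \<in> T" "s \<in> carrier (sect Y T)" "G = germ_at Y ?y T s"
        by (rule Y.stalk_rep)
      then have "x \<in> pb U f T" using x by (simp add: pb_def)
      then show "h G \<in> carrier (stalk X x)" unfolding *(4) h[OF *(1-3)] using * pb_open closed by simp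
    next
      fix G G' assume "G \<in> carrier (stalk Y ?y)" "G' \<in> carrier (stalk Y ?y)"
      then obtain T s s' where *: "opn Y T" "?y \<in> T" "s \<in> carrier (sect Y T)" "s' \<in> carrier (sect Y T)"
        "G = germ_at Y ?y T s" "G' = germ_at Y ?y T s'" by (rule Y.stalk_rep2)
      interpret T: cring "sect Y T" using Y.sect_cring[OF *(1)] .
      have xT: "x \<in> pb U f T" using x * by (simp add: pb_def)
      note o = pb_open[OF *(1)] and c = closed[OF *(1,3)] closed[OF *(1,4)]
      show "h (G \<otimes>\<^bsub>stalk Y ?y\<^esub> G') = h G \<otimes>\<^bsub>stalk X x\<^esub> h G'"
        using * by (simp add: Y.germ_mult h X.germ_mult[OF o xT c] ring_hom_mult[OF hom])
      show "h (G \<oplus>\<^bsub>stalk Y ?y\<^esub> G') = h G \<oplus>\<^bsub>stalk X x\<^esub> h G'"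
        using * by (simp add: Y.germ_add h X.germ_add[OF o xT c] ring_hom_add[OF hom])
    next
      have o: "opn Y (points Y)" "?y \<in> points Y" using point[OF x] by auto
      interpret T: cring "sect Y (points Y)" using Y.sect_cring[OF o(1)] .
      have "x \<in> pb U f (points Y)" using x pb_points by simp
      then show "h \<one>\<^bsub>stalk Y ?y\<^esub> = \<one>\<^bsub>stalk X x\<^esub>"
        unfolding Y.stalk_one[OF o] h[OF o T.one_closed] ring_hom_one[OF hom[OF o(1)]]
        using X.stalk_one[OF pb_open[OF o(1)]] by simp
    qed
    have "inj_on h (carrier (stalk Y ?y))"
    proof (rule inj_onI)
      fix G G' assume "G \<in> carrier (stalk Y ?y)" "G' \<in> carrier (stalk Y ?y)" and eq: "h G = h G'"
      then obtain T s s' where *: "opn Y T" "?y \<in> T" "s \<in> carrier (sect Y T)" "s' \<in> carrier (sect Y T)"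
        "G = germ_at Y ?y T s" "G' = germ_at Y ?y T s'" using Y.stalk_rep2 by metis
      have xT: "x \<in> pb U f T" using x * by (simp add: pb_def)
      have "germ_at X x (pb U f T) (snd f T s) = germ_at X x (pb U f T) (snd f T s')"
        using eq unfolding *(5,6) h[OF *(1-3)] h[OF *(1,2,4)] .
      then obtain N where N: "opn X N" "x \<in> N" "N \<subseteq> pb U f T"
        "restr X (pb U f T) N (snd f T s) = restr X (pb U f T) N (snd f T s')"
        unfolding X.germ_eq_iff[OF pb_open[OF *(1)] xT closed[OF *(1,3)] pb_open[OF *(1)] xT closed[OF *(1,4)]]
        by auto
      have NU: "N \<subseteq> U" using N(3) pb_subset[of U f T] by blast
      note oN = open_image[OF N(1) NU]
      have NT: "fst f ` N \<subseteq> T" using N(3) by (auto simp: pb_def)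
      have "snd f (fst f ` N) (restr Y T (fst f ` N) s) = snd f (fst f ` N) (restr Y T (fst f ` N) s')"
        using compat[OF *(1) oN NT *(3)] compat[OF *(1) oN NT *(4)] pb_image[OF NU] N(4) by simp
      then have "restr Y T (fst f ` N) s = restr Y T (fst f ` N) s'"
        using e_f[OF N(1) NU] * oN NT by (metis Y.restr_closed)
      then show "G = G'"
        unfolding *(5,6) using Y.germ_eq_iff[OF *(1,2,3) *(1,2,4)] oN NT N(2) by blast
    qed
    moreover have "h ` carrier (stalk Y ?y) = carrier (stalk X x)"
    proof
      show "h ` carrier (stalk Y ?y) \<subseteq> carrier (stalk X x)" using ring_hom_closed[OF hom] by blast
      show "carrier (stalk X x) \<subseteq> h ` carrier (stalk Y ?y)"
      proof
        fix G assume "G \<in> carrier (stalk X x)"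
        then obtain N0 t0 where 0: "opn X N0" "x \<in> N0" "t0 \<in> carrier (sect X N0)" "G = germ_at X x N0 t0"
          by (rule X.stalk_rep)
        define N where "N = N0 \<inter> U"
        have N: "opn X N" "x \<in> N" "N \<subseteq> U" "N \<subseteq> N0" using 0 x U by (auto simp: N_def)
        define t where "t = restr X N0 N t0"
        have t: "t \<in> carrier (sect X N)" "G = germ_at X x N t"
          using 0 N X.germ_restr[of N0 N x t0] by (auto simp: t_def)
        have "h (germ_at Y ?y (fst f ` N) (e N t)) = germ_at X x N t"
          using h[OF open_image[OF N(1,3)] _ e_closed[OF N(1,3) t(1)]] N(2) pb_image[OF N(3)] f_e[OF N(1,3) t(1)] by simp
        moreover have "germ_at Y ?y (fst f ` N) (e N t) \<in> carrier (stalk Y ?y)"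
          using open_image[OF N(1,3)] e_closed[OF N(1,3) t(1)] N(2) by simp
        ultimately show "G \<in> h ` carrier (stalk Y ?y)" using t(2) by (metis image_eqI)
      qed
    qed
    ultimately show ?thesis using hom by (simp add: ring_iso_def bij_betw_def)
  qed
  then show ?thesis using h by blast
qed

lemma (in oimm) residue_k_alg_iso:
  assumes x: "x \<in> U"
  shows "k_alg_iso k (residue_field Y (fst f x)) (residue_struc Y (fst f x)) (residue_field X x) (residue_struc X x)"
proof -
  let ?y = "fst f x"
  have X: "x \<in> points X" "?y \<in> points Y" using x point openin_subset[OF U] by auto
  obtain h where h: "h \<in> ring_iso (stalk Y ?y) (stalk X x)"
    "\<And>T s. opn Y T \<Longrightarrow> ?y \<in> T \<Longrightarrow> s \<in> carrier (sect Y T) \<Longrightarrow>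
      h (germ_at Y ?y T s) = germ_at X x (pb U f T) (snd f T s)" using stalk_iso[OF x] by blast
  obtain h' where h': "h' \<in> ring_iso (stalk Y ?y Quot the_max_ideal (stalk Y ?y)) (stalk X x Quot the_max_ideal (stalk X x))"
    "\<And>a. a \<in> carrier (stalk Y ?y) \<Longrightarrow>
      h' (the_max_ideal (stalk Y ?y) +>\<^bsub>stalk Y ?y\<^esub> a) = the_max_ideal (stalk X x) +>\<^bsub>stalk X x\<^esub> h a"
    using residue_ring_iso[OF Y.stalk_local[OF X(2)] X.stalk_local[OF X(1)] h(1)] by blast
  have "h' (residue_struc Y ?y a) = residue_struc X x a" if a: "a \<in> carrier k" for a
  proof -
    have s: "struc Y a \<in> carrier (sect Y (points Y))" "struc X a \<in> carrier (sect X (points X))"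
      using Y.struc_closed[OF a] X.struc_closed[OF a] by auto
    have "h (germ_at Y ?y (points Y) (struc Y a)) = germ_at X x U (restr X (points X) U (struc X a))"
      using h(2)[of "points Y" "struc Y a"] X(2) s pb_points struc[OF a] by simp
    also have "\<dots> = germ_at X x (points X) (struc X a)"
      using X.germ_restr[of "points X" U x "struc X a"] U x s openin_subset[OF U] by simp
    finally show ?thesis
      unfolding residue_struc_def using h'(2) s X(2) by simp
  qed
  then show ?thesis unfolding k_alg_iso_def residue_field_def using h'(1) by blast
qed

lemma k_alg_iso_trans:
  "k_alg_iso k A \<alpha> B \<beta> \<Longrightarrow> k_alg_iso k B \<beta> C \<gamma> \<Longrightarrow> k_alg_iso k A \<alpha> C \<gamma>"
  unfolding k_alg_iso_def using ring_iso_set_trans by (metis comp_apply)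

text \<open>
  Like \<open>residue_class\<close>, but for a variety whose types are unrelated to those of the varieties
  constituting the class; this is what allows comparing \<open>X\<close> with \<open>X'\<close>.
\<close>

definition gclass :: "'k ring \<Rightarrow> ('y, 's, 'k) k_space \<Rightarrow> 'y \<Rightarrow> ('a, 'b, 'k) k_space set" where
  "gclass k Y y = {V. variety k V \<and>
     k_alg_iso k (residue_field V (generic_point V)) (residue_struc V (generic_point V))
       (residue_field Y y) (residue_struc Y y)}"

text \<open>Each inclusion composes with an isomorphism of residue fields; the one in the opposite
  direction comes from the inverse immersion.\<close>

lemma (in oimm) gclass_image:
  assumes x: "x \<in> U" shows "gclass k Y (fst f x) = gclass k X x"
proof -
  interpret g: oimm k Y X V finv by (rule oimm.intro[OF kmor_finv oimm_axioms.intro[OF oi_finv]])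
  have "k_alg_iso k (residue_field X x) (residue_struc X x) (residue_field Y (fst f x)) (residue_struc Y (fst f x))"
    using g.residue_k_alg_iso[of "fst f x"] x fst_finv by simp
  then show ?thesis
    unfolding gclass_def
    by (intro Collect_cong conj_cong refl iffI)
      (erule k_alg_iso_trans, (rule residue_k_alg_iso[OF x] | assumption))+
qed

section \<open>The homomorphism \<open>c\<close>\<close>

text \<open>Unlike in \<open>c_map\<close>, the two varieties may have different types, and the
  types \<open>'a\<close>, \<open>'b\<close> of the classes are independent of both. So the values
  for maps among \<open>X\<close> and \<open>X'\<close> lie in one group and can be added.\<close>

definition c_gen ::
    "'k ring \<Rightarrow> ('x, 'r, 'k) k_space \<Rightarrow> ('y, 's, 'k) k_space \<Rightarrow>
     ('x, 'r, 'y, 's) rat_map \<Rightarrow> ('a, 'b, 'k) k_space set \<Rightarrow>\<^sub>0 int" where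
  "c_gen k X Y \<phi> =
     (\<Sum>y\<in>codim1_points (topo Y) \<inter> exc_locus k Y X (birational_inv k X Y \<phi>). frag_of (gclass k Y y)) -
     (\<Sum>x\<in>codim1_points (topo X) \<inter> exc_locus k X Y \<phi>. frag_of (gclass k X x))"

lemma c_map_eq_c_gen:
  fixes X Y :: "('x, 'r, 'k) k_space"
  shows "c_map k X Y \<phi> = c_gen k X Y \<phi>"
proof -
  have *: "{y \<in> exc_locus k Z Z' \<psi>. codim_point (topo Z) y = 1} = codim1_points (topo Z) \<inter> exc_locus k Z Z' \<psi>"
    for Z Z' :: "('x, 'r, 'k) k_space" and \<psi> by (auto simp: codim1_points_def exc_locus_def)
  show ?thesis unfolding c_map_def c_gen_def * residue_class_def gclass_def ..
qed

lemma iso_at_iff: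
  assumes X: "var k X" and Y: "var k Y" and \<phi>: "rational_map k X Y \<phi>"
  shows "iso_at k X Y \<phi> x \<longleftrightarrow> (\<exists>U f. (U, f) \<in> \<phi> \<and> x \<in> U \<and> oimm k X Y U f)"
proof -
  have "open_immersion k (open_subscheme X U) Y f \<longleftrightarrow> oimm k X Y U f" if "(U, f) \<in> \<phi>" for U f
    using kmor.open_immersion_iff[OF rat_class(2)[OF X Y \<phi> that]] rat_class(2)[OF X Y \<phi> that]
    by (auto simp: oimm_def oimm_axioms_def)
  moreover have "iso_at k X Y \<phi> x \<longleftrightarrow>
      (\<exists>U f. (U, f) \<in> \<phi> \<and> x \<in> U \<and> open_immersion k (open_subscheme X U) Y f)"
    unfolding iso_at_def by (metis (no_types, lifting) case_prodE case_prodI)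
  ultimately show ?thesis by blast
qed

section \<open>Points at which a birational map is an isomorphism\<close>

locale bir_map =
  fixes k :: "'k ring" and X :: "('x, 'r, 'k) k_space" and Y :: "('y, 's, 'k) k_space" and \<phi>
  assumes X: "var k X" and Y: "var k Y" and \<phi>: "birational_map k X Y \<phi>"
begin

definition iso_pts :: "'x set" where "iso_pts = {x. \<exists>U f. (U, f) \<in> \<phi> \<and> x \<in> U \<and> oimm k X Y U f}"

definition pt :: "'x \<Rightarrow> 'y" where
  "pt x = (SOME y. \<exists>U f. (U, f) \<in> \<phi> \<and> x \<in> U \<and> oimm k X Y U f \<and> y = fst f x)"

lemma rational: "rational_map k X Y \<phi>" by (rule birational_rational[OF X Y \<phi>])

lemma exc_locus_eq: "exc_locus k X Y \<phi> = points X - iso_pts"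
  unfolding exc_locus_def iso_pts_def iso_at_iff[OF X Y rational] by blast

lemma sub_iso_pts: "(U, f) \<in> \<phi> \<Longrightarrow> oimm k X Y U f \<Longrightarrow> U \<subseteq> iso_pts"
  unfolding iso_pts_def by blast

text \<open>Makes the choice in \<open>pt\<close> harmless: two immersions in \<open>\<phi>\<close>
  agree on a nonempty open set, hence by separatedness at every common point of their
  domains.\<close>

lemma pt_eq:
  assumes "(U, f) \<in> \<phi>" "oimm k X Y U f" "x \<in> U" shows "pt x = fst f x"
proof -
  have "\<exists>V g. (V, g) \<in> \<phi> \<and> x \<in> V \<and> oimm k X Y V g \<and> pt x = fst g x"
    unfolding pt_def by (rule someI[of _ "fst f x"]) (use assms in blast)
  then obtain V g where g: "(V, g) \<in> \<phi>" "x \<in> V" "oimm k X Y V g" "pt x = fst g x" by blast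
  obtain W where W: "W \<noteq> {}" "agree X Y V g U f W" using rat_mem_iff[OF X Y rational g(1)] assms(1) by blast
  have "fst g x = fst f x"
    by (rule agree_points[OF oimm.axioms(1)[OF g(3)] oimm.axioms(1)[OF assms(2)] W(2,1) g(2) assms(3)])
  then show ?thesis using g(4) by simp
qed

lemma pt_props:
  assumes "x \<in> iso_pts"
  shows "codim_point (topo Y) (pt x) = codim_point (topo X) x" "gclass k Y (pt x) = gclass k X x"
    "x \<in> points X" "pt x \<in> points Y"
proof -
  from assms obtain U f where f: "(U, f) \<in> \<phi>" "x \<in> U" "oimm k X Y U f" unfolding iso_pts_def by blast
  interpret f: oimm k X Y U f by (rule f)
  show "codim_point (topo Y) (pt x) = codim_point (topo X) x" "gclass k Y (pt x) = gclass k X x"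
    "x \<in> points X" "pt x \<in> points Y"
    unfolding pt_eq[OF f(1,3,2)]
    using f.codim_point_image[OF f(2)] f.gclass_image[OF f(2)] f.point[OF f(2)] f(2) openin_subset[OF f.U] by auto
qed

end

lemma bir_map_inv:
  assumes "bir_map k X Y \<phi>" shows "bir_map k Y X (birational_inv k X Y \<phi>)"
  using assms birational_inv(1) unfolding bir_map_def by blast

lemma (in bir_map) pt_inv:
  assumes "x \<in> iso_pts"
  shows "pt x \<in> bir_map.iso_pts k Y X (birational_inv k X Y \<phi>)"
    "bir_map.pt k Y X (birational_inv k X Y \<phi>) (pt x) = x"
proof -
  interpret i: bir_map k Y X "birational_inv k X Y \<phi>" by (rule bir_map_inv[OF bir_map_axioms])
  from assms obtain U f where f: "(U, f) \<in> \<phi>" "x \<in> U" "oimm k X Y U f" unfolding iso_pts_def by blast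
  interpret f: oimm k X Y U f by (rule f)
  have m: "(f.V, f.finv) \<in> birational_inv k X Y \<phi>" by (rule birational_inv_rep(4)[OF X Y \<phi> f(1,3)])
  have o: "oimm k Y X f.V f.finv" by (rule oimm.intro[OF f.kmor_finv oimm_axioms.intro[OF f.oi_finv]])
  have p: "pt x = fst f x" by (rule pt_eq[OF f(1,3,2)])
  show "pt x \<in> i.iso_pts" using i.sub_iso_pts[OF m o] f(2) unfolding p by blast
  show "i.pt (pt x) = x" unfolding p using i.pt_eq[OF m o] f(2) f.fst_finv by simp
qed

text \<open>\<open>i.pt\<close> inverts \<open>pt\<close>, as the inverse of the inverse is
  \<open>\<phi>\<close>.\<close>

lemma (in bir_map) bij_pt:
  "bij_betw pt iso_pts (bir_map.iso_pts k Y X (birational_inv k X Y \<phi>))"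
proof -
  interpret i: bir_map k Y X "birational_inv k X Y \<phi>" by (rule bir_map_inv[OF bir_map_axioms])
  note ii = birational_inv(4)[OF X Y \<phi>]
  show ?thesis
    by (rule bij_betw_byWitness[where f' = i.pt])
      (use pt_inv i.pt_inv[unfolded ii] in auto)
qed

text \<open>
  The open set on which \<open>c \<phi>\<close> is computed may be shrunk at will: the points thereby added to
  both sums correspond to each other under \<open>\<phi>\<close> and have the same classes.
\<close>

theorem (in bir_map) c_gen_rep:
  assumes k: "field k" and f: "(U, f) \<in> \<phi>" "oimm k X Y U f"
  shows "c_gen k X Y \<phi> =
     (\<Sum>y\<in>codim1_points (topo Y) - fst f ` U. frag_of (gclass k Y y :: ('a, 'b, 'k) k_space set)) -
     (\<Sum>x\<in>codim1_points (topo X) - U. frag_of (gclass k X x))"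
proof -
  let ?gX = "gclass k X :: 'x \<Rightarrow> ('a, 'b, 'k) k_space set" and ?gY = "gclass k Y :: 'y \<Rightarrow> ('a, 'b, 'k) k_space set"
  interpret i: bir_map k Y X "birational_inv k X Y \<phi>" by (rule bir_map_inv[OF bir_map_axioms])
  interpret f: oimm k X Y U f by (rule f)
  have U0: "U \<noteq> {}" by (rule rat_class(3)[OF X Y rational f(1)])
  let ?P = "codim1_points (topo X)" and ?Q = "codim1_points (topo Y)"
  have UI: "U \<subseteq> iso_pts" by (rule sub_iso_pts[OF f])
  have ptU: "pt ` U = f.V" using pt_eq[OF f] by auto
  have VI: "f.V \<subseteq> i.iso_pts" unfolding ptU[symmetric] using UI pt_inv(1) by auto
  \<comment> \<open>Splitting off the points matched by \<open>pt\<close> needs finite index sets,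
    since sums over infinite sets are 0 by convention.\<close>
  have finX: "finite (?P - U)" by (rule f.X.finite_codim1[OF k f.U U0])
  have finY: "finite (?Q - f.V)" by (rule f.Y.finite_codim1[OF k f.V_open]) (use U0 in simp)
  have bij: "bij_betw pt (?P \<inter> iso_pts - U) (?Q \<inter> i.iso_pts - f.V)"
  proof -
    have inj: "inj_on pt iso_pts" and img: "pt ` iso_pts = i.iso_pts" using bij_pt by (auto simp: bij_betw_def)
    have "pt ` (?P \<inter> iso_pts - U) = ?Q \<inter> i.iso_pts - f.V"
    proof -
      have "pt x \<in> ?Q \<longleftrightarrow> x \<in> ?P" if "x \<in> iso_pts" for x
        using pt_props(1,3,4)[OF that] by (simp add: codim1_points_def)
      then have "pt ` (?P \<inter> iso_pts) = ?Q \<inter> pt ` iso_pts" by blast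
      then have "pt ` (?P \<inter> iso_pts) = ?Q \<inter> i.iso_pts" unfolding img .
      moreover have "pt ` (?P \<inter> iso_pts - U) = pt ` (?P \<inter> iso_pts) - pt ` U"
        by (rule inj_on_image_set_diff[OF inj]) (use UI in auto)
      ultimately show ?thesis unfolding ptU by simp
    qed
    then show ?thesis unfolding bij_betw_def by (intro conjI inj_on_subset[OF inj]) auto
  qed
  \<comment> \<open>These are the terms by which the sums outside \<open>U\<close> and its image
    exceed those over the exceptional loci; they cancel in the difference.\<close>
  have eq: "(\<Sum>x\<in>?P \<inter> iso_pts - U. frag_of (?gX x)) = (\<Sum>y\<in>?Q \<inter> i.iso_pts - f.V. frag_of (?gY y))"
    using sum.reindex_bij_betw[OF bij, of "\<lambda>y. frag_of (?gY y)"] by (simp add: pt_props(2))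
  have "(\<Sum>x\<in>?P - U. frag_of (?gX x)) =
      (\<Sum>x\<in>?P \<inter> exc_locus k X Y \<phi>. frag_of (?gX x)) + (\<Sum>x\<in>?P \<inter> iso_pts - U. frag_of (?gX x))"
  proof -
    have "?P - U = ?P \<inter> exc_locus k X Y \<phi> \<union> (?P \<inter> iso_pts - U)" "?P \<inter> exc_locus k X Y \<phi> \<inter> (?P \<inter> iso_pts - U) = {}"
      unfolding exc_locus_eq codim1_points_def using UI by auto
    then show ?thesis using sum.union_disjoint[of "?P \<inter> exc_locus k X Y \<phi>" "?P \<inter> iso_pts - U"] finX
      by (metis finite_Un)
  qed
  moreover have "(\<Sum>y\<in>?Q - f.V. frag_of (?gY y)) =
      (\<Sum>y\<in>?Q \<inter> exc_locus k Y X (birational_inv k X Y \<phi>). frag_of (?gY y)) +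
      (\<Sum>y\<in>?Q \<inter> i.iso_pts - f.V. frag_of (?gY y))"
  proof -
    have "?Q - f.V = ?Q \<inter> exc_locus k Y X (birational_inv k X Y \<phi>) \<union> (?Q \<inter> i.iso_pts - f.V)"
      "?Q \<inter> exc_locus k Y X (birational_inv k X Y \<phi>) \<inter> (?Q \<inter> i.iso_pts - f.V) = {}"
      unfolding i.exc_locus_eq codim1_points_def using VI by auto
    then show ?thesis
      using sum.union_disjoint[of "?Q \<inter> exc_locus k Y X (birational_inv k X Y \<phi>)" "?Q \<inter> i.iso_pts - f.V"] finY
      by (metis finite_Un)
  qed
  ultimately show ?thesis unfolding c_gen_def using eq by simp
qed

text \<open>Shrink the domain of \<open>f\<close> to \<open>U'\<close> so that its image
  \<open>V'\<close> lies in the domain of \<open>g\<close>. The three classes are then computed with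
  \<open>U'\<close>, \<open>V'\<close> and the image of \<open>V'\<close> under \<open>g\<close>,
  and the sum over the points of \<open>Y\<close> outside \<open>V'\<close> cancels.\<close>

theorem c_gen_comp:
  assumes k: "field k" and X: "var k X" and Y: "var k Y" and Z: "var k Z"
    and \<phi>: "birational_map k X Y \<phi>" and \<psi>: "birational_map k Y Z \<psi>"
  shows "c_gen k X Z (rat_comp k X Y Z \<psi> \<phi>) =
    (c_gen k Y Z \<psi> + c_gen k X Y \<phi> :: ('a, 'b, 'k) k_space set \<Rightarrow>\<^sub>0 int)"
proof -
  note \<phi>r = birational_rational[OF X Y \<phi>] and \<psi>r = birational_rational[OF Y Z \<psi>]
  obtain U f where f: "(U, f) \<in> \<phi>" "oimm k X Y U f" using birational_oimm[OF X Y \<phi>] by blast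
  obtain V g where g: "(V, g) \<in> \<psi>" "oimm k Y Z V g" using birational_oimm[OF Y Z \<psi>] by blast
  interpret f: oimm k X Y U f by (rule f)
  interpret g: oimm k Y Z V g by (rule g)
  define U' where "U' = pb U f V"
  define V' where "V' = fst f ` U'"
  have U': "opn X U'" "U' \<subseteq> U" "U' \<noteq> {}"
    using f.pb_open[OF g.U] pb_subset[of U f V]
      birational_dominant[OF X Y \<phi> f(1) g.U rat_class(3)[OF Y Z \<psi>r g(1)]] by (simp_all add: U'_def)
  have V': "opn Y V'" "V' \<subseteq> V" "V' \<noteq> {}"
    using f.open_image[OF U'(1,2)] U'(3) by (auto simp: V'_def U'_def pb_def)
  let ?gX = "gclass k X :: _ \<Rightarrow> ('a, 'b, 'k) k_space set" and ?gY = "gclass k Y :: _ \<Rightarrow> ('a, 'b, 'k) k_space set"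
    and ?gZ = "gclass k Z :: _ \<Rightarrow> ('a, 'b, 'k) k_space set"
  have "c_gen k X Y \<phi> = (\<Sum>y\<in>codim1_points (topo Y) - V'. frag_of (?gY y)) -
     (\<Sum>x\<in>codim1_points (topo X) - U'. frag_of (?gX x))"
    using bir_map.c_gen_rep[OF bir_map.intro[OF X Y \<phi>] k rat_restrict_mem[OF X Y \<phi>r f(1) U'] f.oimm_restrict[OF U'(1,2)]]
    by (simp add: V'_def)
  moreover have "c_gen k Y Z \<psi> = (\<Sum>z\<in>codim1_points (topo Z) - fst g ` V'. frag_of (?gZ z)) -
     (\<Sum>y\<in>codim1_points (topo Y) - V'. frag_of (?gY y))"
    using bir_map.c_gen_rep[OF bir_map.intro[OF Y Z \<psi>] k rat_restrict_mem[OF Y Z \<psi>r g(1) V'] g.oimm_restrict[OF V'(1,2)]]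
    by simp
  moreover have "c_gen k X Z (rat_comp k X Y Z \<psi> \<phi>) =
     (\<Sum>z\<in>codim1_points (topo Z) - fst g ` V'. frag_of (?gZ z)) -
     (\<Sum>x\<in>codim1_points (topo X) - U'. frag_of (?gX x))"
  proof -
    have "fst (rcomp X Y U f V g) ` U' = fst g ` V'" by (auto simp: V'_def image_iff)
    then show ?thesis
      using bir_map.c_gen_rep[OF bir_map.intro[OF X Z birational_comp[OF X Y Z \<phi> \<psi>]] k
          rat_comp_mem(1)[OF X Y Z \<phi> \<psi>r f(1) g(1)] oimm_rcomp[OF f(2) g(2)]]
      by (simp add: U'_def)
  qed
  ultimately show ?thesis by simp
qed

text \<open>Additivity applied to \<open>id \<circ> id = id\<close> gives a value equal to its own
  double.\<close>

lemma c_gen_id: assumes "field k" "var k X" shows "c_gen k X X (rat_id k X) = 0"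
  using c_gen_comp[OF assms assms(2) assms(2) birational_id[OF assms(2)] birational_id[OF assms(2)]]
  by (simp add: rat_comp_id_left[OF assms(2,2) birational_id[OF assms(2)]])

lemma c_gen_inv:
  assumes k: "field k" and X: "var k X" and Y: "var k Y" and \<phi>: "birational_map k X Y \<phi>"
  shows "c_gen k Y X (birational_inv k X Y \<phi>) = - c_gen k X Y \<phi>"
  using c_gen_comp[OF k X Y X \<phi> birational_inv(1)[OF X Y \<phi>]]
  by (simp add: eq_neg_iff_add_eq_0 birational_inv(2)[OF X Y \<phi>] c_gen_id[OF k X])

text \<open>The exceptional locus is closed, so it contains the closure of each of its points. A
  point of codimension one in it would contribute the value 1 to the infimum that defines
  \<open>codim_closed\<close>.\<close>

lemma no_codim1_points:
  assumes X: "var k X" and \<phi>: "birational_map k X X \<phi>" and codim: "codim_closed (topo X) (exc_locus k X X \<phi>) \<ge> 2"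
  shows "codim1_points (topo X) \<inter> exc_locus k X X \<phi> = {}"
proof (rule ccontr)
  interpret b: bir_map k X X \<phi> by (rule bir_map.intro[OF X X \<phi>])
  assume "codim1_points (topo X) \<inter> exc_locus k X X \<phi> \<noteq> {}"
  then obtain x where x: "x \<in> codim1_points (topo X)" "x \<in> exc_locus k X X \<phi>" by blast
  have "openin (topo X) b.iso_pts"
  proof (subst openin_subopen, intro ballI)
    fix y assume "y \<in> b.iso_pts"
    then obtain U f where f: "(U, f) \<in> \<phi>" "y \<in> U" "oimm k X X U f" unfolding b.iso_pts_def by blast
    interpret f: oimm k X X U f by (rule f)
    show "\<exists>T. opn X T \<and> y \<in> T \<and> T \<subseteq> b.iso_pts" using b.sub_iso_pts[OF f(1,3)] f(2) f.U by blast
  qed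
  then have "closedin (topo X) (exc_locus k X X \<phi>)" unfolding b.exc_locus_eq by blast
  then have "topo X closure_of {x} \<subseteq> exc_locus k X X \<phi>" using x by (intro closure_of_minimal) auto
  moreover have "irreducible_closed (topo X) (topo X closure_of {x})"
    using irreducible_closure_of_point x by (auto simp: codim1_points_def)
  ultimately have "codim_closed (topo X) (exc_locus k X X \<phi>) \<le> codim_irred (topo X) (topo X closure_of {x})"
    unfolding codim_closed_def by (intro Inf_lower) blast
  also have "\<dots> = 1" using x(1) by (simp add: codim1_points_def codim_point_def)
  finally have "(2::enat) \<le> 1" using codim order.trans by blast
  then show False by simp
qed

lemma c_gen_pseudo_automorphism:
  assumes X: "var k X" and \<gamma>: "pseudo_automorphism k X \<gamma>"
  shows "birational_map k X X \<gamma>" "c_gen k X X \<gamma> = 0"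
proof -
  show b: "birational_map k X X \<gamma>" using \<gamma> by (simp add: pseudo_automorphism_def Bir_def)
  show "c_gen k X X \<gamma> = 0"
    unfolding c_gen_def
    using no_codim1_points[OF X b] no_codim1_points[OF X birational_inv(1)[OF X X b]] \<gamma>
    by (simp add: pseudo_automorphism_def)
qed

lemma c_gen_pseudo_regularizable:
  fixes X :: "('x, 'r, 'k) k_space"
  assumes k: "field k" and X: "var k X" and \<phi>: "pseudo_regularizable TYPE('y \<times> 's) k X \<phi>"
  shows "c_gen k X X \<phi> = 0"
proof -
  from \<phi> obtain X' :: "('y, 's, 'k) k_space" and \<alpha> \<gamma> where
    *: "variety k X'" "birational_map k X X' \<alpha>" "pseudo_automorphism k X' \<gamma>"
      "\<phi> = rat_comp k X X' X (birational_inv k X X' \<alpha>) (rat_comp k X X' X' \<gamma> \<alpha>)"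
    unfolding pseudo_regularizable_def by blast
  have X': "var k X'" using *(1) by unfold_locales
  note \<gamma> = c_gen_pseudo_automorphism[OF X' *(3)]
  show ?thesis
    unfolding *(4) c_gen_comp[OF k X X' X birational_comp[OF X X' X' *(2) \<gamma>(1)] birational_inv(1)[OF X X' *(2)]]
      c_gen_comp[OF k X X' X' *(2) \<gamma>(1)] \<gamma>(2) c_gen_inv[OF k X X' *(2)] by simp
qed

theorem lemma4p3:
  fixes k :: "'k ring" and X :: "('x, 'r, 'k) k_space"
  assumes "field k" and "variety k X"
  shows "Bir_preg TYPE('y \<times> 's) k X \<subseteq>
    kernel (Bir k X) (free_Abelian_group (Bir_classes k (krull_dim (topo X) - 1))) (c_map k X X)"
proof -
  have X: "var k X" using assms(2) by unfold_locales
  \<comment> \<open>In the free group on all sets of models, membership of the values is immediate.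
    The kernel depends on the codomain only through its zero, so it is the same for the group in the
    statement.\<close>
  interpret c: group_hom "Bir k X" "free_Abelian_group UNIV" "c_map k X X"
  proof (rule group_hom.intro[OF group_Bir[OF X] group_free_Abelian_group], rule group_hom_axioms.intro)
    show "c_map k X X \<in> hom (Bir k X) (free_Abelian_group UNIV)"
      by (rule homI) (auto simp: Bir_def c_map_eq_c_gen c_gen_comp[OF assms(1) X X X])
  qed
  let ?K = "kernel (Bir k X) (free_Abelian_group UNIV) (c_map k X X)"
  have "{\<phi>. pseudo_regularizable TYPE('y \<times> 's) k X \<phi>} \<subseteq> ?K"
  proof
    fix \<phi> assume "\<phi> \<in> {\<phi>. pseudo_regularizable TYPE('y \<times> 's) k X \<phi>}"
    then have \<phi>: "pseudo_regularizable TYPE('y \<times> 's) k X \<phi>" by simp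
    then have "\<phi> \<in> carrier (Bir k X)" by (simp add: pseudo_regularizable_def)
    then show "\<phi> \<in> ?K"
      using c_gen_pseudo_regularizable[OF assms(1) X \<phi>] by (simp add: kernel_def c_map_eq_c_gen)
  qed
  \<comment> \<open>A kernel is a normal subgroup, hence one of those intersected in
    \<open>normal_closure\<close>.\<close>
  then have "Bir_preg TYPE('y \<times> 's) k X \<subseteq> ?K"
    unfolding Bir_preg_def normal_closure_def using c.normal_kernel by blast
  then show ?thesis by (simp add: kernel_def)
qed

end
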